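(* Let $n\geq2$ and $k\geq2$ be integers, and let $\gamma:[0,1]\to\mathbf{R}^n$ be an immersed $H^2$-curve with a point of multiplicity $k$. Then $$\bar{B}[\gamma]\geq \varpi^*(k-1)^2.$$ In particular, if an immersed $H^2$-curve $\gamma:[0,1]\to\mathbf{R}^n$ satisfies $\bar{B}[\gamma]<\varpi^*$, then $\gamma$ is embedded (injective); the threshold $\varpi^*$ is optimal, since a half-fold figure-eight elastica is a non-embedded immersed curve with $\bar{B}=\varpi^*$.
   Context: $H^2=W^{2,2}$, and $H^2\hookrightarrow C^1$, so a curve is immersed if $\gamma'\neq0$ everywhere. For an immersed $H^2$-curve $\gamma$ let $\partial_s:=\frac{1}{|\gamma'|}\partial_x$, $ds=|\gamma'|dx$, $\kappa:=\partial_s^2\gamma$, $L[\gamma]:=\int_\gamma ds$, $B[\gamma]:=\int_\gamma|\kappa|^2ds$, $\bar{B}[\gamma]:=L[\gamma]B[\gamma]$. A curve $\gamma$ has a point $p$ of multiplicity $k$ if $\gamma^{-1}(p)$ contains at least $k$ distinct points. For $m\in(0,1)$ let $F(x,m)=\int_0^x\frac{d\theta}{\sqrt{1-m\sin^2\theta}}$, $K(m)=F(\pi/2,m)$, $E(m)=\int_0^{\pi/2}\sqrt{1-m\sin^2\theta}\,d\theta$, $\operatorname{am}(\cdot,m):=F^{-1}(\cdot,m)$ on $\mathbf{R}$, $\operatorname{cn}(x,m):=\cos(\operatorname{am}(x,m))$. Let $m^*\in(0,1)$ be the unique parameter with $K(m^* )=2E(m^* )$, and $\varpi^*:=32(2m^*-1)E(m^*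 )^2$. A half-fold figure-eight elastica is an immersed curve $\gamma:[a,b]\to\mathbf{R}^n$ that is contained in a plane and whose signed curvature in that plane, as a function of arclength $s\in[0,L]$ ($L$ its length), is up to the choice of sign $\mathrm{k}(s)=2\sqrt{m^*}\Lambda\operatorname{cn}(\Lambda s-K(m^* ),m^* )$ with $\Lambda=2K(m^* )/L$. *)

theory Defs
  imports "HOL-Analysis.Analysis"
begin

section \<open>The Sobolev space W^{2,2} on a bounded interval\<close>

text \<open>
  Weak derivatives on the bounded open interval \<open>(a,b)\<close>, tested against \<open>C\<^sup>1\<close> functions with
  compact support in \<open>(a,b)\<close> (as in Brezis, Functional Analysis, Sobolev Spaces and PDE,
  Section 8.2).
\<close>

definition test_function :: "real \<Rightarrow> real \<Rightarrow> (real \<Rightarrow> real) \<Rightarrow> bool" where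
  "test_function a b \<phi> \<longleftrightarrow>
     \<phi> C1_differentiable_on UNIV \<and> closure {x. \<phi> x \<noteq> 0} \<subseteq> {a<..<b}"

definition has_weak_derivative ::
  "real \<Rightarrow> real \<Rightarrow> (real \<Rightarrow> 'a::euclidean_space) \<Rightarrow> (real \<Rightarrow> 'a) \<Rightarrow> bool" where
  "has_weak_derivative a b f g \<longleftrightarrow>
     integrable (lebesgue_on {a<..<b}) f \<and>
     integrable (lebesgue_on {a<..<b}) g \<and>
     (\<forall>\<phi>. test_function a b \<phi> \<longrightarrow>
        (LINT x|lebesgue_on {a<..<b}. deriv \<phi> x *\<^sub>R f x) =
        - (LINT x|lebesgue_on {a<..<b}. \<phi> x *\<^sub>R g x))"

text \<open>A representative of the weak derivative, which is unique only up to null sets.\<close>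

definition weak_deriv ::
  "real \<Rightarrow> real \<Rightarrow> (real \<Rightarrow> 'a::euclidean_space) \<Rightarrow> real \<Rightarrow> 'a" where
  "weak_deriv a b f = (SOME g. has_weak_derivative a b f g)"

definition L2_on :: "real \<Rightarrow> real \<Rightarrow> (real \<Rightarrow> 'a::euclidean_space) \<Rightarrow> bool" where
  "L2_on a b f \<longleftrightarrow>
     f \<in> borel_measurable (lebesgue_on {a<..<b}) \<and>
     integrable (lebesgue_on {a<..<b}) (\<lambda>x. (norm (f x))\<^sup>2)"

definition W22_on :: "real \<Rightarrow> real \<Rightarrow> (real \<Rightarrow> 'a::euclidean_space) \<Rightarrow> bool" where
  "W22_on a b f \<longleftrightarrow>
     (\<exists>g h. L2_on a b f \<and> L2_on a b g \<and> L2_on a b h \<and>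
            has_weak_derivative a b f g \<and> has_weak_derivative a b g h)"


section \<open>Immersed H^2-curves\<close>

text \<open>
  A curve \<open>[a,b] \<rightarrow> \<real>\<^sup>n\<close> is a total function of which only the values on \<open>{a..b}\<close> matter.
  Derivatives at the end points are one-sided.
\<close>

definition curve_deriv ::
  "real \<Rightarrow> real \<Rightarrow> (real \<Rightarrow> 'a::euclidean_space) \<Rightarrow> real \<Rightarrow> 'a" where
  "curve_deriv a b \<gamma> x = vector_derivative \<gamma> (at x within {a..b})"

text \<open>
  Continuity on \<open>{a..b}\<close> selects the representative of the Sobolev class; by the embedding of
  \<open>H\<^sup>2\<close> into \<open>C\<^sup>1\<close> this representative is continuously differentiable on \<open>{a..b}\<close>, so that the
  pointwise derivative below is meaningful everywhere.
\<close>

definition immersed_H2_curve :: "real \<Rightarrow> real \<Rightarrow> (real \<Rightarrow> 'a::euclidean_space) \<Rightarrow> bool" where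
  "immersed_H2_curve a b \<gamma> \<longleftrightarrow>
     a < b \<and> continuous_on {a..b} \<gamma> \<and> W22_on a b \<gamma> \<and>
     (\<forall>x\<in>{a..b}. curve_deriv a b \<gamma> x \<noteq> 0)"

definition speed :: "real \<Rightarrow> real \<Rightarrow> (real \<Rightarrow> 'a::euclidean_space) \<Rightarrow> real \<Rightarrow> real" where
  "speed a b \<gamma> x = norm (curve_deriv a b \<gamma> x)"

definition unit_tangent :: "real \<Rightarrow> real \<Rightarrow> (real \<Rightarrow> 'a::euclidean_space) \<Rightarrow> real \<Rightarrow> 'a" where
  "unit_tangent a b \<gamma> x = (1 / speed a b \<gamma> x) *\<^sub>R curve_deriv a b \<gamma> x"

text \<open>
  The curvature vector is the second arclength derivative.  The unit tangent of an immersed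
  \<open>H\<^sup>2\<close>-curve is only an \<open>H\<^sup>1\<close> function, so it is differentiated weakly and the curvature is
  determined almost everywhere.
\<close>

definition curvature :: "real \<Rightarrow> real \<Rightarrow> (real \<Rightarrow> 'a::euclidean_space) \<Rightarrow> real \<Rightarrow> 'a" where
  "curvature a b \<gamma> x = (1 / speed a b \<gamma> x) *\<^sub>R weak_deriv a b (unit_tangent a b \<gamma>) x"

definition curve_length :: "real \<Rightarrow> real \<Rightarrow> (real \<Rightarrow> 'a::euclidean_space) \<Rightarrow> real" where
  "curve_length a b \<gamma> = (LINT x|lebesgue_on {a..b}. speed a b \<gamma> x)"

definition bending_energy :: "real \<Rightarrow> real \<Rightarrow> (real \<Rightarrow> 'a::euclidean_space) \<Rightarrow> real" where
  "bending_energy a b \<gamma> =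
     (LINT x|lebesgue_on {a..b}. (norm (curvature a b \<gamma> x))\<^sup>2 * speed a b \<gamma> x)"

definition normalized_bending_energy ::
  "real \<Rightarrow> real \<Rightarrow> (real \<Rightarrow> 'a::euclidean_space) \<Rightarrow> real" where
  "normalized_bending_energy a b \<gamma> = curve_length a b \<gamma> * bending_energy a b \<gamma>"

definition has_point_of_multiplicity ::
  "real \<Rightarrow> real \<Rightarrow> (real \<Rightarrow> 'a::euclidean_space) \<Rightarrow> nat \<Rightarrow> bool" where
  "has_point_of_multiplicity a b \<gamma> k \<longleftrightarrow>
     (\<exists>p S. S \<subseteq> {x \<in> {a..b}. \<gamma> x = p} \<and> finite S \<and> card S = k)"


section \<open>Elliptic integrals and Jacobi elliptic functions\<close>

text \<open>The interval integral is signed, so \<open>ell_F\<close> is odd in its first argument.\<close>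

definition ell_F :: "real \<Rightarrow> real \<Rightarrow> real" where
  "ell_F x m = (LBINT \<theta>=0..x. 1 / sqrt (1 - m * (sin \<theta>)\<^sup>2))"

definition ell_K :: "real \<Rightarrow> real" where
  "ell_K m = ell_F (pi / 2) m"

definition ell_E :: "real \<Rightarrow> real" where
  "ell_E m = (LBINT \<theta>=0..pi / 2. sqrt (1 - m * (sin \<theta>)\<^sup>2))"

definition jacobi_am :: "real \<Rightarrow> real \<Rightarrow> real" where
  "jacobi_am x m = inv (\<lambda>y. ell_F y m) x"

definition jacobi_cn :: "real \<Rightarrow> real \<Rightarrow> real" where
  "jacobi_cn x m = cos (jacobi_am x m)"

definition m_star :: real where
  "m_star = (THE m. 0 < m \<and> m < 1 \<and> ell_K m = 2 * ell_E m)"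

definition varpi_star :: real where
  "varpi_star = 32 * (2 * m_star - 1) * (ell_E m_star)\<^sup>2"


section \<open>The half-fold figure-eight elastica\<close>

text \<open>
  Signed curvature in the plane oriented by the orthonormal frame \<open>(e1, e2)\<close>: the component of
  the curvature vector along the unit tangent rotated by a right angle from \<open>e1\<close> towards \<open>e2\<close>.
\<close>

definition signed_curvature ::
  "'a \<Rightarrow> 'a \<Rightarrow> real \<Rightarrow> real \<Rightarrow> (real \<Rightarrow> 'a::euclidean_space) \<Rightarrow> real \<Rightarrow> real" where
  "signed_curvature e1 e2 a b \<gamma> x =
     (let T = unit_tangent a b \<gamma> x
      in curvature a b \<gamma> x \<bullet> ((T \<bullet> e1) *\<^sub>R e2 - (T \<bullet> e2) *\<^sub>R e1))"

definition arclength :: "real \<Rightarrow> real \<Rightarrow> (real \<Rightarrow> 'a::euclidean_space) \<Rightarrow> real \<Rightarrow> real" where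
  "arclength a b \<gamma> x = (LINT y|lebesgue_on {a..x}. speed a b \<gamma> y)"

text \<open>
  The curvature equation is required almost everywhere, because the curvature of an immersed
  \<open>H\<^sup>2\<close>-curve is only defined up to null sets.
\<close>

definition half_fold_figure_eight_elastica ::
  "real \<Rightarrow> real \<Rightarrow> (real \<Rightarrow> 'a::euclidean_space) \<Rightarrow> bool" where
  "half_fold_figure_eight_elastica a b \<gamma> \<longleftrightarrow>
     immersed_H2_curve a b \<gamma> \<and>
     (\<exists>p e1 e2 \<sigma>. norm e1 = 1 \<and> norm e2 = 1 \<and> e1 \<bullet> e2 = 0 \<and>
        (\<forall>x\<in>{a..b}. \<gamma> x - p \<in> span {e1, e2}) \<and>
        \<sigma> \<in> {1, -1} \<and>
        (let \<Lambda> = 2 * ell_K m_star / curve_length a b \<gamma> in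
         AE x in lebesgue_on {a..b}.
           signed_curvature e1 e2 a b \<gamma> x =
           \<sigma> * (2 * sqrt m_star * \<Lambda> *
             jacobi_cn (\<Lambda> * arclength a b \<gamma> x - ell_K m_star) m_star)))"

end

theory Submission
  imports Defs
begin

text \<open>
  Consecutive visits of a multiple point cut the curve into closed loops, and the Cauchy-Schwarz
  inequality reduces the bound to \<open>L B \<ge> \<varpi>\<^sup>*\<close> for a single loop, that is, for a unit tangent
  field \<open>T\<close> with \<open>\<integral> T ds = 0\<close>.  Let \<open>e\<close> be the tangent at the midpoint of the loop and
  \<open>u = T \<bullet> e\<close>.  Then \<open>|T'|\<^sup>2 \<ge> u'\<^sup>2 / (1 - u\<^sup>2)\<close>, the right-hand side is jointly convex in
  \<open>(u, u')\<close>, and the constraint \<open>\<integral> u ds = 0\<close> is linear.  Hence every critical point of the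
  constrained problem is a global minimiser; the one with \<open>u = 1\<close> at the midpoint and natural
  boundary conditions at both ends is \<open>u = 1 - 2 m sn\<^sup>2\<close>, the half-fold figure-eight elastica.
  Convexity is used as a tangent-line inequality, with \<open>q = u' / (1 - u\<^sup>2)\<close> of the elastica as
  slope, so that no minimiser has to be shown to exist and no elastica has to be classified.
\<close>

section \<open>Absolutely continuous functions\<close>

text \<open>The slope q behaves like -1/y at arclength parameter y from the midpoint, so the
  tangent-line inequality cannot be integrated up to the point where u = 1. Its linear part is
  therefore written with the factor u - 1, and the boundary term q (1 - u) at a nearby point is
  absorbed by the energy of the short arc in between, because Cauchy-Schwarz bounds 1 - u by
  arclength times energy. Choosing e as the tangent at the midpoint makes u = 1 hold there for every
  loop, and splitting at half the length lets both halves be compared with the same elastica. The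
  equation K = 2 E is the closing condition of that elastica: u = 2 dn^2 - 1 has integral 2 (2 E -
  K) over [-K, K]. The tangent of an H^2-curve is merely absolutely continuous and its curvature is
  known only almost everywhere. Hence the calculus is that of indefinite integrals of absolutely
  integrable functions, and the speed is carried along as a weight in the given parameter instead of
  reparametrising by arclength.\<close>

lemma absolutely_integrable_continuous_bilinear:
  fixes Q :: "'a::euclidean_space \<Rightarrow> 'b::euclidean_space \<Rightarrow> 'c::euclidean_space" and p :: "real \<Rightarrow> 'a"
  assumes "bounded_bilinear Q" "continuous_on {a..b} p" "q absolutely_integrable_on {a..b}"
  shows "(\<lambda>x. Q (p x) (q x)) absolutely_integrable_on {a..b}"
proof (rule absolutely_integrable_bounded_measurable_product[where h=Q and f=p and g=q])
  show "bilinear Q" using assms(1) by (simp add: bilinear_conv_bounded_bilinear)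
  show "p \<in> borel_measurable (lebesgue_on {a..b})"
    using assms(2) by (intro continuous_imp_measurable_on_sets_lebesgue) auto
  show "bounded (p ` {a..b})"
    using assms(2) by (intro compact_imp_bounded compact_continuous_image) auto
qed (use assms in auto)

text \<open>Absolute continuity is encoded by the fundamental theorem of calculus, with the
  derivative as explicit data: it is determined only up to a null set, and no pointwise
  differentiability has to be discussed.\<close>

definition has_ac_deriv :: "real \<Rightarrow> real \<Rightarrow> (real \<Rightarrow> 'a::euclidean_space) \<Rightarrow> (real \<Rightarrow> 'a) \<Rightarrow> bool" where
  "has_ac_deriv a b f g \<longleftrightarrow>
     g absolutely_integrable_on {a..b} \<and> (\<forall>x\<in>{a..b}. f x = f a + integral {a..x} g)"

lemma has_ac_derivD:
  assumes "has_ac_deriv a b f g" "a \<le> x" "x \<le> b"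
  shows "f x = f a + integral {a..x} g"
  using assms unfolding has_ac_deriv_def by (meson atLeastAtMost_iff)

lemma has_ac_deriv_integrable:
  assumes "has_ac_deriv a b f g" "a \<le> x" "y \<le> b"
  shows "g absolutely_integrable_on {x..y}" "g integrable_on {x..y}" "(\<lambda>t. norm (g t)) integrable_on {x..y}"
proof -
  show 1: "g absolutely_integrable_on {x..y}"
    using assms unfolding has_ac_deriv_def
    by (auto intro: absolutely_integrable_on_subinterval)
  then show "g integrable_on {x..y}" "(\<lambda>t. norm (g t)) integrable_on {x..y}"
    by (auto simp: absolutely_integrable_on_def)
qed

lemma has_ac_deriv_diff:
  assumes "has_ac_deriv a b f g" "a \<le> x" "x \<le> y" "y \<le> b"
  shows "f y - f x = integral {x..y} g"
proof -
  have "integral {a..x} g + integral {x..y} g = integral {a..y} g"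
    using assms by (intro Henstock_Kurzweil_Integration.integral_combine has_ac_deriv_integrable[OF assms(1)]) auto
  then show ?thesis
    using has_ac_derivD[OF assms(1), of x] has_ac_derivD[OF assms(1), of y] assms(2-4)
    by (simp add: algebra_simps)
qed

lemma has_ac_deriv_subinterval:
  assumes "has_ac_deriv a b f g" "a \<le> c" "d \<le> b"
  shows "has_ac_deriv c d f g"
  unfolding has_ac_deriv_def
proof (intro conjI ballI)
  show "g absolutely_integrable_on {c..d}"
    using has_ac_deriv_integrable[OF assms] by simp
  fix x assume "x \<in> {c..d}"
  then show "f x = f c + integral {c..x} g"
    using has_ac_deriv_diff[OF assms(1), of c x] assms by (auto simp: algebra_simps)
qed

lemma has_ac_deriv_continuous_on:
  assumes "has_ac_deriv a b f g"
  shows "continuous_on {a..b} f"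
proof -
  have "continuous_on {a..b} (\<lambda>x. f a + integral {a..x} g)"
    by (intro continuous_intros indefinite_integral_continuous_1 has_ac_deriv_integrable[OF assms]) auto
  then show ?thesis
    by (rule continuous_on_eq) (metis atLeastAtMost_iff has_ac_derivD[OF assms])
qed

lemma has_ac_deriv_cong:
  assumes "has_ac_deriv a b f g" "\<And>x. a \<le> x \<Longrightarrow> x \<le> b \<Longrightarrow> f x = f' x" "\<And>x. a \<le> x \<Longrightarrow> x \<le> b \<Longrightarrow> g x = g' x"
  shows "has_ac_deriv a b f' g'"
proof (cases "a \<le> b")
  case True
  have i: "integral {a..x} g = integral {a..x} g'" if "x \<le> b" for x
    using assms(3) that by (intro integral_cong) auto
  have "g absolutely_integrable_on {a..b} \<longleftrightarrow> g' absolutely_integrable_on {a..b}"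
    by (rule absolutely_integrable_spike_eq[of "{}"]) (use assms(3) in auto)
  then have "g' absolutely_integrable_on {a..b}"
    using assms(1) unfolding has_ac_deriv_def by blast
  moreover have "f' x = f' a + integral {a..x} g'" if "x \<in> {a..b}" for x
    using has_ac_derivD[OF assms(1), of x] assms(2)[of x] assms(2)[of a] i that by simp
  ultimately show ?thesis unfolding has_ac_deriv_def by blast
qed (use assms(1) in \<open>simp add: has_ac_deriv_def\<close>)

lemma has_ac_deriv_spike:
  assumes "has_ac_deriv a b f g" "negligible N" "\<And>x. x \<in> {a..b} - N \<Longrightarrow> g' x = g x"
  shows "has_ac_deriv a b f g'"
proof -
  have i: "integral {a..x} g' = integral {a..x} g" if "x \<in> {a..b}" for x
    using that assms(3) by (intro integral_spike[OF assms(2)]) auto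
  have "g' absolutely_integrable_on {a..b}"
    using assms unfolding has_ac_deriv_def by (blast intro: absolutely_integrable_spike)
  moreover have "f x = f a + integral {a..x} g'" if "x \<in> {a..b}" for x
    using has_ac_derivD[OF assms(1), of x] i that by simp
  ultimately show ?thesis
    unfolding has_ac_deriv_def by blast
qed

lemma has_ac_deriv_C1:
  fixes f :: "real \<Rightarrow> 'a::euclidean_space"
  assumes "continuous_on {a..b} g"
    and "\<And>x. a \<le> x \<Longrightarrow> x \<le> b \<Longrightarrow> (f has_vector_derivative g x) (at x within {a..b})"
  shows "has_ac_deriv a b f g"
  unfolding has_ac_deriv_def
proof (intro conjI ballI)
  show "g absolutely_integrable_on {a..b}"
    using absolutely_integrable_continuous_real assms(1) by blast
  fix x assume x: "x \<in> {a..b}"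
  have "(g has_integral (f x - f a)) {a..x}"
    by (rule fundamental_theorem_of_calculus)
       (use x in \<open>auto intro!: has_vector_derivative_within_subset[OF assms(2)]\<close>)
  then show "f x = f a + integral {a..x} g"
    by (auto simp: integral_unique)
qed

lemma has_ac_deriv_linear:
  assumes "has_ac_deriv a b f g" "bounded_linear h"
  shows "has_ac_deriv a b (\<lambda>x. h (f x)) (\<lambda>x. h (g x))"
  unfolding has_ac_deriv_def
proof (intro conjI ballI)
  interpret bounded_linear h by fact
  show "(\<lambda>x. h (g x)) absolutely_integrable_on {a..b}"
    using absolutely_integrable_linear[OF _ assms(2), of "{a..b}" g] assms(1)
    unfolding has_ac_deriv_def by (simp add: o_def)
  fix x assume x: "x \<in> {a..b}"
  have "integral {a..x} (h \<circ> g) = h (integral {a..x} g)"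
    using has_ac_deriv_integrable[OF assms(1), of a x] x by (intro integral_linear assms) auto
  moreover have "f x = f a + integral {a..x} g"
    using has_ac_derivD[OF assms(1), of x] x by simp
  ultimately show "h (f x) = h (f a) + integral {a..x} (\<lambda>x. h (g x))"
    by (simp add: add o_def)
qed

lemma has_ac_deriv_add:
  assumes "has_ac_deriv a b f f'" "has_ac_deriv a b g g'"
  shows "has_ac_deriv a b (\<lambda>x. f x + g x) (\<lambda>x. f' x + g' x)"
  unfolding has_ac_deriv_def
proof (intro conjI ballI)
  show "(\<lambda>x. f' x + g' x) absolutely_integrable_on {a..b}"
    using assms unfolding has_ac_deriv_def by auto
  fix x assume x: "x \<in> {a..b}"
  have "integral {a..x} (\<lambda>x. f' x + g' x) = integral {a..x} f' + integral {a..x} g'"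
    using x by (intro Henstock_Kurzweil_Integration.integral_add
        has_ac_deriv_integrable[OF assms(1)] has_ac_deriv_integrable[OF assms(2)]) auto
  moreover have "f x = f a + integral {a..x} f'" "g x = g a + integral {a..x} g'"
    using x has_ac_derivD[OF assms(1), of x] has_ac_derivD[OF assms(2), of x] by simp_all
  ultimately show "f x + g x = f a + g a + integral {a..x} (\<lambda>x. f' x + g' x)"
    by simp
qed

text \<open>On a partition fine enough that \<open>H\<close> grows by at most \<delta> on each
  piece, the increments of \<open>\<Phi>\<close> add up to at most \<open>C\<close> \<delta> times
  the total growth of \<open>H\<close>, and \<delta> is arbitrary.\<close>

lemma eq_if_quadratic_increments:
  fixes \<Phi> :: "real \<Rightarrow> 'a::real_normed_vector" and H :: "real \<Rightarrow> real"
  assumes "a \<le> b" "continuous_on {a..b} H"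
    and mono: "\<And>x y. a \<le> x \<Longrightarrow> x \<le> y \<Longrightarrow> y \<le> b \<Longrightarrow> H x \<le> H y"
    and quad: "\<And>x y. a \<le> x \<Longrightarrow> x \<le> y \<Longrightarrow> y \<le> b \<Longrightarrow> norm (\<Phi> y - \<Phi> x) \<le> C * (H y - H x)\<^sup>2"
  shows "\<Phi> b = \<Phi> a"
proof -
  have est: "norm (\<Phi> b - \<Phi> a) \<le> \<epsilon> * (H b - H a)" if \<epsilon>: "\<epsilon> > 0" for \<epsilon>
  proof -
    \<comment> \<open>An estimate linear in the increment of \<open>H\<close> passes to adjoining
      intervals, as the bisection argument requires; the quadratic one does not.\<close>
    define P where "P x y \<longleftrightarrow> (a \<le> x \<and> y \<le> b \<longrightarrow> norm (\<Phi> y - \<Phi> x) \<le> \<epsilon> * (H y - H x))" for x y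
    have "P a b"
    proof (rule Bolzano[OF assms(1)])
      fix x y z assume xyz: "P x y" "P y z" "x \<le> y" "y \<le> z"
      show "P x z"
        unfolding P_def
      proof
        assume "a \<le> x \<and> z \<le> b"
        then have "a \<le> x" "y \<le> b" "a \<le> y" "z \<le> b"
          using xyz(3,4) by linarith+
        then have "norm (\<Phi> y - \<Phi> x) \<le> \<epsilon> * (H y - H x)" "norm (\<Phi> z - \<Phi> y) \<le> \<epsilon> * (H z - H y)"
          using xyz(1,2) unfolding P_def by blast+
        moreover have "norm (\<Phi> z - \<Phi> x) \<le> norm (\<Phi> z - \<Phi> y) + norm (\<Phi> y - \<Phi> x)"
          using norm_triangle_ineq[of "\<Phi> z - \<Phi> y" "\<Phi> y - \<Phi> x"] by simp
        ultimately show "norm (\<Phi> z - \<Phi> x) \<le> \<epsilon> * (H z - H x)"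
          by (simp add: right_diff_distrib)
      qed
    next
      fix x assume x: "a \<le> x" "x \<le> b"
      \<comment> \<open>With \<open>H\<close> varying by less than \<open>\<eta>\<close> on either
        side of \<open>x\<close>, one factor of the square is at most \<open>2 * \<eta>\<close>,
        which turns \<open>C\<close> into \<open>\<epsilon>\<close>; the summand 1 covers
        \<open>C = 0\<close>.\<close>
      define \<eta> where "\<eta> = \<epsilon> / (2 * (\<bar>C\<bar> + 1))"
      have "\<eta> > 0" unfolding \<eta>_def using \<epsilon> by (intro divide_pos_pos) auto
      then obtain d where d: "d > 0" "\<And>z. z \<in> {a..b} \<Longrightarrow> dist z x < d \<Longrightarrow> dist (H z) (H x) < \<eta>"
        using assms(2) x unfolding continuous_on_iff by (metis atLeastAtMost_iff)
      have "P u w" if uw: "u \<le> x" "x \<le> w" "w - u < d" for u w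
        unfolding P_def
      proof
        assume "a \<le> u \<and> w \<le> b"
        then have m: "H u \<le> H w" "norm (\<Phi> w - \<Phi> u) \<le> C * (H w - H u)\<^sup>2"
          using uw mono quad by auto
        have "dist u x < d" "dist w x < d" "u \<in> {a..b}" "w \<in> {a..b}"
          using uw x \<open>a \<le> u \<and> w \<le> b\<close> by (auto simp: dist_real_def)
        then have "dist (H u) (H x) < \<eta>" "dist (H w) (H x) < \<eta>"
          using d(2) by blast+
        then have "H w - H u \<le> 2 * \<eta>" by (auto simp: dist_real_def)
        then have "(\<bar>C\<bar> + 1) * (H w - H u) \<le> \<epsilon>"
          by (simp add: \<eta>_def field_simps)
        then have "(\<bar>C\<bar> + 1) * (H w - H u) * (H w - H u) \<le> \<epsilon> * (H w - H u)"
          using m by (intro mult_right_mono) auto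
        moreover have "C * (H w - H u)\<^sup>2 \<le> (\<bar>C\<bar> + 1) * (H w - H u)\<^sup>2"
          by (intro mult_right_mono) auto
        ultimately show "norm (\<Phi> w - \<Phi> u) \<le> \<epsilon> * (H w - H u)"
          using m by (simp add: power2_eq_square mult.assoc)
      qed
      then show "\<exists>d>0. \<forall>u w. u \<le> x \<and> x \<le> w \<and> w - u < d \<longrightarrow> P u w"
        using d(1) by blast
    qed
    then show ?thesis by (auto simp: P_def)
  qed
  have "norm (\<Phi> b - \<Phi> a) \<le> 0"
  proof (rule field_le_epsilon)
    fix e :: real assume "e > 0"
    have h: "H b - H a \<ge> 0" using mono[of a b] assms(1) by simp
    have "norm (\<Phi> b - \<Phi> a) \<le> e / (H b - H a + 1) * (H b - H a)"
      using h \<open>e > 0\<close> by (intro est) auto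
    also have "\<dots> \<le> 0 + e"
      using h \<open>e > 0\<close> by (simp add: field_simps)
    finally show "norm (\<Phi> b - \<Phi> a) \<le> 0 + e" .
  qed
  then show ?thesis by simp
qed

text \<open>Over \<open>[x,y]\<close> both sides of the product rule agree up to \<open>C (H y - H x)\<^sup>2\<close>, where \<open>H\<close> is the
  total variation of the two factors; this avoids differentiating almost everywhere.\<close>

lemma has_ac_deriv_bilinear:
  fixes B :: "'a::euclidean_space \<Rightarrow> 'b::euclidean_space \<Rightarrow> 'c::euclidean_space"
  assumes B: "bounded_bilinear B" and f: "has_ac_deriv a b f f'" and g: "has_ac_deriv a b g g'"
  shows "has_ac_deriv a b (\<lambda>x. B (f x) (g x)) (\<lambda>x. B (f x) (g' x) + B (f' x) (g x))"
proof -
  interpret bounded_bilinear B by fact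
  let ?k = "\<lambda>x. B (f x) (g' x) + B (f' x) (g x)"
  note cf = has_ac_deriv_continuous_on[OF f] and cg = has_ac_deriv_continuous_on[OF g]
  have f': "f' absolutely_integrable_on {a..b}" and g': "g' absolutely_integrable_on {a..b}"
    using f g unfolding has_ac_deriv_def by auto
  have 1: "(\<lambda>x. B (f x) (g' x)) absolutely_integrable_on {a..b}"
    by (rule absolutely_integrable_continuous_bilinear[OF B cf g'])
  have 2: "(\<lambda>x. B (f' x) (g x)) absolutely_integrable_on {a..b}"
    by (rule absolutely_integrable_continuous_bilinear[OF flip cg f'])
  have k: "?k absolutely_integrable_on {a..b}"
    using 1 2 by auto
  obtain M where M: "M > 0" "\<And>u w. norm (B u w) \<le> norm u * norm w * M"
    using pos_bounded by blast
  define H where "H x = integral {a..x} (\<lambda>t. norm (f' t) + norm (g' t))" for x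
  have hint: "(\<lambda>t. norm (f' t) + norm (g' t)) integrable_on {x..y}" if "a \<le> x" "y \<le> b" for x y
    using has_ac_deriv_integrable[OF f that] has_ac_deriv_integrable[OF g that] by (intro integrable_add)
  have Hdiff: "H y - H x = integral {x..y} (\<lambda>t. norm (f' t)) + integral {x..y} (\<lambda>t. norm (g' t))"
    if "a \<le> x" "x \<le> y" "y \<le> b" for x y
  proof -
    have "H x + integral {x..y} (\<lambda>t. norm (f' t) + norm (g' t)) = H y"
      unfolding H_def by (intro Henstock_Kurzweil_Integration.integral_combine hint) (use that in auto)
    then show ?thesis
      using has_ac_deriv_integrable[OF f that(1,3)] has_ac_deriv_integrable[OF g that(1,3)]
      by (subst (asm) Henstock_Kurzweil_Integration.integral_add) auto
  qed
  have ge0: "0 \<le> integral S (\<lambda>t. norm (f' t))" "0 \<le> integral S (\<lambda>t. norm (g' t))" for S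
    by (cases "(\<lambda>t. norm (f' t)) integrable_on S"; simp add: integral_nonneg not_integrable_integral)
       (cases "(\<lambda>t. norm (g' t)) integrable_on S"; simp add: integral_nonneg not_integrable_integral)
  have Hmono: "H x \<le> H y" if "a \<le> x" "x \<le> y" "y \<le> b" for x y
    using Hdiff[OF that] ge0 by (smt (verit))
  have osc: "norm (f t - f x) \<le> H y - H x" "norm (g t - g x) \<le> H y - H x"
    if "a \<le> x" "x \<le> t" "t \<le> y" "y \<le> b" for x y t
  proof -
    have "norm (f t - f x) \<le> integral {x..t} (\<lambda>t. norm (f' t))"
      unfolding has_ac_deriv_diff[OF f that(1,2) order_trans[OF that(3,4)]]
      by (intro integral_norm_bound_integral has_ac_deriv_integrable[OF f]) (use that in auto)
    moreover have "norm (g t - g x) \<le> integral {x..t} (\<lambda>t. norm (g' t))"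
      unfolding has_ac_deriv_diff[OF g that(1,2) order_trans[OF that(3,4)]]
      by (intro integral_norm_bound_integral has_ac_deriv_integrable[OF g]) (use that in auto)
    ultimately show "norm (f t - f x) \<le> H y - H x" "norm (g t - g x) \<le> H y - H x"
      using Hdiff[of x t] Hmono[of t y] ge0(1)[of "{x..t}"] ge0(2)[of "{x..t}"] that by linarith+
  qed
  define \<Phi> where "\<Phi> x = B (f x) (g x) - integral {a..x} ?k" for x
  have quad: "norm (\<Phi> y - \<Phi> x) \<le> (2 * M) * (H y - H x)\<^sup>2" if xy: "a \<le> x" "x \<le> y" "y \<le> b" for x y
  proof -
    let ?h = "H y - H x"
    note fi = has_ac_deriv_integrable[OF f xy(1,3)] and gi = has_ac_deriv_integrable[OF g xy(1,3)]
    have sub: "q integrable_on {x..y}" if "q absolutely_integrable_on {a..b}" for q :: "real \<Rightarrow> 'c"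
      using absolutely_integrable_on_subinterval[OF that] xy by (auto simp: absolutely_integrable_on_def)
    have ki: "?k integrable_on {u..w}" if "a \<le> u" "w \<le> b" for u w
      using absolutely_integrable_on_subinterval[OF k] that by (auto simp: absolutely_integrable_on_def)
    have k1: "integral {a..x} ?k + integral {x..y} ?k = integral {a..y} ?k"
      by (intro Henstock_Kurzweil_Integration.integral_combine ki) (use xy in auto)
    have e1: "B (f x) (g y - g x) = integral {x..y} (\<lambda>t. B (f x) (g' t))"
      unfolding has_ac_deriv_diff[OF g xy]
      using integral_linear[OF gi(2) bounded_linear_right[of "f x"]] by (simp add: o_def)
    have e2: "B (f y - f x) (g x) = integral {x..y} (\<lambda>t. B (f' t) (g x))"
      unfolding has_ac_deriv_diff[OF f xy]
      using integral_linear[OF fi(2) bounded_linear_left[of "g x"]] by (simp add: o_def)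
    have i1: "(\<lambda>t. B (f x) (g' t)) integrable_on {x..y}"
      using integrable_linear[OF gi(2) bounded_linear_right[of "f x"]] by (simp add: o_def)
    have i2: "(\<lambda>t. B (f' t) (g x)) integrable_on {x..y}"
      using integrable_linear[OF fi(2) bounded_linear_left[of "g x"]] by (simp add: o_def)
    have j1: "(\<lambda>t. B (f x - f t) (g' t)) integrable_on {x..y}"
      unfolding diff_left by (intro integrable_diff i1 sub 1)
    have j2: "(\<lambda>t. B (f' t) (g x - g t)) integrable_on {x..y}"
      unfolding diff_right by (intro integrable_diff i2 sub 2)
    \<comment> \<open>Freezing \<open>f\<close> and \<open>g\<close> at \<open>x\<close> makes the
      linear terms cancel against the integral; each of the three remaining terms is a product of
      two oscillations over the interval.\<close>
    have eq: "\<Phi> y - \<Phi> x = integral {x..y} (\<lambda>t. B (f x - f t) (g' t)) +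
                 integral {x..y} (\<lambda>t. B (f' t) (g x - g t)) + B (f y - f x) (g y - g x)"
    proof -
      have "\<Phi> y - \<Phi> x = B (f x) (g y - g x) + B (f y - f x) (g x) + B (f y - f x) (g y - g x) - integral {x..y} ?k"
        unfolding \<Phi>_def k1[symmetric] by (simp add: diff_left diff_right algebra_simps)
      moreover have "integral {x..y} ?k = integral {x..y} (\<lambda>t. B (f x) (g' t)) + integral {x..y} (\<lambda>t. B (f' t) (g x))
          - integral {x..y} (\<lambda>t. B (f x - f t) (g' t)) - integral {x..y} (\<lambda>t. B (f' t) (g x - g t))"
        using i1 i2 j1 j2 sub[OF 1] sub[OF 2]
        by (simp add: diff_left diff_right Henstock_Kurzweil_Integration.integral_add
            Henstock_Kurzweil_Integration.integral_diff)
      ultimately show ?thesis unfolding e1 e2 by simp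
    qed
    have n1: "norm (integral {x..y} (\<lambda>t. B (f x - f t) (g' t))) \<le> integral {x..y} (\<lambda>t. (?h * M) * norm (g' t))"
    proof (intro integral_norm_bound_integral j1 integrable_on_mult_right gi)
      fix t assume "t \<in> {x..y}"
      then have "norm (f x - f t) \<le> ?h" using osc[of x t y] xy by (auto simp: norm_minus_commute)
      then have "norm (f x - f t) * norm (g' t) * M \<le> ?h * norm (g' t) * M"
        using M by (intro mult_right_mono) auto
      then show "norm (B (f x - f t) (g' t)) \<le> ?h * M * norm (g' t)"
        using M(2)[of "f x - f t" "g' t"] by (simp add: mult_ac)
    qed
    have n2: "norm (integral {x..y} (\<lambda>t. B (f' t) (g x - g t))) \<le> integral {x..y} (\<lambda>t. (?h * M) * norm (f' t))"
    proof (intro integral_norm_bound_integral j2 integrable_on_mult_right fi)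
      fix t assume "t \<in> {x..y}"
      then have "norm (g x - g t) \<le> ?h" using osc[of x t y] xy by (auto simp: norm_minus_commute)
      then have "norm (f' t) * norm (g x - g t) * M \<le> norm (f' t) * ?h * M"
        using M by (intro mult_right_mono mult_left_mono) auto
      then show "norm (B (f' t) (g x - g t)) \<le> ?h * M * norm (f' t)"
        using M(2)[of "f' t" "g x - g t"] by (simp add: mult_ac)
    qed
    have n3: "norm (B (f y - f x) (g y - g x)) \<le> ?h * ?h * M"
      using osc[of x y y] xy M Hmono[OF xy]
      by (intro order_trans[OF M(2)] mult_right_mono mult_mono) auto
    have "norm (\<Phi> y - \<Phi> x) \<le> (?h * M) * integral {x..y} (\<lambda>t. norm (g' t)) + (?h * M) * integral {x..y} (\<lambda>t. norm (f' t)) + ?h * ?h * M"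
      unfolding eq using n1 n2 n3 by (intro norm_triangle_le add_mono) auto
    also have "\<dots> = (2 * M) * ?h\<^sup>2"
      using Hdiff[OF xy] by (simp add: power2_eq_square algebra_simps)
    finally show ?thesis .
  qed
  have eq: "\<Phi> x = \<Phi> a" if "x \<in> {a..b}" for x
  proof (rule eq_if_quadratic_increments[where \<Phi>=\<Phi> and H=H and C="2 * M"])
    show "continuous_on {a..x} H"
      unfolding H_def using that by (intro indefinite_integral_continuous_1 hint) auto
    show "a \<le> x" using that by simp
    show "H u \<le> H w" if "a \<le> u" "u \<le> w" "w \<le> x" for u w
      using Hmono[OF that(1,2)] that(3) \<open>x \<in> {a..b}\<close> by simp
    show "norm (\<Phi> w - \<Phi> u) \<le> (2 * M) * (H w - H u)\<^sup>2" if "a \<le> u" "u \<le> w" "w \<le> x" for u w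
      using quad[OF that(1,2)] that(3) \<open>x \<in> {a..b}\<close> by simp
  qed
  have "B (f x) (g x) = B (f a) (g a) + integral {a..x} ?k" if "x \<in> {a..b}" for x
    using eq[OF that] unfolding \<Phi>_def by (simp add: diff_eq_eq)
  then show ?thesis
    using k unfolding has_ac_deriv_def by blast
qed

lemmas has_ac_deriv_inner = has_ac_deriv_bilinear[OF bounded_bilinear_inner]
lemmas has_ac_deriv_scaleR = has_ac_deriv_bilinear[OF bounded_bilinear_scaleR]
lemmas has_ac_deriv_mult = has_ac_deriv_bilinear[OF bounded_bilinear_mult[where 'a=real]]

text \<open>Same argument as for the product rule. The continuous second derivative bounds the
  Taylor remainder of \<open>F\<close> quadratically, which is why \<open>F\<close> is required to
  be twice differentiable on a compact interval containing the values of \<open>r\<close>.\<close>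

lemma has_ac_deriv_compose:
  fixes F F' F'' :: "real \<Rightarrow> real"
  assumes r: "has_ac_deriv a b r r'" and J: "\<And>x. a \<le> x \<Longrightarrow> x \<le> b \<Longrightarrow> r x \<in> {c..d}"
    and F: "\<And>t. t \<in> {c..d} \<Longrightarrow> (F has_real_derivative F' t) (at t within {c..d})"
    and F': "\<And>t. t \<in> {c..d} \<Longrightarrow> (F' has_real_derivative F'' t) (at t within {c..d})"
    and F'': "continuous_on {c..d} F''"
  shows "has_ac_deriv a b (\<lambda>x. F (r x)) (\<lambda>x. F' (r x) * r' x)"
proof -
  obtain C0 where C0: "\<And>t. t \<in> {c..d} \<Longrightarrow> norm (F'' t) \<le> C0"
    using compact_imp_bounded[OF compact_continuous_image[OF F'' compact_Icc]]
    unfolding bounded_iff by blast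
  define C where "C = max C0 0"
  have C: "C \<ge> 0" "\<And>t. t \<in> {c..d} \<Longrightarrow> norm (F'' t) \<le> C"
    using C0 unfolding C_def by force+
  have lip: "\<bar>F' s - F' t\<bar> \<le> C * \<bar>s - t\<bar>" if "s \<in> {c..d}" "t \<in> {c..d}" for s t
    using field_differentiable_bound[of "{c..d}" F' F'' C s t] F' C that by auto
  have tay: "\<bar>F s - F t - F' t * (s - t)\<bar> \<le> C * (s - t)\<^sup>2" if st: "s \<in> {c..d}" "t \<in> {c..d}" for s t
  proof -
    define S where "S = {min s t..max s t}"
    have "S \<subseteq> {c..d}" using st by (auto simp: S_def)
    have "norm ((F s - F' t * s) - (F t - F' t * t)) \<le> (C * \<bar>s - t\<bar>) * norm (s - t)"
    proof (rule field_differentiable_bound[of S _ "\<lambda>z. F' z - F' t"])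
      fix z assume z: "z \<in> S"
      then have "z \<in> {c..d}" using \<open>S \<subseteq> {c..d}\<close> by auto
      then show "((\<lambda>z. F z - F' t * z) has_real_derivative F' z - F' t) (at z within S)"
        using DERIV_subset[OF F \<open>S \<subseteq> {c..d}\<close>] by (auto intro!: derivative_eq_intros)
      have "\<bar>F' z - F' t\<bar> \<le> C * \<bar>z - t\<bar>" using lip \<open>z \<in> {c..d}\<close> st by auto
      also have "\<dots> \<le> C * \<bar>s - t\<bar>" using z C by (intro mult_left_mono) (auto simp: S_def)
      finally show "norm (F' z - F' t) \<le> C * \<bar>s - t\<bar>" by simp
    qed (auto simp: S_def)
    then show ?thesis
      by (simp add: power2_eq_square algebra_simps)
  qed
  note cr = has_ac_deriv_continuous_on[OF r]
  have r': "r' absolutely_integrable_on {a..b}" using r unfolding has_ac_deriv_def by auto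
  let ?k = "\<lambda>x. F' (r x) * r' x"
  have cF: "continuous_on {a..b} (\<lambda>x. F' (r x))"
    by (rule continuous_on_compose2[OF DERIV_continuous_on[OF F'] cr]) (use J in auto)
  have k: "?k absolutely_integrable_on {a..b}"
    by (rule absolutely_integrable_continuous_bilinear[OF bounded_bilinear_mult cF r'])
  define H where "H x = integral {a..x} (\<lambda>t. norm (r' t))" for x
  have Hdiff: "H y - H x = integral {x..y} (\<lambda>t. norm (r' t))" if "a \<le> x" "x \<le> y" "y \<le> b" for x y
  proof -
    have "H x + integral {x..y} (\<lambda>t. norm (r' t)) = H y"
      unfolding H_def by (intro Henstock_Kurzweil_Integration.integral_combine has_ac_deriv_integrable[OF r])
        (use that in auto)
    then show ?thesis by simp
  qed
  have Hmono: "H x \<le> H y" if "a \<le> x" "x \<le> y" "y \<le> b" for x y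
  proof -
    have "0 \<le> integral {x..y} (\<lambda>t. norm (r' t))"
      by (intro integral_nonneg has_ac_deriv_integrable[OF r]) (use that in auto)
    then show ?thesis using Hdiff[OF that] by simp
  qed
  have osc: "\<bar>r t - r x\<bar> \<le> H y - H x" if "a \<le> x" "x \<le> t" "t \<le> y" "y \<le> b" for x y t
  proof -
    have "norm (r t - r x) \<le> integral {x..t} (\<lambda>t. norm (r' t))"
      unfolding has_ac_deriv_diff[OF r that(1,2) order_trans[OF that(3,4)]]
      by (intro integral_norm_bound_integral has_ac_deriv_integrable[OF r]) (use that in auto)
    then show ?thesis
      using Hdiff[of x t] Hmono[of t y] that by simp
  qed
  define \<Phi> where "\<Phi> x = F (r x) - integral {a..x} ?k" for x
  have quad: "norm (\<Phi> y - \<Phi> x) \<le> (2 * C) * (H y - H x)\<^sup>2" if xy: "a \<le> x" "x \<le> y" "y \<le> b" for x y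
  proof -
    let ?h = "H y - H x"
    have h0: "?h \<ge> 0" using Hmono[OF xy] by simp
    note ri = has_ac_deriv_integrable[OF r xy(1,3)]
    have ki: "?k integrable_on {u..w}" if "a \<le> u" "w \<le> b" for u w
      using absolutely_integrable_on_subinterval[OF k] that by (auto simp: absolutely_integrable_on_def)
    have k1: "integral {a..x} ?k + integral {x..y} ?k = integral {a..y} ?k"
      by (intro Henstock_Kurzweil_Integration.integral_combine ki) (use xy in auto)
    have i1: "(\<lambda>t. F' (r x) * r' t) integrable_on {x..y}"
      using ri by (intro integrable_on_mult_right)
    have j1: "(\<lambda>t. (F' (r x) - F' (r t)) * r' t) integrable_on {x..y}"
      unfolding left_diff_distrib using xy by (intro integrable_diff i1 ki) auto
    have "integral {x..y} ?k = integral {x..y} (\<lambda>t. F' (r x) * r' t) - integral {x..y} (\<lambda>t. (F' (r x) - F' (r t)) * r' t)"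
      using i1 ki[OF xy(1,3)] by (simp add: left_diff_distrib Henstock_Kurzweil_Integration.integral_diff)
    moreover have "integral {x..y} (\<lambda>t. F' (r x) * r' t) = F' (r x) * (r y - r x)"
      unfolding has_ac_deriv_diff[OF r xy] by simp
    ultimately have eq: "\<Phi> y - \<Phi> x = (F (r y) - F (r x) - F' (r x) * (r y - r x)) + integral {x..y} (\<lambda>t. (F' (r x) - F' (r t)) * r' t)"
      unfolding \<Phi>_def k1[symmetric] by simp
    have "norm (integral {x..y} (\<lambda>t. (F' (r x) - F' (r t)) * r' t)) \<le> integral {x..y} (\<lambda>t. (C * ?h) * norm (r' t))"
    proof (intro integral_norm_bound_integral j1 integrable_on_mult_right ri)
      fix t assume t: "t \<in> {x..y}"
      have "\<bar>F' (r x) - F' (r t)\<bar> \<le> C * \<bar>r x - r t\<bar>"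
        using t xy by (intro lip J) auto
      also have "\<dots> \<le> C * ?h"
        using osc[of x t y] t xy C by (intro mult_left_mono) (auto simp: abs_minus_commute)
      finally show "norm ((F' (r x) - F' (r t)) * r' t) \<le> C * ?h * norm (r' t)"
        by (auto simp: abs_mult intro: mult_right_mono)
    qed
    also have "\<dots> = C * ?h * ?h" using Hdiff[OF xy] by simp
    finally have n1: "norm (integral {x..y} (\<lambda>t. (F' (r x) - F' (r t)) * r' t)) \<le> C * ?h * ?h" .
    have "\<bar>F (r y) - F (r x) - F' (r x) * (r y - r x)\<bar> \<le> C * (r y - r x)\<^sup>2"
      using xy by (intro tay J) auto
    also have "(r y - r x)\<^sup>2 \<le> ?h\<^sup>2"
      using osc[of x y y] xy h0 by (metis abs_le_square_iff abs_of_nonneg order_refl)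
    finally have n2: "\<bar>F (r y) - F (r x) - F' (r x) * (r y - r x)\<bar> \<le> C * ?h\<^sup>2"
      using C(1) by (simp add: mult_left_mono)
    show ?thesis unfolding eq
      using n1 n2 by (simp add: power2_eq_square)
  qed
  have eq: "\<Phi> x = \<Phi> a" if "x \<in> {a..b}" for x
  proof (rule eq_if_quadratic_increments[where \<Phi>=\<Phi> and H=H and C="2 * C"])
    show "continuous_on {a..x} H"
      unfolding H_def using that by (intro indefinite_integral_continuous_1 has_ac_deriv_integrable[OF r]) auto
    show "a \<le> x" using that by simp
    show "H u \<le> H w" if "a \<le> u" "u \<le> w" "w \<le> x" for u w
      using Hmono[OF that(1,2)] that(3) \<open>x \<in> {a..b}\<close> by simp
    show "norm (\<Phi> w - \<Phi> u) \<le> (2 * C) * (H w - H u)\<^sup>2" if "a \<le> u" "u \<le> w" "w \<le> x" for u w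
      using quad[OF that(1,2)] that(3) \<open>x \<in> {a..b}\<close> by simp
  qed
  have "F (r x) = F (r a) + integral {a..x} ?k" if "x \<in> {a..b}" for x
    using eq[OF that] unfolding \<Phi>_def by (simp add: diff_eq_eq)
  then show ?thesis
    using k unfolding has_ac_deriv_def by blast
qed

section \<open>Weak derivatives\<close>

text \<open>By Lebesgue differentiation the averages over [x, x + h] tend to \<open>f x\<close> for
  almost every x. The end points of the interval join the null set because the hypothesis concerns
  intervals strictly inside.\<close>

lemma zero_ae_if_integral_zero:
  fixes f :: "real \<Rightarrow> 'a::euclidean_space"
  assumes f: "f integrable_on {a..b}"
    and zero: "\<And>c d. a < c \<Longrightarrow> c < d \<Longrightarrow> d < b \<Longrightarrow> integral {c..d} f = 0"
  shows "\<exists>N. negligible N \<and> (\<forall>x\<in>{a..b} - N. f x = 0)"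
proof -
  let ?F = "\<lambda>x. if x \<in> {a..b} then f x else 0"
  have "?F integrable_on UNIV" using f by (simp only: integrable_restrict_UNIV)
  then have "?F integrable_on cbox c d" for c d
    by (rule integrable_on_subcbox) auto
  then obtain N where N: "negligible N"
    "\<And>x e. \<lbrakk>x \<notin> N; 0 < e\<rbrakk> \<Longrightarrow> \<exists>d>0. \<forall>h. 0 < h \<and> h < d \<longrightarrow>
        norm (integral (cbox x (x + h *\<^sub>R One)) ?F /\<^sub>R h ^ DIM(real) - ?F x) < e"
    using integrable_ccontinuous_explicit[of ?F] by blast
  show ?thesis
  proof (intro exI conjI)
    show "negligible (N \<union> {a, b})" using N(1) by auto
    show "\<forall>x\<in>{a..b} - (N \<union> {a, b}). f x = 0"
    proof
      fix x assume x: "x \<in> {a..b} - (N \<union> {a, b})"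
      have "norm (f x) \<le> e" if "e > 0" for e
      proof -
        have "x \<notin> N" using x by blast
        from N(2)[OF this that] obtain d where d: "d > 0"
          "\<forall>h. 0 < h \<and> h < d \<longrightarrow>
            norm (integral (cbox x (x + h *\<^sub>R One)) ?F /\<^sub>R h ^ DIM(real) - ?F x) < e"
          by (elim exE conjE) (rule that)
        define h where "h = min d (b - x) / 2"
        have h: "0 < h" "h < d" "x + h < b" using d(1) x by (auto simp: h_def min_def field_simps)
        have "integral {x..x + h} ?F = integral {x..x + h} f"
          using x h by (intro integral_cong) auto
        also have "\<dots> = 0" using x h by (intro zero) auto
        finally show ?thesis using d(2)[rule_format, of h] h x by simp
      qed
      then have "norm (f x) \<le> 0" by (rule field_le_epsilon) simp
      then show "f x = 0" by simp
    qed
  qed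
qed

lemma continuous_zero_if_ae_zero:
  fixes f :: "real \<Rightarrow> 'a::real_normed_vector"
  assumes "a < b" "continuous_on {a..b} f" "negligible N" "\<And>x. x \<in> {a..b} - N \<Longrightarrow> f x = 0"
    and "x \<in> {a..b}"
  shows "f x = 0"
proof -
  have "integral {a..b} (\<lambda>x. norm (f x)) = integral {a..b} (\<lambda>x. 0)"
    using assms(4) by (intro integral_spike[OF assms(3)]) auto
  then have "integral {a..b} (\<lambda>x. norm (f x)) = 0" by simp
  then show ?thesis
    using integral_eq_0_iff[OF continuous_on_norm[OF assms(2)] assms(1)] assms(5) by simp
qed

lemma integrable_lebesgue_on_Ioo:
  fixes f :: "real \<Rightarrow> 'a::euclidean_space"
  shows "integrable (lebesgue_on {a<..<b}) f \<longleftrightarrow> f absolutely_integrable_on {a..b}"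
  unfolding absolutely_integrable_on_Icc_iff_Ioo
  by (subst integrable_restrict_space) (auto simp: set_integrable_def)

lemma integrable_lebesgue_on_Icc:
  fixes f :: "real \<Rightarrow> 'a::euclidean_space"
  shows "integrable (lebesgue_on {a..b}) f \<longleftrightarrow> f absolutely_integrable_on {a..b}"
  by (subst integrable_restrict_space) (auto simp: set_integrable_def)

lemma LINT_lebesgue_on_Ioo:
  fixes f :: "real \<Rightarrow> 'a::euclidean_space"
  assumes "f absolutely_integrable_on {a..b}"
  shows "(LINT x|lebesgue_on {a<..<b}. f x) = integral {a..b} f"
  using assms lebesgue_integral_eq_integral[of "{a<..<b}" f]
  by (simp add: integrable_lebesgue_on_Ioo integral_open_interval_real)

lemma LINT_lebesgue_on_Icc:
  fixes f :: "real \<Rightarrow> 'a::euclidean_space"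
  assumes "f absolutely_integrable_on {a..b}"
  shows "(LINT x|lebesgue_on {a..b}. f x) = integral {a..b} f"
  using assms lebesgue_integral_eq_integral[of "{a..b}" f]
  by (simp add: integrable_lebesgue_on_Icc)

lemma test_functionD:
  assumes "test_function a b \<phi>"
  shows "continuous_on UNIV (deriv \<phi>)" "(\<phi> has_vector_derivative deriv \<phi> x) (at x)"
    "\<phi> a = 0" "\<phi> b = 0"
proof -
  obtain D where D: "\<And>x. (\<phi> has_vector_derivative D x) (at x)" "continuous_on UNIV D"
    using assms unfolding test_function_def C1_differentiable_on_def by blast
  have "deriv \<phi> = D"
    using D(1) by (auto intro!: DERIV_imp_deriv simp: has_real_derivative_iff_has_vector_derivative)
  then show "continuous_on UNIV (deriv \<phi>)" "(\<phi> has_vector_derivative deriv \<phi> x) (at x)"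
    using D by auto
  have "{x. \<phi> x \<noteq> 0} \<subseteq> {a<..<b}"
    using assms order_trans[OF closure_subset] unfolding test_function_def by metis
  then show "\<phi> a = 0" "\<phi> b = 0" by auto
qed

text \<open>Integration by parts through the product rule; a test function vanishes at both ends, so
  there is no boundary term.\<close>

lemma has_weak_derivative_if_ac:
  assumes "has_ac_deriv a b f g"
  shows "has_weak_derivative a b f g"
  unfolding has_weak_derivative_def integrable_lebesgue_on_Ioo
proof (intro conjI allI impI)
  show f: "f absolutely_integrable_on {a..b}"
    using has_ac_deriv_continuous_on[OF assms] by (rule absolutely_integrable_continuous_real)
  show g: "g absolutely_integrable_on {a..b}"
    using assms has_ac_deriv_integrable by blast
  fix \<phi> assume \<phi>: "test_function a b \<phi>"
  have c: "continuous_on {a..b} (deriv \<phi>)" "continuous_on {a..b} \<phi>"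
    using test_functionD[OF \<phi>] continuous_on_subset
    by (blast, meson continuous_at_imp_continuous_on has_vector_derivative_continuous)
  have "has_ac_deriv a b \<phi> (deriv \<phi>)"
    by (rule has_ac_deriv_C1[OF c(1) has_vector_derivative_at_within[OF test_functionD(2)[OF \<phi>]]])
  then have p: "has_ac_deriv a b (\<lambda>x. \<phi> x *\<^sub>R f x) (\<lambda>x. \<phi> x *\<^sub>R g x + deriv \<phi> x *\<^sub>R f x)"
    using assms by (rule has_ac_deriv_scaleR)
  have i: "(\<lambda>x. deriv \<phi> x *\<^sub>R f x) absolutely_integrable_on {a..b}"
    "(\<lambda>x. \<phi> x *\<^sub>R g x) absolutely_integrable_on {a..b}"
    using absolutely_integrable_continuous_bilinear[OF bounded_bilinear_scaleR] c f g by auto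
  have "integral {a..b} (\<lambda>x. \<phi> x *\<^sub>R g x) + integral {a..b} (\<lambda>x. deriv \<phi> x *\<^sub>R f x) = 0"
  proof (cases "a \<le> b")
    case True
    have "integral {a..b} (\<lambda>x. \<phi> x *\<^sub>R g x + deriv \<phi> x *\<^sub>R f x) = 0"
      using has_ac_deriv_diff[OF p order_refl True order_refl] test_functionD(3,4)[OF \<phi>] by simp
    then show ?thesis
      using i by (subst (asm) Henstock_Kurzweil_Integration.integral_add) (auto simp: absolutely_integrable_on_def)
  qed auto
  then show "(LINT x|lebesgue_on {a<..<b}. deriv \<phi> x *\<^sub>R f x) =
    - (LINT x|lebesgue_on {a<..<b}. \<phi> x *\<^sub>R g x)"
    using i by (simp add: LINT_lebesgue_on_Ioo eq_neg_iff_add_eq_0 add.commute)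
qed

section \<open>The du Bois-Reymond lemma\<close>

definition ramp :: "real \<Rightarrow> nat \<Rightarrow> real \<Rightarrow> real" where
  "ramp c n x = real (Suc n) * (max 0 (x - c) - max 0 (x - c - 1 / real (Suc n)))"

text \<open>\<open>ramp\<close> is a piecewise linear approximation of the indicator function of (c,
  \<infinity>), rising from 0 to 1 on [c, c + 1/(n+1)]. Writing it with positive parts gives this
  explicit C^1 antiderivative that vanishes to the left of \<open>c\<close>, from which test
  functions are assembled.\<close>

definition ramp_primitive :: "real \<Rightarrow> nat \<Rightarrow> real \<Rightarrow> real" where
  "ramp_primitive c n x = real (Suc n) / 2 * ((max 0 (x - c))\<^sup>2 - (max 0 (x - c - 1 / real (Suc n)))\<^sup>2)"

lemma max_0_square_deriv: "((\<lambda>t::real. (max 0 t)\<^sup>2) has_real_derivative 2 * max 0 t) (at t)"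
proof -
  consider "t < 0" | "t > 0" | "t = 0" by linarith
  then show ?thesis
  proof cases
    case 1
    have "((\<lambda>t::real. 0) has_real_derivative 2 * max 0 t) (at t)"
      using 1 by auto
    then show ?thesis
      by (rule has_field_derivative_transform_within_open[where S="{..<0}"]) (use 1 in auto)
  next
    case 2
    have "((\<lambda>t::real. t\<^sup>2) has_real_derivative 2 * max 0 t) (at t)"
      using 2 by (auto intro!: derivative_eq_intros)
    then show ?thesis
      by (rule has_field_derivative_transform_within_open[where S="{0<..}"]) (use 2 in auto)
  next
    case 3
    have "(\<lambda>h. ((max 0 (0 + h))\<^sup>2 - (max 0 0)\<^sup>2) / h) \<midarrow>0\<rightarrow> (0::real)"
    proof (rule Lim_null_comparison)
      show "\<forall>\<^sub>F h in at (0::real). norm (((max 0 (0 + h))\<^sup>2 - (max 0 0)\<^sup>2) / h) \<le> \<bar>h\<bar>"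
        by (auto simp: max_def power2_eq_square intro!: always_eventually)
      show "((\<lambda>h::real. \<bar>h\<bar>) \<longlongrightarrow> 0) (at 0)"
        using tendsto_rabs_zero[OF tendsto_ident_at] by simp
    qed
    then show ?thesis unfolding 3 DERIV_def by simp
  qed
qed

lemma ramp_primitive_deriv: "(ramp_primitive c n has_real_derivative ramp c n x) (at x)"
proof -
  have d: "((\<lambda>x. (max 0 (x - s))\<^sup>2) has_real_derivative 2 * max 0 (x - s)) (at x)" for s :: real
    using DERIV_shift[of "\<lambda>t. (max 0 t)\<^sup>2" "2 * max 0 (x - s)" x "-s"] max_0_square_deriv[of "x - s"]
    by simp
  have e: "((\<lambda>x. (max 0 (x - c - 1 / real (Suc n)))\<^sup>2) has_real_derivative 2 * max 0 (x - c - 1 / real (Suc n))) (at x)"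
    using d[of "c + 1 / real (Suc n)"] by (simp add: diff_diff_eq)
  show ?thesis
    unfolding ramp_primitive_def[abs_def]
    by (rule DERIV_cong[OF DERIV_cmult[OF DERIV_diff[OF d[of c] e], of "real (Suc n) / 2"]])
       (simp add: ramp_def right_diff_distrib)
qed

lemma ramp_bounds: "0 \<le> ramp c n x" "ramp c n x \<le> 1"
proof -
  have p: "1 / real (Suc n) > 0" by simp
  show "0 \<le> ramp c n x" unfolding ramp_def using p by (intro mult_nonneg_nonneg) linarith+
  have "max 0 (x - c) - max 0 (x - c - 1 / real (Suc n)) \<le> 1 / real (Suc n)"
    using p by linarith
  then have "ramp c n x \<le> real (Suc n) * (1 / real (Suc n))"
    unfolding ramp_def by (intro mult_left_mono) auto
  then show "ramp c n x \<le> 1" by simp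
qed

lemma ramp_tendsto: "(\<lambda>n. ramp c n x) \<longlonglongrightarrow> (if x \<in> {c<..} then 1 else 0)"
proof (cases "x > c")
  case True
  have "(\<lambda>n. 1 / real (Suc n)) \<longlonglongrightarrow> 0"
    using LIMSEQ_inverse_real_of_nat by (simp add: inverse_eq_divide)
  then have "\<forall>\<^sub>F n in sequentially. 1 / real (Suc n) < x - c"
    using True by (intro order_tendstoD) auto
  then have "\<forall>\<^sub>F n in sequentially. ramp c n x = 1"
    by eventually_elim (use True in \<open>simp add: ramp_def max_def field_simps\<close>)
  then show ?thesis using True by (auto intro: tendsto_eventually)
next
  case False
  have "ramp c n x = 0" for n
  proof -
    have "1 / real (Suc n) > 0" by simp
    then have "max 0 (x - c - 1 / real (Suc n)) = 0" "max 0 (x - c) = 0"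
      using False by linarith+
    then show ?thesis by (simp only: ramp_def) simp
  qed
  then show ?thesis using False by simp
qed

lemma continuous_on_ramp: "continuous_on S (ramp c n)"
  unfolding ramp_def[abs_def] by (intro continuous_intros)

lemma ramp_primitive_values:
  "x \<le> c \<Longrightarrow> ramp_primitive c n x = 0"
  "c + 1 / real (Suc n) \<le> x \<Longrightarrow> ramp_primitive c n x = x - c - 1 / (2 * real (Suc n))"
proof -
  define e where "e = 1 / real (Suc n)"
  have e: "e > 0" "real (Suc n) = 1 / e" by (auto simp: e_def)
  show "x \<le> c \<Longrightarrow> ramp_primitive c n x = 0"
    using e(1) unfolding ramp_primitive_def e_def[symmetric] by (simp add: max_def)
  show "c + 1 / real (Suc n) \<le> x \<Longrightarrow> ramp_primitive c n x = x - c - 1 / (2 * real (Suc n))"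
    using e(1) unfolding ramp_primitive_def e_def[symmetric] unfolding e(2)
    by (simp add: max_def field_simps power2_eq_square)
qed

lemma integral_ramp_tendsto:
  fixes w :: "real \<Rightarrow> 'a::euclidean_space"
  assumes w: "w absolutely_integrable_on {a..b}" and c: "a \<le> c"
  shows "(\<lambda>n. integral {a..b} (\<lambda>x. ramp c n x *\<^sub>R w x)) \<longlonglongrightarrow> integral {c..b} w"
proof -
  have "(\<lambda>n. integral {a..b} (\<lambda>x. ramp c n x *\<^sub>R w x)) \<longlonglongrightarrow>
    integral {a..b} (\<lambda>x. (if x \<in> {c<..} then 1 else 0) *\<^sub>R w x)"
  proof (rule dominated_convergence(2)[where h="\<lambda>x. norm (w x)"])
    show "(\<lambda>x. ramp c n x *\<^sub>R w x) integrable_on {a..b}" for n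
      using absolutely_integrable_continuous_bilinear[OF bounded_bilinear_scaleR continuous_on_ramp w]
      by (auto simp: absolutely_integrable_on_def)
    show "(\<lambda>x. norm (w x)) integrable_on {a..b}"
      using w by (auto simp: absolutely_integrable_on_def)
    show "norm (ramp c n x *\<^sub>R w x) \<le> norm (w x)" for n x
      using ramp_bounds[of c n x] by (simp add: mult_left_le_one_le)
    show "(\<lambda>n. ramp c n x *\<^sub>R w x) \<longlonglongrightarrow> (if x \<in> {c<..} then 1 else 0) *\<^sub>R w x" for x
      by (intro tendsto_intros ramp_tendsto)
  qed
  also have "integral {a..b} (\<lambda>x. (if x \<in> {c<..} then 1 else 0) *\<^sub>R w x) =
      integral {a..b} (\<lambda>x. if x \<in> {c..} then w x else 0)"
    by (intro integral_spike[of "{c}"]) auto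
  also have "\<dots> = integral ({a..b} \<inter> {c..}) w"
    by (simp only: Henstock_Kurzweil_Integration.integral_restrict_Int Int_commute)
  also have "{a..b} \<inter> {c..} = {c..b}" using c by auto
  finally show ?thesis .
qed

text \<open>Testing against primitives of differences of normalised indicator functions shows that
  \<open>w\<close> has the same average over all intervals compactly inside. Subtracting that
  average leaves a function with vanishing integrals, hence zero almost everywhere. Indicators are
  not continuous, so they are reached as limits of ramps.\<close>

lemma const_ae_if_weak_derivative_zero:
  fixes w :: "real \<Rightarrow> 'a::euclidean_space"
  assumes ab: "a < b" and w: "w absolutely_integrable_on {a..b}"
    and zero: "\<And>\<phi>. test_function a b \<phi> \<Longrightarrow> integral {a..b} (\<lambda>x. deriv \<phi> x *\<^sub>R w x) = 0"
  shows "\<exists>k N. negligible N \<and> (\<forall>x\<in>{a..b} - N. w x = k)"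
proof -
  have wi: "w integrable_on {c..d}" if "a \<le> c" "d \<le> b" for c d
    using absolutely_integrable_on_subinterval[OF w, of c d] that
    by (auto simp: absolutely_integrable_on_def)
  have avg: "integral {c..d} w /\<^sub>R (d - c) = integral {c'..d'} w /\<^sub>R (d' - c')"
    if cd: "a < c" "c < d" "d < b" "a < c'" "c' < d'" "d' < b" for c d c' d'
  proof -
    \<comment> \<open>Both quotients equal 1 to the right of all ramps, so their difference vanishes
      there as well as on the left: this balance is what gives compact support.\<close>
    define \<phi> where "\<phi> n x = (ramp_primitive c n x - ramp_primitive d n x) / (d - c)
      - (ramp_primitive c' n x - ramp_primitive d' n x) / (d' - c')" for n x
    define \<psi> where "\<psi> n x = (ramp c n x - ramp d n x) / (d - c)
      - (ramp c' n x - ramp d' n x) / (d' - c')" for n x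
    have der: "(\<phi> n has_real_derivative \<psi> n x) (at x)" for n x
      unfolding \<phi>_def[abs_def] \<psi>_def
      by (intro DERIV_diff DERIV_cdivide ramp_primitive_deriv)
    then have deriv: "deriv (\<phi> n) = \<psi> n" for n
      by (auto intro!: DERIV_imp_deriv)
    have c\<psi>: "continuous_on S (\<psi> n)" for n S
      unfolding \<psi>_def[abs_def] using cd by (intro continuous_intros continuous_on_ramp) auto
    \<comment> \<open>The ramps at \<open>d\<close> and \<open>d'\<close> extend to the right by
      1/(n+1); \<open>e\<close> is the room left before \<open>b\<close>.\<close>
    define e where "e = b - max d d'"
    have "e > 0" using cd by (auto simp: e_def)
    have "(\<lambda>n. 1 / real (Suc n)) \<longlonglongrightarrow> 0"
      using LIMSEQ_inverse_real_of_nat by (simp add: inverse_eq_divide)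
    then have ev: "\<forall>\<^sub>F n in sequentially. 1 / real (Suc n) < e"
      using \<open>e > 0\<close> by (intro order_tendstoD) auto
    have test: "test_function a b (\<phi> n)" if n: "1 / real (Suc n) < e" for n
      unfolding test_function_def
    proof
      show "\<phi> n C1_differentiable_on UNIV"
        unfolding C1_differentiable_on_def using der c\<psi>
        by (intro exI[of _ "\<psi> n"]) (auto simp: has_real_derivative_iff_has_vector_derivative)
      let ?l = "min c c'" and ?r = "max d d' + 1 / real (Suc n)"
      have left: "\<phi> n x = 0" if "x < ?l" for x
        using that cd by (simp add: \<phi>_def ramp_primitive_values)
      have right: "\<phi> n x = 0" if "x > ?r" for x
      proof -
        have p: "1 / real (Suc n) > 0" by simp
        have "ramp_primitive z n x = x - z - 1 / (2 * real (Suc n))" if "z \<le> max d d'" for z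
          using that \<open>x > ?r\<close> p by (intro ramp_primitive_values) linarith
        then show ?thesis unfolding \<phi>_def using cd by simp
      qed
      have "{x. \<phi> n x \<noteq> 0} \<subseteq> {?l..?r}"
      proof
        fix x assume "x \<in> {x. \<phi> n x \<noteq> 0}"
        then have "\<not> x < ?l" "\<not> x > ?r"
          using left[of x] right[of x] by blast+
        then show "x \<in> {?l..?r}" unfolding atLeastAtMost_iff linorder_not_less by blast
      qed
      then have "closure {x. \<phi> n x \<noteq> 0} \<subseteq> {?l..?r}"
        by (rule closure_minimal) auto
      also have "\<dots> \<subseteq> {a<..<b}" using cd n by (auto simp: e_def simp del: of_nat_Suc)
      finally show "closure {x. \<phi> n x \<noteq> 0} \<subseteq> {a<..<b}" .
    qed
    let ?I = "\<lambda>z n. integral {a..b} (\<lambda>x. ramp z n x *\<^sub>R w x)"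
    have ri: "(\<lambda>x. ramp z n x *\<^sub>R w x) integrable_on {a..b}" for z n
      using absolutely_integrable_continuous_bilinear[OF bounded_bilinear_scaleR continuous_on_ramp w]
      by (auto simp: absolutely_integrable_on_def)
    let ?J = "\<lambda>n. (?I c n - ?I d n) /\<^sub>R (d - c) - (?I c' n - ?I d' n) /\<^sub>R (d' - c')"
    have J: "integral {a..b} (\<lambda>x. \<psi> n x *\<^sub>R w x) = ?J n" for n
    proof -
      have "((\<lambda>x. (ramp c n x *\<^sub>R w x - ramp d n x *\<^sub>R w x) /\<^sub>R (d - c) - (ramp c' n x *\<^sub>R w x - ramp d' n x *\<^sub>R w x) /\<^sub>R (d' - c'))
        has_integral ?J n) {a..b}"
        by (intro has_integral_diff has_integral_cmul integrable_integral ri)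
      moreover have "(\<lambda>x. \<psi> n x *\<^sub>R w x) = (\<lambda>x. (ramp c n x *\<^sub>R w x - ramp d n x *\<^sub>R w x) /\<^sub>R (d - c) - (ramp c' n x *\<^sub>R w x - ramp d' n x *\<^sub>R w x) /\<^sub>R (d' - c'))"
        by (simp add: \<psi>_def divide_inverse algebra_simps)
      ultimately show ?thesis by (simp add: integral_unique)
    qed
    have "?J n = 0" if "1 / real (Suc n) < e" for n
      using zero[OF test[OF that]] unfolding deriv J .
    then have "\<forall>\<^sub>F n in sequentially. ?J n = 0"
      by (rule eventually_mono[OF ev])
    then have "?J \<longlonglongrightarrow> 0" by (rule tendsto_eventually)
    moreover have "?J \<longlonglongrightarrow> (integral {c..b} w - integral {d..b} w) /\<^sub>R (d - c)
      - (integral {c'..b} w - integral {d'..b} w) /\<^sub>R (d' - c')"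
      using cd by (intro tendsto_intros integral_ramp_tendsto w) auto
    ultimately have "(integral {c..b} w - integral {d..b} w) /\<^sub>R (d - c)
      - (integral {c'..b} w - integral {d'..b} w) /\<^sub>R (d' - c') = 0"
      using LIMSEQ_unique by blast
    moreover have "integral {c..d} w + integral {d..b} w = integral {c..b} w"
      "integral {c'..d'} w + integral {d'..b} w = integral {c'..b} w"
      using cd by (intro Henstock_Kurzweil_Integration.integral_combine wi; simp)+
    then have "integral {c..b} w - integral {d..b} w = integral {c..d} w"
      "integral {c'..b} w - integral {d'..b} w = integral {c'..d'} w"
      by (metis add_diff_cancel_right')+
    ultimately show ?thesis by simp
  qed
  define c0 d0 where "c0 = a + (b - a) / 3" and "d0 = a + (b - a) / 2"
  have cd0: "a < c0" "c0 < d0" "d0 < b" using ab by (auto simp: c0_def d0_def field_simps)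
  define k where "k = integral {c0..d0} w /\<^sub>R (d0 - c0)"
  have "integral {c..d} (\<lambda>x. w x - k) = 0" if "a < c" "c < d" "d < b" for c d
  proof -
    have "integral {c..d} (\<lambda>x. w x - k) = integral {c..d} w - (d - c) *\<^sub>R k"
      using that by (subst Henstock_Kurzweil_Integration.integral_diff) (auto intro!: wi)
    moreover have "k = integral {c..d} w /\<^sub>R (d - c)"
      unfolding k_def using avg[OF cd0 that] .
    ultimately show ?thesis using that by simp
  qed
  note zz = this
  have "(\<lambda>x. w x - k) integrable_on {a..b}"
    using wi[of a b] by (intro integrable_diff) auto
  then obtain N where "negligible N" "\<forall>x\<in>{a..b} - N. w x - k = 0"
    using zero_ae_if_integral_zero[OF _ zz] by blast
  then have "negligible N \<and> (\<forall>x\<in>{a..b} - N. w x = k)" by simp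
  then show ?thesis by blast
qed

text \<open>The function \<open>f\<close> minus the indefinite integral of \<open>g\<close> has weak
  derivative zero, hence is constant almost everywhere.\<close>

lemma has_weak_derivative_imp_ac:
  fixes f :: "real \<Rightarrow> 'a::euclidean_space"
  assumes ab: "a < b" and f: "has_weak_derivative a b f g"
  shows "\<exists>F N. has_ac_deriv a b F g \<and> negligible N \<and> (\<forall>x\<in>{a..b} - N. f x = F x)"
proof -
  have fi: "f absolutely_integrable_on {a..b}" and gi: "g absolutely_integrable_on {a..b}"
    using f unfolding has_weak_derivative_def integrable_lebesgue_on_Ioo by auto
  define G where "G x = integral {a..x} g" for x
  have G: "has_ac_deriv a b G g"
    using gi unfolding has_ac_deriv_def G_def by simp
  have Gi: "G absolutely_integrable_on {a..b}"
    using has_ac_deriv_continuous_on[OF G] by (rule absolutely_integrable_continuous_real)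
  have z: "integral {a..b} (\<lambda>x. deriv \<phi> x *\<^sub>R (f x - G x)) = 0" if "test_function a b \<phi>" for \<phi>
  proof -
    have c: "continuous_on {a..b} (deriv \<phi>)"
      using test_functionD(1)[OF that] continuous_on_subset by blast
    have i: "(\<lambda>x. deriv \<phi> x *\<^sub>R f x) absolutely_integrable_on {a..b}"
      "(\<lambda>x. deriv \<phi> x *\<^sub>R G x) absolutely_integrable_on {a..b}"
      using absolutely_integrable_continuous_bilinear[OF bounded_bilinear_scaleR c] fi Gi by auto
    have "(LINT x|lebesgue_on {a<..<b}. deriv \<phi> x *\<^sub>R f x) = (LINT x|lebesgue_on {a<..<b}. deriv \<phi> x *\<^sub>R G x)"
      using f has_weak_derivative_if_ac[OF G] that unfolding has_weak_derivative_def by auto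
    then have "integral {a..b} (\<lambda>x. deriv \<phi> x *\<^sub>R f x) = integral {a..b} (\<lambda>x. deriv \<phi> x *\<^sub>R G x)"
      using i by (simp add: LINT_lebesgue_on_Ioo)
    then show ?thesis
      using i by (simp add: scaleR_diff_right absolutely_integrable_on_def Henstock_Kurzweil_Integration.integral_diff)
  qed
  have "(\<lambda>x. f x - G x) absolutely_integrable_on {a..b}"
    using fi Gi by auto
  then obtain k N where N: "negligible N" "\<forall>x\<in>{a..b} - N. f x - G x = k"
    using const_ae_if_weak_derivative_zero[OF ab _ z] by blast
  show ?thesis
  proof (intro exI conjI)
    show "has_ac_deriv a b (\<lambda>x. G x + k) g"
      using gi unfolding has_ac_deriv_def G_def by simp
    show "negligible N" by fact
    show "\<forall>x\<in>{a..b} - N. f x = G x + k"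
      using N(2) by (simp add: diff_eq_eq add.commute)
  qed
qed

lemma has_ac_deriv_unique:
  assumes "a < b" "has_ac_deriv a b f g" "has_ac_deriv a b f g'"
  shows "\<exists>N. negligible N \<and> (\<forall>x\<in>{a..b} - N. g x = g' x)"
proof -
  have i: "(\<lambda>x. g x - g' x) integrable_on {a..b}"
    by (rule integrable_diff[OF has_ac_deriv_integrable(2)[OF assms(2) order_refl order_refl]
          has_ac_deriv_integrable(2)[OF assms(3) order_refl order_refl]])
  have z: "integral {c..d} (\<lambda>x. g x - g' x) = 0" if "a < c" "c < d" "d < b" for c d
    using has_ac_deriv_integrable(2)[OF assms(2), of c d] has_ac_deriv_integrable(2)[OF assms(3), of c d]
      has_ac_deriv_diff[OF assms(2), of c d] has_ac_deriv_diff[OF assms(3), of c d] that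
    by (simp add: Henstock_Kurzweil_Integration.integral_diff)
  show ?thesis
    using zero_ae_if_integral_zero[OF i z] by simp
qed

lemma has_weak_derivative_ac_unique:
  fixes f :: "real \<Rightarrow> 'a::euclidean_space"
  assumes ab: "a < b" and f: "has_weak_derivative a b f g" "has_ac_deriv a b f g'"
  shows "\<exists>N. negligible N \<and> (\<forall>x\<in>{a..b} - N. g x = g' x)"
proof -
  obtain F N where F: "has_ac_deriv a b F g" "negligible N" "\<forall>x\<in>{a..b} - N. f x = F x"
    using has_weak_derivative_imp_ac[OF ab f(1)] by blast
  have fF: "f x - F x = 0" if "x \<in> {a..b}" for x
  proof (rule continuous_zero_if_ae_zero[OF ab _ F(2) _ that])
    show "continuous_on {a..b} (\<lambda>x. f x - F x)"
      by (intro continuous_intros has_ac_deriv_continuous_on[OF f(2)] has_ac_deriv_continuous_on[OF F(1)])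
    show "f x - F x = 0" if "x \<in> {a..b} - N" for x
      using F(3) that by simp
  qed
  have "has_ac_deriv a b f g"
  proof (rule has_ac_deriv_cong[OF F(1)])
    show "F x = f x" if "a \<le> x" "x \<le> b" for x
      using fF[of x] that by simp
  qed simp
  then show ?thesis by (rule has_ac_deriv_unique[OF ab _ f(2)])
qed

text \<open>\<open>weak_deriv\<close> is an arbitrary choice among representatives. This makes it
  computable up to a null set for every absolutely continuous function.\<close>

lemma weak_deriv_ac:
  fixes f :: "real \<Rightarrow> 'a::euclidean_space"
  assumes "a < b" "has_ac_deriv a b f g"
  shows "\<exists>N. negligible N \<and> (\<forall>x\<in>{a..b} - N. weak_deriv a b f x = g x)"
proof -
  have "has_weak_derivative a b f (weak_deriv a b f)"
    unfolding weak_deriv_def by (rule someI[of "has_weak_derivative a b f", OF has_weak_derivative_if_ac[OF assms(2)]])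
  then show ?thesis
    by (rule has_weak_derivative_ac_unique[OF assms(1) _ assms(2)])
qed

section \<open>Immersed curves of class H^2\<close>

text \<open>The embedding of H^2 into C^1 for the continuous representative: the first weak
  derivative agrees almost everywhere with a continuous \<open>W\<close>, so the curve is an
  indefinite integral of \<open>W\<close> and has \<open>W\<close> as its classical derivative,
  one-sided at the ends.\<close>

lemma H2_curve_derivative:
  fixes \<gamma> :: "real \<Rightarrow> 'a::euclidean_space"
  assumes ab: "a < b" and \<gamma>: "continuous_on {a..b} \<gamma>" "W22_on a b \<gamma>"
  obtains h where "has_ac_deriv a b (curve_deriv a b \<gamma>) h" "(\<lambda>x. (norm (h x))\<^sup>2) integrable_on {a..b}"
    "\<And>x. x \<in> {a..b} \<Longrightarrow> (\<gamma> has_vector_derivative curve_deriv a b \<gamma> x) (at x within {a..b})"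
proof -
  obtain g h where gh: "L2_on a b h" "has_weak_derivative a b \<gamma> g" "has_weak_derivative a b g h"
    using \<gamma>(2) unfolding W22_on_def by blast
  have h2: "(\<lambda>x. (norm (h x))\<^sup>2) integrable_on {a..b}"
    using gh(1) unfolding L2_on_def integrable_lebesgue_on_Ioo by (simp add: absolutely_integrable_on_def)
  obtain W N where W: "has_ac_deriv a b W h" "negligible N" "\<forall>x\<in>{a..b} - N. g x = W x"
    using has_weak_derivative_imp_ac[OF ab gh(3)] by blast
  obtain F M where F: "has_ac_deriv a b F g" "negligible M" "\<forall>x\<in>{a..b} - M. \<gamma> x = F x"
    using has_weak_derivative_imp_ac[OF ab gh(2)] by blast
  \<comment> \<open>Replacing \<open>g\<close> by its continuous representative leaves all integrals
    unchanged, and only then does differentiating the integral work at every point.\<close>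
  have F': "has_ac_deriv a b F W"
    using W(3) by (intro has_ac_deriv_spike[OF F(1) W(2)]) simp
  have eq: "\<gamma> x - F x = 0" if "x \<in> {a..b}" for x
  proof (rule continuous_zero_if_ae_zero[OF ab _ F(2) _ that])
    show "continuous_on {a..b} (\<lambda>x. \<gamma> x - F x)"
      by (intro continuous_on_diff \<gamma>(1) has_ac_deriv_continuous_on[OF F(1)])
    show "\<gamma> x - F x = 0" if "x \<in> {a..b} - M" for x
      using F(3) that by simp
  qed
  have der: "(\<gamma> has_vector_derivative W x) (at x within {a..b})" if x: "x \<in> {a..b}" for x
  proof -
    have "((\<lambda>u. integral {a..u} W) has_vector_derivative W x) (at x within {a..b})"
      by (rule integral_has_vector_derivative[OF has_ac_deriv_continuous_on[OF W(1)] x])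
    then have "((\<lambda>u. F a + integral {a..u} W) has_vector_derivative W x) (at x within {a..b})"
      by (auto intro!: derivative_eq_intros)
    then show ?thesis
    proof (rule has_vector_derivative_transform[OF x, rotated])
      fix u assume "u \<in> {a..b}"
      then show "\<gamma> u = F a + integral {a..u} W"
        using has_ac_derivD[OF F', of u] eq[of u] by simp
    qed
  qed
  have cd: "curve_deriv a b \<gamma> x = W x" if "x \<in> {a..b}" for x
    unfolding curve_deriv_def using vector_derivative_within_closed_interval[OF ab that der[OF that]] .
  show thesis
  proof (rule that)
    show "has_ac_deriv a b (curve_deriv a b \<gamma>) h"
      by (rule has_ac_deriv_cong[OF W(1)]) (simp_all add: cd)
    show "(\<gamma> has_vector_derivative curve_deriv a b \<gamma> x) (at x within {a..b})" if "x \<in> {a..b}" for x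
      using der[OF that] cd[OF that] by simp
  qed (rule h2)
qed

text \<open>Collects what the geometric arguments use of an immersed curve. Since \<open>g\<close>
  is the derivative of the unit tangent T in the given parameter, the curvature vector is
  \<open>g\<close> divided by the speed, and |g|^2 / speed dx is the energy density |kappa|^2 ds.
  Orthogonality of \<open>g\<close> to T is the infinitesimal form of |T| = 1.\<close>

lemma immersed_H2_curve_structure:
  fixes \<gamma> :: "real \<Rightarrow> 'a::euclidean_space"
  assumes "immersed_H2_curve a b \<gamma>"
  shows "\<exists>g. has_ac_deriv a b (unit_tangent a b \<gamma>) g \<and>
    (\<forall>x\<in>{a..b}. unit_tangent a b \<gamma> x \<bullet> g x = 0) \<and>
    (\<lambda>x. (norm (g x))\<^sup>2 / speed a b \<gamma> x) absolutely_integrable_on {a..b}"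
    and "continuous_on {a..b} (speed a b \<gamma>)"
    and "x \<in> {a..b} \<Longrightarrow> speed a b \<gamma> x > 0"
    and "x \<in> {a..b} \<Longrightarrow> norm (unit_tangent a b \<gamma> x) = 1"
    and "x \<in> {a..b} \<Longrightarrow>
      (\<gamma> has_vector_derivative speed a b \<gamma> x *\<^sub>R unit_tangent a b \<gamma> x) (at x within {a..b})"
proof -
  have ab: "a < b" and c\<gamma>: "continuous_on {a..b} \<gamma>" and W22: "W22_on a b \<gamma>"
    and nz: "\<And>x. x \<in> {a..b} \<Longrightarrow> curve_deriv a b \<gamma> x \<noteq> 0"
    using assms unfolding immersed_H2_curve_def by auto
  define W where "W = curve_deriv a b \<gamma>"
  define \<rho> where "\<rho> x = W x \<bullet> W x" for x
  obtain h where h: "has_ac_deriv a b W h" "(\<lambda>x. (norm (h x))\<^sup>2) integrable_on {a..b}"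
    "\<And>x. x \<in> {a..b} \<Longrightarrow> (\<gamma> has_vector_derivative W x) (at x within {a..b})"
    using H2_curve_derivative[OF ab c\<gamma> W22] unfolding W_def by metis
  have cW: "continuous_on {a..b} W" by (rule has_ac_deriv_continuous_on[OF h(1)])
  have W0: "norm (W x) > 0" if "x \<in> {a..b}" for x using nz[OF that] by (simp add: W_def)
  have \<rho>: "has_ac_deriv a b \<rho> (\<lambda>x. W x \<bullet> h x + h x \<bullet> W x)"
    unfolding \<rho>_def by (rule has_ac_deriv_inner[OF h(1) h(1)])
  have \<rho>n: "\<rho> x = (norm (W x))\<^sup>2" for x by (simp add: \<rho>_def power2_norm_eq_inner)
  have c\<rho>: "continuous_on {a..b} \<rho>" by (rule has_ac_deriv_continuous_on[OF \<rho>])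
  \<comment> \<open>The extrema of the squared speed supply a compact interval inside the positive
    reals on which t \<mapsto> 1 / sqrt t is smooth, so that the chain rule applies.\<close>
  obtain p q where p: "p \<in> {a..b}" "\<And>x. x \<in> {a..b} \<Longrightarrow> \<rho> p \<le> \<rho> x"
    and q: "q \<in> {a..b}" "\<And>x. x \<in> {a..b} \<Longrightarrow> \<rho> x \<le> \<rho> q"
    using continuous_attains_inf[OF compact_Icc _ c\<rho>] continuous_attains_sup[OF compact_Icc _ c\<rho>] ab
    by (metis atLeastAtMost_iff empty_iff less_eq_real_def)
  have pos: "\<rho> p > 0" using W0[OF p(1)] by (simp add: \<rho>n)
  let ?J = "{\<rho> p..\<rho> q}"
  have N: "has_ac_deriv a b (\<lambda>x. 1 / sqrt (\<rho> x)) (\<lambda>x. - 1 / (2 * \<rho> x * sqrt (\<rho> x)) * (W x \<bullet> h x + h x \<bullet> W x))"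
  proof (rule has_ac_deriv_compose[OF \<rho>, where c="\<rho> p" and d="\<rho> q" and F="\<lambda>t. 1 / sqrt t"
        and F'="\<lambda>t. - 1 / (2 * t * sqrt t)" and F''="\<lambda>t. 3 / (4 * t\<^sup>2 * sqrt t)"])
    show "\<rho> x \<in> ?J" if "a \<le> x" "x \<le> b" for x using p(2) q(2) that by simp
    fix t assume "t \<in> ?J"
    then have t: "t > 0" using pos by auto
    have s: "sqrt t * sqrt t = t" "sqrt t > 0" using t by auto
    show "((\<lambda>t. 1 / sqrt t) has_real_derivative - 1 / (2 * t * sqrt t)) (at t within ?J)"
      by (rule has_field_derivative_at_within)
         (use t s in \<open>auto intro!: derivative_eq_intros simp: field_simps\<close>)
    show "((\<lambda>t. - 1 / (2 * t * sqrt t)) has_real_derivative 3 / (4 * t\<^sup>2 * sqrt t)) (at t within ?J)"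
      by (rule has_field_derivative_at_within)
         (use t s in \<open>auto intro!: derivative_eq_intros simp: field_simps power2_eq_square\<close>)
  next
    show "continuous_on ?J (\<lambda>t. 3 / (4 * t\<^sup>2 * sqrt t))"
      using pos by (intro continuous_intros) auto
  qed
  define g where "g x = (1 / sqrt (\<rho> x)) *\<^sub>R h x
    + (- 1 / (2 * \<rho> x * sqrt (\<rho> x)) * (W x \<bullet> h x + h x \<bullet> W x)) *\<^sub>R W x" for x
  have sq: "sqrt (\<rho> x) = speed a b \<gamma> x" for x
    by (simp add: \<rho>n speed_def W_def)
  have T: "has_ac_deriv a b (unit_tangent a b \<gamma>) g"
    using has_ac_deriv_scaleR[OF N h(1)]
    unfolding g_def[abs_def] sq unfolding W_def unit_tangent_def[abs_def] .
  \<comment> \<open>Geometrically, \<open>g\<close> is the component of the second derivative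
    \<open>h\<close> orthogonal to \<open>W\<close>, divided by |W|. Both orthogonality and the
    bound by \<open>h\<close> follow from this form.\<close>
  have geq: "g x = (1 / norm (W x)) *\<^sub>R (h x - ((W x \<bullet> h x) / (norm (W x))\<^sup>2) *\<^sub>R W x)"
    if "x \<in> {a..b}" for x
    using W0[OF that] unfolding g_def \<rho>n by (simp add: algebra_simps inner_commute power2_eq_square)
  have Tg: "unit_tangent a b \<gamma> x \<bullet> g x = 0" if "x \<in> {a..b}" for x
    using W0[OF that] unfolding geq[OF that] unit_tangent_def W_def[symmetric]
    by (simp add: inner_diff_right power2_norm_eq_inner)
  have gh: "(norm (g x))\<^sup>2 \<le> (norm (h x))\<^sup>2 / (norm (W x))\<^sup>2" if "x \<in> {a..b}" for x
  proof -
    let ?c = "(W x \<bullet> h x) / (norm (W x))\<^sup>2"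
    have c: "?c * (W x \<bullet> W x) = W x \<bullet> h x"
      using W0[OF that] by (simp add: power2_norm_eq_inner)
    have "(norm (h x - ?c *\<^sub>R W x))\<^sup>2 = (norm (h x))\<^sup>2 - 2 * ?c * (W x \<bullet> h x) + ?c * (?c * (W x \<bullet> W x))"
      by (simp add: power2_norm_eq_inner inner_diff_left inner_diff_right inner_commute algebra_simps)
    also have "\<dots> = (norm (h x))\<^sup>2 - ?c * (W x \<bullet> h x)" unfolding c by simp
    also have "\<dots> = (norm (h x))\<^sup>2 - (W x \<bullet> h x)\<^sup>2 / (norm (W x))\<^sup>2"
      by (simp add: power2_eq_square)
    also have "\<dots> \<le> (norm (h x))\<^sup>2" by simp
    finally show ?thesis
      unfolding geq[OF that] using W0[OF that]
      by (simp add: power_mult_distrib power_divide divide_right_mono)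
  qed
  have cs: "continuous_on {a..b} (speed a b \<gamma>)"
    unfolding speed_def[abs_def] W_def[symmetric] by (intro continuous_on_norm cW)
  have sp: "speed a b \<gamma> x > 0" if "x \<in> {a..b}" for x
    using W0[OF that] by (simp add: speed_def W_def)
  have sW: "speed a b \<gamma> x = norm (W x)" for x by (simp add: speed_def W_def)
  \<comment> \<open>The density is dominated by |h|^2 / |W|^3, and |W| is continuous and nonzero on
    the compact interval; this is where the square integrability of the second derivative
    enters.\<close>
  have int: "(\<lambda>x. (norm (g x))\<^sup>2 / speed a b \<gamma> x) absolutely_integrable_on {a..b}"
  proof (rule measurable_bounded_by_integrable_imp_absolutely_integrable)
    have "g \<in> borel_measurable (lebesgue_on {a..b})"
      using has_ac_deriv_integrable(1)[OF T order_refl order_refl]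
      by (simp add: borel_measurable_integrable integrable_lebesgue_on_Icc)
    moreover have "speed a b \<gamma> \<in> borel_measurable (lebesgue_on {a..b})"
      using cs by (rule continuous_imp_measurable_on_sets_lebesgue) simp
    ultimately show "(\<lambda>x. (norm (g x))\<^sup>2 / speed a b \<gamma> x) \<in> borel_measurable (lebesgue_on {a..b})"
      by measurable
    have "(\<lambda>x. (norm (h x))\<^sup>2) absolutely_integrable_on {a..b}"
      using h(2) by (rule nonnegative_absolutely_integrable_1) simp
    then have "(\<lambda>x. 1 / (norm (W x))^3 * (norm (h x))\<^sup>2) absolutely_integrable_on {a..b}"
      using W0 by (intro absolutely_integrable_continuous_bilinear[OF bounded_bilinear_mult] continuous_intros cW) force+
    then show "(\<lambda>x. 1 / (norm (W x))^3 * (norm (h x))\<^sup>2) integrable_on {a..b}"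
      by (simp add: absolutely_integrable_on_def)
    show "norm ((norm (g x))\<^sup>2 / speed a b \<gamma> x) \<le> 1 / (norm (W x))^3 * (norm (h x))\<^sup>2"
      if x: "x \<in> {a..b}" for x
    proof -
      have "(norm (g x))\<^sup>2 / norm (W x) \<le> ((norm (h x))\<^sup>2 / (norm (W x))\<^sup>2) / norm (W x)"
        using gh[OF x] by (rule divide_right_mono) simp
      then show ?thesis by (simp add: sW power2_eq_square power3_eq_cube)
    qed
  qed simp
  show "\<exists>g. has_ac_deriv a b (unit_tangent a b \<gamma>) g \<and>
    (\<forall>x\<in>{a..b}. unit_tangent a b \<gamma> x \<bullet> g x = 0) \<and>
    (\<lambda>x. (norm (g x))\<^sup>2 / speed a b \<gamma> x) absolutely_integrable_on {a..b}"
    using T Tg int by blast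
  show "continuous_on {a..b} (speed a b \<gamma>)" by (rule cs)
  show "speed a b \<gamma> x > 0" if "x \<in> {a..b}" by (rule sp[OF that])
  show "norm (unit_tangent a b \<gamma> x) = 1" if "x \<in> {a..b}"
    using sp[OF that] by (simp add: unit_tangent_def speed_def)
  show "(\<gamma> has_vector_derivative speed a b \<gamma> x *\<^sub>R unit_tangent a b \<gamma> x) (at x within {a..b})"
    if "x \<in> {a..b}"
    using h(3)[OF that] sp[OF that] by (simp add: unit_tangent_def W_def)
qed

lemma curvature_ac:
  fixes \<gamma> :: "real \<Rightarrow> 'a::euclidean_space"
  assumes "a < b" "has_ac_deriv a b (unit_tangent a b \<gamma>) g"
  shows "\<exists>N. negligible N \<and> (\<forall>x\<in>{a..b} - N. curvature a b \<gamma> x = (1 / speed a b \<gamma> x) *\<^sub>R g x)"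
  using weak_deriv_ac[OF assms] unfolding curvature_def by metis

text \<open>The chosen weak derivative agrees with \<open>g\<close> off a null set, where |g / v|^2
  v = |g|^2 / v for the speed v. Integrability must be transferred along with the values, since
  \<open>LINT\<close> returns 0 on integrands that are not integrable.\<close>

lemma bending_energy_ac:
  fixes \<gamma> :: "real \<Rightarrow> 'a::euclidean_space"
  assumes ab: "a < b" and T: "has_ac_deriv a b (unit_tangent a b \<gamma>) g"
    and int: "(\<lambda>x. (norm (g x))\<^sup>2 / speed a b \<gamma> x) absolutely_integrable_on {a..b}"
    and pos: "\<And>x. x \<in> {a..b} \<Longrightarrow> speed a b \<gamma> x > 0"
  shows "bending_energy a b \<gamma> = integral {a..b} (\<lambda>x. (norm (g x))\<^sup>2 / speed a b \<gamma> x)"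
proof -
  obtain N where N: "negligible N" "\<forall>x\<in>{a..b} - N. curvature a b \<gamma> x = (1 / speed a b \<gamma> x) *\<^sub>R g x"
    using curvature_ac[OF ab T] by blast
  have eq: "(norm (curvature a b \<gamma> x))\<^sup>2 * speed a b \<gamma> x = (norm (g x))\<^sup>2 / speed a b \<gamma> x"
    if "x \<in> {a..b} - N" for x
    using N(2) that pos[of x] by (simp add: power_divide power2_eq_square)
  have i: "(\<lambda>x. (norm (curvature a b \<gamma> x))\<^sup>2 * speed a b \<gamma> x) absolutely_integrable_on {a..b}"
    using absolutely_integrable_spike[OF int N(1) eq] by blast
  have "integral {a..b} (\<lambda>x. (norm (curvature a b \<gamma> x))\<^sup>2 * speed a b \<gamma> x)
      = integral {a..b} (\<lambda>x. (norm (g x))\<^sup>2 / speed a b \<gamma> x)"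
    by (rule integral_spike[OF N(1)]) (use eq in simp)
  then show ?thesis
    unfolding bending_energy_def LINT_lebesgue_on_Icc[OF i] .
qed

section \<open>Elliptic integrals and Jacobi elliptic functions\<close>

definition ell_delta :: "real \<Rightarrow> real \<Rightarrow> real" where
  "ell_delta m \<theta> = sqrt (1 - m * (sin \<theta>)\<^sup>2)"

definition ell_E_inc :: "real \<Rightarrow> real \<Rightarrow> real" where
  "ell_E_inc x m = (LBINT \<theta>=0..x. ell_delta m \<theta>)"

lemma ell_delta_radicand:
  fixes m \<theta> :: real
  assumes "0 \<le> m" "m < 1"
  shows "0 < 1 - m * (sin \<theta>)\<^sup>2"
proof -
  have "(sin \<theta>)\<^sup>2 \<le> 1" by (simp add: abs_square_le_1)
  from mult_left_mono[OF this assms(1)] have "m * (sin \<theta>)\<^sup>2 \<le> m" by simp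
  then show ?thesis using assms by simp
qed

lemma ell_delta_bounds:
  assumes "0 \<le> m" "m < 1"
  shows "0 < ell_delta m \<theta>" "ell_delta m \<theta> \<le> 1" "(ell_delta m \<theta>)\<^sup>2 = 1 - m * (sin \<theta>)\<^sup>2"
  using ell_delta_radicand[OF assms, of \<theta>] assms unfolding ell_delta_def
  by (auto intro!: mult_nonneg_nonneg)

lemma ell_delta_minus [simp]: "ell_delta m (- \<theta>) = ell_delta m \<theta>"
  by (simp add: ell_delta_def)

lemma continuous_on_ell_delta: "continuous_on S (ell_delta m)"
  unfolding ell_delta_def[abs_def] by (intro continuous_intros)

lemma LBINT_0_deriv:
  fixes f :: "real \<Rightarrow> real"
  assumes "continuous_on UNIV f"
  shows "((\<lambda>x. LBINT \<theta>=0..x. f \<theta>) has_real_derivative f x) (at x)"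
proof -
  let ?I = "{-\<bar>x\<bar> - 1..\<bar>x\<bar> + 1}"
  have "((\<lambda>x. LBINT \<theta>=ereal 0..x. f \<theta>) has_vector_derivative f x) (at x within ?I)"
    by (rule interval_integral_FTC2) (auto intro: continuous_on_subset[OF assms])
  moreover have "at x within ?I = at x"
    by (rule at_within_interior) auto
  ultimately show ?thesis
    by (simp add: has_real_derivative_iff_has_vector_derivative zero_ereal_def)
qed

lemma LBINT_0_odd:
  fixes f :: "real \<Rightarrow> real" and x :: real
  assumes "\<And>x. f (- x) = f x"
  shows "(LBINT \<theta>=0..ereal (- x). f \<theta>) = - (LBINT \<theta>=0..x. f \<theta>)"
proof -
  have "(LBINT \<theta>=0..ereal (- x). f \<theta>) = - (LBINT \<theta>=ereal (- x)..0. f \<theta>)"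
    by (rule interval_integral_endpoints_reverse)
  also have "(LBINT \<theta>=ereal (- x)..0. f \<theta>) = (LBINT \<theta>=0..x. f \<theta>)"
    using interval_integral_reflect[of "ereal (-x)" 0 f] assms by simp
  finally show ?thesis .
qed

lemma LBINT_0_pi_half:
  fixes f :: "real \<Rightarrow> real"
  assumes "continuous_on UNIV f"
  shows "(LBINT \<theta>=0..pi/2. f \<theta>) = integral {0..pi/2} f"
proof -
  have "set_integrable lborel {0..pi/2} f"
    by (intro borel_integrable_atLeastAtMost' continuous_on_subset[OF assms]) auto
  then show ?thesis
    using interval_integral_eq_integral[of 0 "pi/2" f] by (simp add: zero_ereal_def)
qed

lemma ell_F_delta: "ell_F x m = (LBINT \<theta>=0..x. 1 / ell_delta m \<theta>)"
  by (simp add: ell_F_def ell_delta_def)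

lemma ell_E_delta: "ell_E m = ell_E_inc (pi / 2) m"
  by (simp add: ell_E_def ell_E_inc_def ell_delta_def)

context
  fixes m :: real
  assumes m: "0 \<le> m" "m < 1"
begin

lemma continuous_on_inverse_ell_delta: "continuous_on S (\<lambda>\<theta>. 1 / ell_delta m \<theta>)"
  using ell_delta_bounds(1)[OF m] by (intro continuous_intros continuous_on_ell_delta) (metis less_irrefl)

lemma ell_F_deriv: "((\<lambda>x. ell_F x m) has_real_derivative 1 / ell_delta m x) (at x)"
  unfolding ell_F_delta by (rule LBINT_0_deriv[OF continuous_on_inverse_ell_delta])

lemma ell_E_inc_deriv: "((\<lambda>x. ell_E_inc x m) has_real_derivative ell_delta m x) (at x)"
  unfolding ell_E_inc_def by (rule LBINT_0_deriv[OF continuous_on_ell_delta])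

lemma ell_F_0: "ell_F 0 m = 0"
  by (simp add: ell_F_def zero_ereal_def[symmetric])

lemma ell_E_inc_0: "ell_E_inc 0 m = 0"
  by (simp add: ell_E_inc_def zero_ereal_def[symmetric])

lemma ell_F_odd: "ell_F (- x) m = - ell_F x m"
  unfolding ell_F_delta by (rule LBINT_0_odd) simp

lemma ell_E_inc_odd: "ell_E_inc (- x) m = - ell_E_inc x m"
  unfolding ell_E_inc_def by (rule LBINT_0_odd) simp

lemma ell_F_strict_mono: "x < y \<Longrightarrow> ell_F x m < ell_F y m"
  by (rule DERIV_pos_imp_increasing) (use ell_F_deriv ell_delta_bounds(1)[OF m] in \<open>blast intro: divide_pos_pos zero_less_one\<close>)+

text \<open>The integrand is at least 1. The resulting unbounded growth, with oddness, yields
  surjectivity of \<open>ell_F\<close>.\<close>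

lemma ell_F_ge: "0 \<le> x \<Longrightarrow> x \<le> ell_F x m"
proof -
  assume x: "0 \<le> x"
  have "ell_F 0 m - 0 \<le> ell_F x m - x"
  proof (rule DERIV_nonneg_imp_nondecreasing[OF x])
    fix t
    have "((\<lambda>x. ell_F x m - x) has_real_derivative 1 / ell_delta m t - 1) (at t)"
      by (intro DERIV_diff ell_F_deriv DERIV_ident)
    moreover have "0 \<le> 1 / ell_delta m t - 1"
      using ell_delta_bounds[OF m, of t] by (simp add: field_simps)
    ultimately show "\<exists>y. ((\<lambda>x. ell_F x m - x) has_real_derivative y) (at t) \<and> 0 \<le> y" by blast
  qed
  then show "x \<le> ell_F x m" by (simp add: ell_F_0)
qed

text \<open>The integrand is at most \<open>1 / sqrt (1 - m)\<close>. Read backwards, this bounds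
  the amplitude from below by a multiple of its argument, which controls the pole of the elastica's
  slope.\<close>

lemma ell_F_le:
  assumes "0 \<le> x"
  shows "ell_F x m \<le> x / sqrt (1 - m)"
proof -
  have "0 / sqrt (1 - m) - ell_F 0 m \<le> x / sqrt (1 - m) - ell_F x m"
  proof (rule DERIV_nonneg_imp_nondecreasing[OF assms])
    fix t
    have "((\<lambda>x. x / sqrt (1 - m) - ell_F x m) has_real_derivative 1 / sqrt (1 - m) - 1 / ell_delta m t) (at t)"
      by (intro DERIV_diff ell_F_deriv DERIV_cdivide DERIV_ident)
    moreover have "sqrt (1 - m) \<le> ell_delta m t"
      unfolding ell_delta_def using m by (auto simp: abs_square_le_1 intro!: mult_left_le)
    then have "0 \<le> 1 / sqrt (1 - m) - 1 / ell_delta m t"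
      using m by (simp add: frac_le)
    ultimately show "\<exists>y. ((\<lambda>x. x / sqrt (1 - m) - ell_F x m) has_real_derivative y) (at t) \<and> 0 \<le> y" by blast
  qed
  then show ?thesis by (simp add: ell_F_0)
qed

text \<open>\<open>jacobi_am\<close> is defined by \<open>inv\<close>, which is a two-sided inverse
  only because of this.\<close>

lemma ell_F_bij: "bij (\<lambda>x. ell_F x m)"
proof (rule bijI)
  show "inj (\<lambda>x. ell_F x m)"
    using ell_F_strict_mono by (metis injI linorder_neqE_linordered_idom less_irrefl)
  have cont: "continuous_on S (\<lambda>x. ell_F x m)" for S
    by (intro continuous_at_imp_continuous_on ballI DERIV_isCont[OF ell_F_deriv])
  show "surj (\<lambda>x. ell_F x m)"
  proof (rule surjI[where f="\<lambda>y. SOME x. ell_F x m = y"])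
    fix y :: real
    have "ell_F (- \<bar>y\<bar>) m \<le> y" "y \<le> ell_F \<bar>y\<bar> m"
      using ell_F_ge[of "\<bar>y\<bar>"] by (auto simp: ell_F_odd)
    then have "\<exists>x\<ge>- \<bar>y\<bar>. x \<le> \<bar>y\<bar> \<and> ell_F x m = y"
      by (intro IVT' cont) auto
    then show "ell_F (SOME x. ell_F x m = y) m = y" by (metis (mono_tags, lifting) someI)
  qed
qed

lemma ell_F_jacobi_am [simp]: "ell_F (jacobi_am y m) m = y"
  unfolding jacobi_am_def by (rule surj_f_inv_f[OF bij_is_surj[OF ell_F_bij]])

lemma jacobi_am_ell_F [simp]: "jacobi_am (ell_F x m) m = x"
  unfolding jacobi_am_def by (rule inv_f_f[OF bij_is_inj[OF ell_F_bij]])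

lemma jacobi_am_strict_mono: "x < y \<Longrightarrow> jacobi_am x m < jacobi_am y m"
  by (metis ell_F_jacobi_am ell_F_strict_mono linorder_neqE_linordered_idom order_less_asym)

lemma jacobi_am_values [simp]:
  "jacobi_am 0 m = 0" "jacobi_am (ell_K m) m = pi / 2" "jacobi_am (- ell_K m) m = - (pi / 2)"
  using jacobi_am_ell_F[of 0] jacobi_am_ell_F[of "pi / 2"] jacobi_am_ell_F[of "- (pi / 2)"]
  unfolding ell_K_def ell_F_0 ell_F_odd by simp_all

lemma ell_K_pos: "0 < ell_K m"
  using ell_F_strict_mono[of 0 "pi / 2"] by (simp add: ell_K_def ell_F_0)

lemma isCont_jacobi_am: "isCont (\<lambda>y. jacobi_am y m) y"
proof -
  have "isCont (\<lambda>y. jacobi_am y m) (ell_F (jacobi_am y m) m)"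
    by (rule isCont_inverse_function[where d=1])
       (auto intro: DERIV_isCont[OF ell_F_deriv])
  then show ?thesis by simp
qed

lemma jacobi_am_deriv: "((\<lambda>y. jacobi_am y m) has_real_derivative ell_delta m (jacobi_am y m)) (at y)"
proof -
  have "((\<lambda>y. jacobi_am y m) has_real_derivative inverse (1 / ell_delta m (jacobi_am y m))) (at y)"
    by (rule DERIV_inverse_function[where a="y - 1" and b="y + 1", OF ell_F_deriv])
       (use ell_delta_bounds(1)[OF m] isCont_jacobi_am in \<open>auto simp: less_imp_neq[symmetric]\<close>)
  then show ?thesis by simp
qed


end

section \<open>Jacobi elliptic functions and the slope of the figure-eight elastica\<close>

definition jacobi_sn :: "real \<Rightarrow> real \<Rightarrow> real" where
  "jacobi_sn y m = sin (jacobi_am y m)"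

definition jacobi_dn :: "real \<Rightarrow> real \<Rightarrow> real" where
  "jacobi_dn y m = ell_delta m (jacobi_am y m)"

text \<open>Jacobi's epsilon function, the integral of dn^2 from 0 to \<open>y\<close>.\<close>

definition jacobi_E :: "real \<Rightarrow> real \<Rightarrow> real" where
  "jacobi_E y m = ell_E_inc (jacobi_am y m) m"

lemma jacobi_sn_cn_squared: "(jacobi_cn y m)\<^sup>2 = 1 - (jacobi_sn y m)\<^sup>2"
  unfolding jacobi_cn_def jacobi_sn_def by (simp add: cos_squared_eq)

context
  fixes m :: real
  assumes m: "0 < m" "m < 1"
begin

lemmas modulus_bounds = less_imp_le[OF m(1)] m(2)

lemma jacobi_dn_pos: "0 < jacobi_dn y m"
  unfolding jacobi_dn_def by (rule ell_delta_bounds(1)[OF modulus_bounds])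

lemma jacobi_dn_squared: "(jacobi_dn y m)\<^sup>2 = 1 - m * (jacobi_sn y m)\<^sup>2"
  unfolding jacobi_dn_def jacobi_sn_def by (rule ell_delta_bounds(3)[OF modulus_bounds])

lemma jacobi_sn_deriv: "((\<lambda>y. jacobi_sn y m) has_real_derivative jacobi_cn y m * jacobi_dn y m) (at y)"
  unfolding jacobi_sn_def jacobi_cn_def jacobi_dn_def
  by (rule DERIV_fun_sin[OF jacobi_am_deriv[OF modulus_bounds]])

lemma jacobi_cn_deriv: "((\<lambda>y. jacobi_cn y m) has_real_derivative - jacobi_sn y m * jacobi_dn y m) (at y)"
  unfolding jacobi_sn_def jacobi_cn_def jacobi_dn_def
  by (rule DERIV_fun_cos[OF jacobi_am_deriv[OF modulus_bounds]])

lemma jacobi_dn_eq: "jacobi_dn y m = sqrt (1 - m * (jacobi_sn y m)\<^sup>2)"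
  unfolding jacobi_dn_def jacobi_sn_def ell_delta_def ..

lemma jacobi_dn_deriv: "((\<lambda>y. jacobi_dn y m) has_real_derivative - m * jacobi_sn y m * jacobi_cn y m) (at y)"
proof -
  have "1 - m * (jacobi_sn y m)\<^sup>2 > 0"
    using jacobi_dn_pos[of y] unfolding jacobi_dn_eq by simp
  then have "((\<lambda>y. sqrt (1 - m * (jacobi_sn y m)\<^sup>2)) has_real_derivative
      - m * jacobi_sn y m * (jacobi_cn y m * jacobi_dn y m) / sqrt (1 - m * (jacobi_sn y m)\<^sup>2)) (at y)"
    by (auto intro!: derivative_eq_intros jacobi_sn_deriv simp: field_simps)
  then show ?thesis
    unfolding jacobi_dn_eq[symmetric] using jacobi_dn_pos[of y] by (simp add: mult.assoc)
qed

lemma jacobi_E_deriv: "((\<lambda>y. jacobi_E y m) has_real_derivative (jacobi_dn y m)\<^sup>2) (at y)"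
  unfolding jacobi_E_def jacobi_dn_def power2_eq_square
  by (rule DERIV_chain2[OF ell_E_inc_deriv[OF modulus_bounds] jacobi_am_deriv[OF modulus_bounds]])

lemma jacobi_values:
  "jacobi_sn 0 m = 0" "jacobi_sn (ell_K m) m = 1" "jacobi_sn (- ell_K m) m = - 1"
  "jacobi_cn 0 m = 1" "jacobi_cn (ell_K m) m = 0" "jacobi_cn (- ell_K m) m = 0"
  "jacobi_E 0 m = 0" "jacobi_E (ell_K m) m = ell_E m" "jacobi_E (- ell_K m) m = - ell_E m"
  unfolding jacobi_sn_def jacobi_cn_def jacobi_E_def jacobi_am_values[OF modulus_bounds] ell_E_delta
    ell_E_inc_0[OF modulus_bounds] ell_E_inc_odd[OF modulus_bounds]
  by simp_all

lemma continuous_on_jacobi: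
  "continuous_on S (\<lambda>y. jacobi_sn y m)" "continuous_on S (\<lambda>y. jacobi_cn y m)"
  "continuous_on S (\<lambda>y. jacobi_dn y m)" "continuous_on S (\<lambda>y. jacobi_E y m)"
  using DERIV_isCont[OF jacobi_sn_deriv] DERIV_isCont[OF jacobi_cn_deriv]
    DERIV_isCont[OF jacobi_dn_deriv] DERIV_isCont[OF jacobi_E_deriv]
  by (simp_all add: continuous_at_imp_continuous_on)

lemma jacobi_am_range:
  assumes "0 < y" "y \<le> ell_K m"
  shows "0 < jacobi_am y m" "jacobi_am y m \<le> pi / 2"
  using jacobi_am_strict_mono[OF modulus_bounds, of 0 y] jacobi_am_strict_mono[OF modulus_bounds, of y "ell_K m"] assms
    jacobi_am_values[OF modulus_bounds]
  by (auto simp: le_less)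

lemma jacobi_sn_pos:
  assumes "0 < y" "y \<le> ell_K m"
  shows "0 < jacobi_sn y m"
  unfolding jacobi_sn_def using jacobi_am_range[OF assms] by (intro sin_gt_zero) (use pi_gt_zero in linarith)+

lemma jacobi_cn_nonneg:
  assumes "0 < y" "y \<le> ell_K m"
  shows "0 \<le> jacobi_cn y m"
  unfolding jacobi_cn_def using jacobi_am_range[OF assms] by (intro cos_ge_zero) linarith+

text \<open>For the tangent angle \<open>\<phi>\<close> of the figure-eight elastica, \<open>cos \<phi> = 1 - 2 m sn\<^sup>2\<close>, and this
  slope is \<open>- \<phi>' / sin \<phi>\<close>.\<close>

definition elastica_slope :: "real \<Rightarrow> real" where
  "elastica_slope y = - jacobi_cn y m / (jacobi_sn y m * jacobi_dn y m)"

text \<open>The antiderivative, vanishing at 0, of q^2 (1 - w)^2 / (4 m) with q the slope and w = 1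
  - 2 m sn^2; up to factors this is the constant term of the tangent line at u = 1. The quotient
  alone has an additional cn^2 - sn^2 in its derivative, which the remaining terms, of derivative 2
  sn^2 - 1, cancel.\<close>

definition elastica_defect :: "real \<Rightarrow> real" where
  "elastica_defect y = jacobi_sn y m * jacobi_cn y m / jacobi_dn y m + (2 * y - 2 * jacobi_E y m) / m - y"

text \<open>The Euler-Lagrange equation q' = q^2 u + 1 of the Lagrangian u'^2 / (1 - u^2) at u = 1 -
  2 m sn^2. The summand 1 is half the multiplier of the constraint that u has integral zero.\<close>

lemma elastica_slope_deriv:
  assumes "jacobi_sn y m \<noteq> 0"
  shows "(elastica_slope has_real_derivative
    (elastica_slope y)\<^sup>2 * (1 - 2 * m * (jacobi_sn y m)\<^sup>2) + 1) (at y)"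
proof -
  let ?s = "jacobi_sn y m" and ?c = "jacobi_cn y m" and ?d = "jacobi_dn y m"
  have d: "?d \<noteq> 0" using jacobi_dn_pos[of y] by simp
  have "(elastica_slope has_real_derivative
     ((- (- ?s * ?d)) * (?s * ?d) - (- ?c) * ((?c * ?d) * ?d + (- m * ?s * ?c) * ?s)) / ((?s * ?d) * (?s * ?d))) (at y)"
    unfolding elastica_slope_def[abs_def]
    by (intro DERIV_divide DERIV_minus DERIV_mult jacobi_sn_deriv jacobi_cn_deriv jacobi_dn_deriv)
       (use assms d in simp)
  also have "((- (- ?s * ?d)) * (?s * ?d) - (- ?c) * ((?c * ?d) * ?d + (- m * ?s * ?c) * ?s)) / ((?s * ?d) * (?s * ?d))
      = (?s\<^sup>2 * ?d\<^sup>2 + ?c\<^sup>2 * ?d\<^sup>2 - m * ?s\<^sup>2 * ?c\<^sup>2) / (?s\<^sup>2 * ?d\<^sup>2)"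
    by (simp add: power2_eq_square algebra_simps)
  also have "?s\<^sup>2 * ?d\<^sup>2 + ?c\<^sup>2 * ?d\<^sup>2 - m * ?s\<^sup>2 * ?c\<^sup>2 = ?c\<^sup>2 * (1 - 2 * m * ?s\<^sup>2) + ?s\<^sup>2 * ?d\<^sup>2"
    unfolding jacobi_dn_squared by algebra
  also have "\<dots> / (?s\<^sup>2 * ?d\<^sup>2) = (elastica_slope y)\<^sup>2 * (1 - 2 * m * ?s\<^sup>2) + 1"
    using assms d unfolding elastica_slope_def by (simp add: power_divide power_mult_distrib add_divide_distrib)
  finally show ?thesis .
qed

lemma elastica_defect_deriv:
  "(elastica_defect has_real_derivative
    m * (jacobi_sn y m)\<^sup>2 * (jacobi_cn y m)\<^sup>2 / (jacobi_dn y m)\<^sup>2) (at y)"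
proof -
  let ?s = "jacobi_sn y m" and ?c = "jacobi_cn y m" and ?d = "jacobi_dn y m"
  have d: "?d \<noteq> 0" using jacobi_dn_pos[of y] by simp
  have "(elastica_defect has_real_derivative
     (((?c * ?d) * ?c + (- ?s * ?d) * ?s) * ?d - (?s * ?c) * (- m * ?s * ?c)) / (?d * ?d)
       + (2 * 1 - 2 * ?d\<^sup>2) / m - 1) (at y)"
    unfolding elastica_defect_def[abs_def]
    by (intro DERIV_divide DERIV_cdivide DERIV_add DERIV_diff DERIV_cmult DERIV_ident DERIV_mult
        jacobi_sn_deriv jacobi_cn_deriv jacobi_dn_deriv jacobi_E_deriv d)
  also have "(2 * 1 - 2 * ?d\<^sup>2) / m = 2 * ?s\<^sup>2"
    unfolding jacobi_dn_squared using m by (simp add: field_simps)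
  also have "(((?c * ?d) * ?c + (- ?s * ?d) * ?s) * ?d - (?s * ?c) * (- m * ?s * ?c)) / (?d * ?d)
     = (?c\<^sup>2 - ?s\<^sup>2) + m * ?s\<^sup>2 * ?c\<^sup>2 / ?d\<^sup>2"
    using d by (simp add: field_simps power2_eq_square)
  also have "(?c\<^sup>2 - ?s\<^sup>2) + m * ?s\<^sup>2 * ?c\<^sup>2 / ?d\<^sup>2 + 2 * ?s\<^sup>2 - 1 = m * ?s\<^sup>2 * ?c\<^sup>2 / ?d\<^sup>2"
    unfolding jacobi_sn_cn_squared by (simp add: algebra_simps)
  finally show ?thesis .
qed

text \<open>The zero of the slope at \<open>ell_K m\<close> is the natural boundary condition at the
  end of the loop.\<close>

lemma elastica_values:
  "elastica_slope (ell_K m) = 0" "elastica_defect 0 = 0"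
  "elastica_defect (ell_K m) = (2 * ell_K m - 2 * ell_E m) / m - ell_K m"
  unfolding elastica_slope_def elastica_defect_def jacobi_values by simp_all

text \<open>The pole at 0 is simple, with an explicit constant: with A the amplitude, cot A \<le>
  1/A, A is at least \<open>sqrt (1 - m) * y\<close>, and dn is at least
  \<open>sqrt (1 - m)\<close>.\<close>

lemma elastica_slope_bound:
  assumes y: "0 < y" "y \<le> ell_K m"
  shows "elastica_slope y \<le> 0" "- elastica_slope y \<le> 1 / ((1 - m) * y)"
proof -
  let ?A = "jacobi_am y m"
  note A = jacobi_am_range[OF y]
  note sc = jacobi_sn_pos[OF y] jacobi_cn_nonneg[OF y]
  show "elastica_slope y \<le> 0"
    unfolding elastica_slope_def using sc jacobi_dn_pos[of y] by simp
  have "cos ?A * ?A \<le> sin ?A"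
  proof -
    have "cos 0 * 0 - sin 0 \<ge> cos ?A * ?A - sin ?A"
    proof (rule DERIV_nonpos_imp_nonincreasing[where f="\<lambda>t. cos t * t - sin t"])
      fix t assume t: "0 \<le> t" "t \<le> ?A"
      have "((\<lambda>t. cos t * t - sin t) has_real_derivative - t * sin t) (at t)"
        by (auto intro!: derivative_eq_intros)
      moreover have "- t * sin t \<le> 0"
        using t A by (simp add: sin_ge_zero)
      ultimately show "\<exists>y. ((\<lambda>t. cos t * t - sin t) has_real_derivative y) (at t) \<and> y \<le> 0" by blast
    qed (use A in simp)
    then show ?thesis by simp
  qed
  then have 1: "jacobi_cn y m / jacobi_sn y m \<le> 1 / ?A"
    using A sc unfolding jacobi_cn_def jacobi_sn_def by (simp add: field_simps)
  have q: "sqrt (1 - m) > 0" using m by simp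
  have "y \<le> ?A / sqrt (1 - m)"
    using ell_F_le[OF modulus_bounds, of ?A] A ell_F_jacobi_am[OF modulus_bounds, of y] by simp
  then have 2: "1 / ?A \<le> 1 / (sqrt (1 - m) * y)"
    using y A q by (intro frac_le) (auto simp: field_simps)
  have "sqrt (1 - m) \<le> jacobi_dn y m"
    unfolding jacobi_dn_eq jacobi_sn_def using m by (auto simp: abs_square_le_1 intro!: mult_left_le)
  then have 3: "1 / jacobi_dn y m \<le> 1 / sqrt (1 - m)"
    using q by (intro frac_le) auto
  have "- elastica_slope y = (jacobi_cn y m / jacobi_sn y m) * (1 / jacobi_dn y m)"
    unfolding elastica_slope_def by simp
  also have "\<dots> \<le> (1 / (sqrt (1 - m) * y)) * (1 / sqrt (1 - m))"
    using 1 2 3 q y jacobi_dn_pos[of y] by (intro mult_mono) auto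
  also have "\<dots> = 1 / ((1 - m) * y)" using m by simp
  finally show "- elastica_slope y \<le> 1 / ((1 - m) * y)" .
qed

end

section \<open>Existence and uniqueness of the parameter \<open>m_star\<close>\<close>

lemma ell_K_minus_2E:
  assumes "0 \<le> m" "m < 1"
  shows "ell_K m - 2 * ell_E m = integral {0..pi/2} (\<lambda>\<theta>. 1 / ell_delta m \<theta> - 2 * ell_delta m \<theta>)"
proof -
  have "(\<lambda>\<theta>. 1 / ell_delta m \<theta>) integrable_on {0..pi/2}" "(\<lambda>\<theta>. 2 * ell_delta m \<theta>) integrable_on {0..pi/2}"
    using continuous_on_inverse_ell_delta[OF assms] continuous_on_ell_delta
    by (auto intro!: integrable_continuous_real continuous_on_mult_left)
  then show ?thesis
    unfolding ell_K_def ell_F_delta ell_E_delta ell_E_inc_def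
    using LBINT_0_pi_half[OF continuous_on_inverse_ell_delta[OF assms]]
      LBINT_0_pi_half[OF continuous_on_ell_delta, of m]
    by (simp add: Henstock_Kurzweil_Integration.integral_diff)
qed

text \<open>The integrand 1/d - 2 d decreases in d = \<open>ell_delta m \<theta>\<close>, and d
  decreases strictly in \<open>m\<close> wherever the sine is nonzero.\<close>

lemma ell_K_minus_2E_strict_mono:
  assumes "0 \<le> m1" "m1 < m2" "m2 < 1"
  shows "ell_K m1 - 2 * ell_E m1 < ell_K m2 - 2 * ell_E m2"
proof -
  have m: "0 \<le> m1" "m1 < 1" "0 \<le> m2" "m2 < 1" using assms by auto
  have c: "continuous_on {0..pi/2} (\<lambda>\<theta>. 1 / ell_delta k \<theta> - 2 * ell_delta k \<theta>)" if "0 \<le> k" "k < 1" for k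
    by (intro continuous_on_diff continuous_on_mult_left continuous_on_inverse_ell_delta that continuous_on_ell_delta)
  show ?thesis
    unfolding ell_K_minus_2E[OF m(1,2)] ell_K_minus_2E[OF m(3,4)]
  proof (rule integral_less_real[OF c[OF m(1,2)] c[OF m(3,4)]])
    show "{0<..<pi/2} \<noteq> {}" by (simp add: not_le)
    fix \<theta> :: real assume \<theta>: "\<theta> \<in> {0<..<pi/2}"
    then have "sin \<theta> > 0" by (intro sin_gt_zero2) auto
    then have "m1 * (sin \<theta>)\<^sup>2 < m2 * (sin \<theta>)\<^sup>2" using assms by simp
    then have "ell_delta m2 \<theta> < ell_delta m1 \<theta>" by (simp add: ell_delta_def)
    moreover have "0 < ell_delta m2 \<theta>" by (rule ell_delta_bounds(1)[OF m(3,4)])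
    ultimately have "1 / ell_delta m1 \<theta> < 1 / ell_delta m2 \<theta>"
      by (intro divide_strict_left_mono) auto
    then show "1 / ell_delta m1 \<theta> - 2 * ell_delta m1 \<theta> < 1 / ell_delta m2 \<theta> - 2 * ell_delta m2 \<theta>"
      using \<open>ell_delta m2 \<theta> < ell_delta m1 \<theta>\<close> by linarith
  qed
qed

text \<open>A quantitative form of the blow-up of K as m tends to 1. With m = 1 - \<epsilon>^2, the
  root is at most \<epsilon> + cos \<theta> \<le> \<epsilon> + pi/2 - \<theta>, whose reciprocal
  integrates to ln (\<epsilon> + pi/2) - ln \<epsilon>. The choice \<epsilon> = exp (-4) makes this
  at least 4, which exceeds pi and hence \<open>2 * ell_E m\<close>.\<close>

lemma ell_K_large: "ell_K (1 - (exp (-4))\<^sup>2) \<ge> 4"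
proof -
  define \<epsilon> :: real where "\<epsilon> = exp (-4)"
  define m where "m = 1 - \<epsilon>\<^sup>2"
  have \<epsilon>: "0 < \<epsilon>" "\<epsilon> < 1" by (simp_all add: \<epsilon>_def)
  have m: "0 \<le> m" "m < 1" using \<epsilon> by (simp_all add: m_def power_le_one)
  have lb: "1 / (\<epsilon> + pi/2 - \<theta>) \<le> 1 / ell_delta m \<theta>" if "\<theta> \<in> {0..pi/2}" for \<theta>
  proof -
    have "cos \<theta> = sin (pi/2 - \<theta>)" by (simp add: cos_sin_eq)
    also have "\<dots> \<le> pi/2 - \<theta>" using that by (intro sin_x_le_x) auto
    finally have c: "cos \<theta> \<le> pi/2 - \<theta>" .
    have c0: "0 \<le> cos \<theta>" using that by (intro cos_ge_zero) auto
    have "1 - m * (sin \<theta>)\<^sup>2 = \<epsilon>\<^sup>2 + (1 - \<epsilon>\<^sup>2) * (cos \<theta>)\<^sup>2"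
      unfolding m_def cos_squared_eq by algebra
    also have "\<dots> \<le> \<epsilon>\<^sup>2 + (cos \<theta>)\<^sup>2"
      by (simp add: algebra_simps)
    also have "\<dots> \<le> (\<epsilon> + cos \<theta>)\<^sup>2" using \<epsilon> c0 by (simp add: power2_sum)
    finally have "ell_delta m \<theta> \<le> \<epsilon> + cos \<theta>"
      unfolding ell_delta_def using \<epsilon> c0 by (intro real_le_lsqrt) auto
    then have "ell_delta m \<theta> \<le> \<epsilon> + pi/2 - \<theta>" using c by simp
    then show ?thesis using ell_delta_bounds(1)[OF m, of \<theta>] by (intro frac_le) auto
  qed
  have hi: "((\<lambda>\<theta>. 1 / (\<epsilon> + pi/2 - \<theta>)) has_integral (- ln (\<epsilon> + pi/2 - pi/2) - (- ln (\<epsilon> + pi/2 - 0)))) {0..pi/2}"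
  proof (rule fundamental_theorem_of_calculus)
    fix \<theta> assume "\<theta> \<in> {0..pi/2}"
    then have "\<epsilon> + pi/2 - \<theta> > 0" using \<epsilon> by auto
    then have "((\<lambda>\<theta>. - ln (\<epsilon> + pi/2 - \<theta>)) has_real_derivative 1 / (\<epsilon> + pi/2 - \<theta>)) (at \<theta> within {0..pi/2})"
      by (auto intro!: derivative_eq_intros simp: field_simps)
    then show "((\<lambda>\<theta>. - ln (\<epsilon> + pi/2 - \<theta>)) has_vector_derivative 1 / (\<epsilon> + pi/2 - \<theta>)) (at \<theta> within {0..pi/2})"
      by (simp add: has_real_derivative_iff_has_vector_derivative)
  qed simp
  have "1 \<le> \<epsilon> + pi/2" using \<epsilon> pi_gt3 by linarith
  then have "4 \<le> - ln \<epsilon> + ln (\<epsilon> + pi/2)"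
    using ln_ge_zero by (simp add: \<epsilon>_def)
  also have "\<dots> = integral {0..pi/2} (\<lambda>\<theta>. 1 / (\<epsilon> + pi/2 - \<theta>))"
    using integral_unique[OF hi] by simp
  also have "\<dots> \<le> integral {0..pi/2} (\<lambda>\<theta>. 1 / ell_delta m \<theta>)"
    by (rule integral_le[OF has_integral_integrable[OF hi]
          integrable_continuous_real[OF continuous_on_inverse_ell_delta[OF m]] lb])
  also have "\<dots> = ell_K m"
    unfolding ell_K_def ell_F_delta LBINT_0_pi_half[OF continuous_on_inverse_ell_delta[OF m]] ..
  finally show ?thesis unfolding m_def \<epsilon>_def .
qed

lemma ell_E_le: 
  assumes "0 \<le> m" "m < 1"
  shows "ell_E m \<le> pi / 2"
proof -
  have "ell_E m = integral {0..pi/2} (ell_delta m)"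
    unfolding ell_E_delta ell_E_inc_def LBINT_0_pi_half[OF continuous_on_ell_delta] ..
  also have "\<dots> \<le> integral {0..pi/2} (\<lambda>_. 1)"
    using ell_delta_bounds(2)[OF assms]
    by (intro integral_le integrable_continuous_real continuous_on_ell_delta) auto
  finally show ?thesis by simp
qed

text \<open>Intermediate value theorem for K - 2 E between m = 0, where it equals -pi/2, and the
  modulus \<open>M\<close> at which K \<ge> 4 > pi \<ge> 2 E. Stopping at \<open>M\<close> below 1
  keeps the integrand jointly continuous on a compact rectangle.\<close>

lemma m_star_exists: "\<exists>m. 0 < m \<and> m < 1 \<and> ell_K m = 2 * ell_E m"
proof -
  define M :: real where "M = 1 - (exp (-4))\<^sup>2"
  have M: "0 \<le> M" "M < 1" by (simp_all add: M_def power_le_one)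
  let ?g = "\<lambda>m. integral (cbox 0 (pi/2)) (\<lambda>\<theta>. 1 / ell_delta m \<theta> - 2 * ell_delta m \<theta>)"
  have g: "?g k = ell_K k - 2 * ell_E k" if "0 \<le> k" "k < 1" for k
    using ell_K_minus_2E[OF that] by simp
  have cont: "continuous_on {0..M} ?g"
  proof (rule integral_continuous_on_param)
    have "sqrt (1 - fst p * (sin (snd p))\<^sup>2) \<noteq> 0" if "p \<in> {0..M} \<times> cbox 0 (pi/2)" for p :: "real \<times> real"
      using ell_delta_radicand[of "fst p" "snd p"] that M by auto
    then show "continuous_on ({0..M} \<times> cbox 0 (pi/2)) (\<lambda>(m, \<theta>). 1 / ell_delta m \<theta> - 2 * ell_delta m \<theta>)"
      unfolding ell_delta_def case_prod_beta by (intro continuous_intros) auto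
  qed
  have g0: "?g 0 < 0"
    using pi_gt_zero by (simp add: ell_delta_def)
  have "?g M > 0"
    unfolding g[OF M] using ell_K_large ell_E_le[OF M] pi_less_4 unfolding M_def by linarith
  then obtain m where m: "0 \<le> m" "m \<le> M" "?g m = 0"
    using IVT'[of ?g 0 0 M] g0 cont M by (meson less_imp_le)
  have "m \<noteq> 0" using m(3) g0 by (metis less_irrefl)
  then show ?thesis using m g[of m] M by (intro exI[of _ m]) auto
qed

lemma m_star: "0 < m_star" "m_star < 1" "ell_K m_star = 2 * ell_E m_star"
proof -
  have "\<exists>!m. 0 < m \<and> m < 1 \<and> ell_K m = 2 * ell_E m"
  proof (rule ex_ex1I[OF m_star_exists])
    fix p q :: real assume "0 < p \<and> p < 1 \<and> ell_K p = 2 * ell_E p" "0 < q \<and> q < 1 \<and> ell_K q = 2 * ell_E q"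
    then show "p = q"
      using ell_K_minus_2E_strict_mono[of p q] ell_K_minus_2E_strict_mono[of q p]
      by (cases p q rule: linorder_cases) auto
  qed
  from theI'[OF this] show "0 < m_star" "m_star < 1" "ell_K m_star = 2 * ell_E m_star"
    unfolding m_star_def by auto
qed

section \<open>The energy of a loop\<close>

lemma has_ac_deriv_cmul:
  fixes f :: "real \<Rightarrow> real"
  assumes "has_ac_deriv a b f f'"
  shows "has_ac_deriv a b (\<lambda>x. k * f x) (\<lambda>x. k * f' x)"
  by (rule has_ac_deriv_linear[OF assms bounded_linear_mult_right])

lemma has_ac_deriv_diff_const:
  assumes "has_ac_deriv a b f g"
  shows "has_ac_deriv a b (\<lambda>x. f x - k) g"
  unfolding has_ac_deriv_def
proof (intro conjI ballI)
  show "g absolutely_integrable_on {a..b}"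
    using has_ac_deriv_integrable(1)[OF assms] by simp
  show "f x - k = f a - k + integral {a..x} g" if "x \<in> {a..b}" for x
    using has_ac_derivD[OF assms, of x] that by simp
qed

text \<open>Cauchy-Schwarz for |g| = sqrt v * (|g| / sqrt v). It measures how little the tangent can
  turn on a short arc of small energy.\<close>

lemma norm_increment_squared_le:
  fixes T :: "real \<Rightarrow> 'a::euclidean_space" and P v :: "real \<Rightarrow> real"
  assumes T: "has_ac_deriv a b T g" and ab: "a \<le> b"
    and v: "v integrable_on {a..b}" "\<And>x. x \<in> {a..b} \<Longrightarrow> v x > 0" "integral {a..b} v > 0"
    and P: "(\<lambda>x. (norm (g x))\<^sup>2 / v x) integrable_on {a..b}"
  shows "(norm (T b - T a))\<^sup>2 \<le> integral {a..b} v * integral {a..b} (\<lambda>x. (norm (g x))\<^sup>2 / v x)"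
proof -
  define I S \<beta> where "I = integral {a..b} (\<lambda>x. norm (g x))" and "S = integral {a..b} v"
    and "\<beta> = integral {a..b} (\<lambda>x. (norm (g x))\<^sup>2 / v x)"
  note gi = has_ac_deriv_integrable[OF T order_refl order_refl]
  have le: "norm (T b - T a) \<le> I"
    unfolding has_ac_deriv_diff[OF T order_refl ab order_refl] I_def
    by (rule integral_norm_bound_integral[OF gi(2,3)]) simp
  have \<beta>0: "\<beta> \<ge> 0"
    unfolding \<beta>_def by (rule integral_nonneg[OF P]) (use v(2) in \<open>simp add: less_imp_le\<close>)
  have "I\<^sup>2 \<le> S * \<beta>"
  proof (cases "I > 0")
    case True
    \<comment> \<open>In the case of equality |g| is a constant multiple of \<open>v\<close>, and
      then that constant is \<open>I / S\<close>. For it, the first term of the integrated Young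
      inequality becomes exactly \<open>I\<close>.\<close>
    define \<tau> where "\<tau> = I / S"
    have \<tau>: "\<tau> > 0" using True v(3) by (simp add: \<tau>_def S_def)
    have "integral {a..b} (\<lambda>x. 2 * norm (g x)) \<le> integral {a..b} (\<lambda>x. \<tau> * v x + (norm (g x))\<^sup>2 / v x / \<tau>)"
    proof (rule integral_le)
      show "(\<lambda>x. 2 * norm (g x)) integrable_on {a..b}"
        using gi(3) by (rule integrable_on_mult_right)
      show "(\<lambda>x. \<tau> * v x + (norm (g x))\<^sup>2 / v x / \<tau>) integrable_on {a..b}"
        by (intro integrable_add integrable_on_mult_right v(1) integrable_on_divide P)
      fix x assume x: "x \<in> {a..b}"
      have "0 \<le> (\<tau> * v x - norm (g x))\<^sup>2" by simp
      then have "2 * norm (g x) * (\<tau> * v x) \<le> (\<tau> * v x)\<^sup>2 + (norm (g x))\<^sup>2"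
        by (simp add: power2_diff mult_ac)
      moreover have pos: "0 < \<tau> * v x" using \<tau> v(2)[OF x] by simp
      ultimately have "2 * norm (g x) \<le> ((\<tau> * v x)\<^sup>2 + (norm (g x))\<^sup>2) / (\<tau> * v x)"
        by (simp add: pos_le_divide_eq mult_ac)
      also have "\<dots> = \<tau> * v x + (norm (g x))\<^sup>2 / v x / \<tau>"
        using pos \<tau> v(2)[OF x] by (simp add: add_divide_distrib power2_eq_square mult.commute)
      finally show "2 * norm (g x) \<le> \<tau> * v x + (norm (g x))\<^sup>2 / v x / \<tau>" .
    qed
    also have "\<dots> = \<tau> * S + \<beta> / \<tau>"
      unfolding S_def \<beta>_def
      by (rule integral_unique[OF has_integral_add[OF has_integral_mult_right[OF integrable_integral[OF v(1)]]
            has_integral_divide[OF integrable_integral[OF P]]]])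
    finally have "2 * I \<le> \<tau> * S + \<beta> / \<tau>" by (simp add: I_def)
    then have "2 * I \<le> I + \<beta> * S / I"
      using True v(3) by (simp add: \<tau>_def S_def)
    then show ?thesis
      using True by (simp add: field_simps power2_eq_square)
  next
    case False
    then have "I = 0" using le norm_ge_zero[of "T b - T a"] by linarith
    then show ?thesis using \<beta>0 v(3) by (simp add: S_def)
  qed
  moreover have "(norm (T b - T a))\<^sup>2 \<le> I\<^sup>2"
    using le by (rule power_mono) simp
  ultimately show ?thesis unfolding S_def \<beta>_def by linarith
qed

text \<open>The inequality is \<open>|g - \<Lambda> q v (e - (T \<bullet> e) T)|\<^sup>2 \<ge> 0\<close> combined with \<open>(T \<bullet> e - w)\<^sup>2 \<ge> 0\<close>; the
  latter expresses the convexity of the problem in \<open>T \<bullet> e\<close>.\<close>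

lemma elastica_pointwise_bound:
  fixes T g e :: "'a::real_inner" and q w v \<Lambda> :: real
  assumes "norm T = 1" "norm e = 1" "T \<bullet> g = 0" "v > 0"
  shows "(norm g)\<^sup>2 / v \<ge> 2 * \<Lambda> * q * (g \<bullet> e) + \<Lambda>\<^sup>2 * v * (2 * q\<^sup>2 * w * (T \<bullet> e - 1) - q\<^sup>2 * (1 - w)\<^sup>2)"
proof -
  define u where "u = T \<bullet> e"
  define k where "k = \<Lambda> * q * v"
  have TT: "T \<bullet> T = 1" "e \<bullet> e = 1" "g \<bullet> T = 0" "T \<bullet> g = 0" "T \<bullet> e = u" "e \<bullet> T = u" "e \<bullet> g = g \<bullet> e"
    using assms by (simp_all add: dot_square_norm inner_commute u_def)
  have "0 \<le> (norm (g - k *\<^sub>R (e - u *\<^sub>R T)))\<^sup>2" by simp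
  also have "\<dots> = (norm g)\<^sup>2 - 2 * k * (g \<bullet> e) + k\<^sup>2 * (1 - u\<^sup>2)"
    unfolding power2_norm_eq_inner
    by (simp only: inner_diff_left inner_diff_right inner_scaleR_left inner_scaleR_right TT) algebra
  finally have "2 * k * (g \<bullet> e) - k\<^sup>2 * (1 - u\<^sup>2) \<le> (norm g)\<^sup>2" by simp
  then have "(2 * k * (g \<bullet> e) - k\<^sup>2 * (1 - u\<^sup>2)) / v \<le> (norm g)\<^sup>2 / v"
    using assms(4) by (intro divide_right_mono) auto
  moreover have "(2 * k * (g \<bullet> e) - k\<^sup>2 * (1 - u\<^sup>2)) / v = 2 * \<Lambda> * q * (g \<bullet> e) - \<Lambda>\<^sup>2 * v * (q\<^sup>2 * (1 - u\<^sup>2))"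
    using assms(4) by (simp add: k_def field_simps power2_eq_square)
  moreover have "0 \<le> \<Lambda>\<^sup>2 * v * (q\<^sup>2 * (u - w)\<^sup>2)"
    using assms(4) by (intro mult_nonneg_nonneg) auto
  then have "\<Lambda>\<^sup>2 * v * (2 * q\<^sup>2 * w * (u - 1) - q\<^sup>2 * (1 - w)\<^sup>2) \<le> - (\<Lambda>\<^sup>2 * v * (q\<^sup>2 * (1 - u\<^sup>2)))"
    by (simp add: power2_eq_square algebra_simps)
  ultimately show ?thesis unfolding TT(5) by linarith
qed

text \<open>One half of a loop, from its midpoint \<open>c\<close> to its end, compared with the
  elastica of matching length. The pointwise bound is a total derivative up to known terms. It is
  integrated from a point \<open>x0\<close> beyond the pole of the slope at \<open>c\<close>, and
  then \<open>x0\<close> tends to \<open>c\<close>.\<close>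

lemma elastica_half_bound:
  fixes T :: "real \<Rightarrow> 'a::euclidean_space" and v :: "real \<Rightarrow> real"
  assumes m: "0 < m" "m < 1" and cb: "c < b"
    and v: "continuous_on {c..b} v" "\<And>x. x \<in> {c..b} \<Longrightarrow> v x > 0"
    and T: "has_ac_deriv c b T g" "\<And>x. x \<in> {c..b} \<Longrightarrow> norm (T x) = 1"
      "\<And>x. x \<in> {c..b} \<Longrightarrow> T x \<bullet> g x = 0"
    and P: "(\<lambda>x. (norm (g x))\<^sup>2 / v x) integrable_on {c..b}"
    and \<Lambda>: "\<Lambda> > 0" "\<Lambda> * integral {c..b} v = ell_K m"
  shows "integral {c..b} (\<lambda>x. (norm (g x))\<^sup>2 / v x) \<ge>
    2 * \<Lambda>\<^sup>2 * integral {c..b} (\<lambda>x. v x * (1 - T x \<bullet> T c)) - 4 * \<Lambda> * (2 * (ell_K m - ell_E m) - m * ell_K m)"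
proof -
  let ?P = "\<lambda>x. (norm (g x))\<^sup>2 / v x"
  let ?R = "\<lambda>x. v x * (1 - T x \<bullet> T c)"
  let ?q = "elastica_slope m" and ?G = "elastica_defect m"
  \<comment> \<open>Arclength from \<open>c\<close> in the scale of the elastica, so that the half
    loop corresponds to [0, K].\<close>
  define y where "y x = \<Lambda> * integral {c..x} v" for x
  have vi: "v integrable_on {s..t}" if "c \<le> s" "t \<le> b" for s t
    using v(1) that by (intro integrable_continuous_real continuous_on_subset[OF v(1)]) auto
  have yd: "(y has_real_derivative \<Lambda> * v x) (at x within {c..b})" if "x \<in> {c..b}" for x
    unfolding y_def[abs_def] has_real_derivative_iff_has_vector_derivative
    by (rule has_vector_derivative_mult_right[OF integral_has_vector_derivative[OF v(1) that]])
  have cy: "continuous_on {c..b} y"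
    using yd by (rule DERIV_continuous_on)
  have yc: "y c = 0" and yb: "y b = ell_K m" by (simp_all add: y_def \<Lambda>)
  have ymono: "y s < y t" if "c \<le> s" "s < t" "t \<le> b" for s t
  proof -
    have "integral {s..t} (\<lambda>_. 0) < integral {s..t} v"
      using that v(2) by (intro integral_less_real continuous_on_subset[OF v(1)]) auto
    moreover have "integral {c..s} v + integral {s..t} v = integral {c..t} v"
      using that by (intro Henstock_Kurzweil_Integration.integral_combine vi) auto
    ultimately have "integral {c..s} v < integral {c..t} v" by simp
    then show ?thesis unfolding y_def using \<Lambda>(1) by simp
  qed
  have yrange: "0 < y x" "y x \<le> ell_K m" if "c < x" "x \<le> b" for x
    using ymono[of c x] ymono[of x b] that yc yb cb by (auto simp: le_less)
  have Pi: "?P integrable_on {s..t}" if "c \<le> s" "t \<le> b" for s t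
    using P that by (auto intro: integrable_on_subinterval)
  have cT: "continuous_on {c..b} T" by (rule has_ac_deriv_continuous_on[OF T(1)])
  have cR: "continuous_on {c..b} ?R"
    by (intro continuous_intros v(1) cT)
  have Ri: "?R integrable_on {s..t}" if "c \<le> s" "t \<le> b" for s t
    using that by (intro integrable_continuous_real continuous_on_subset[OF cR]) auto
  have Te: "norm (T c) = 1" using T(2) cb by simp
  have main: "integral {x0..b} ?P \<ge> 2 * \<Lambda> * ?q (y x0) * (1 - T x0 \<bullet> T c) + 2 * \<Lambda>\<^sup>2 * integral {x0..b} ?R
      - 4 * m * \<Lambda> * (?G (ell_K m) - ?G (y x0))" if x0: "c < x0" "x0 < b" for x0
  proof -
    let ?I = "{x0..b}"
    have sub: "?I \<subseteq> {c..b}" using x0 by auto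
    have yd': "(y has_real_derivative \<Lambda> * v x) (at x within ?I)" if "x \<in> ?I" for x
      using yd[of x] that sub by (auto intro: DERIV_subset)
    have yc': "continuous_on ?I y" using cy sub by (rule continuous_on_subset)
    have vc': "continuous_on ?I v" using v(1) sub by (rule continuous_on_subset)
    have r: "0 < y x" "y x \<le> ell_K m" if "x \<in> ?I" for x using yrange[of x] that x0 by auto
    have sn: "jacobi_sn (y x) m > 0" if "x \<in> ?I" for x by (rule jacobi_sn_pos[OF m r[OF that]])
    define q' where "q' x = (?q (y x))\<^sup>2 * (1 - 2 * m * (jacobi_sn (y x) m)\<^sup>2) + 1" for x
    define G' where "G' x = m * (jacobi_sn (y x) m)\<^sup>2 * (jacobi_cn (y x) m)\<^sup>2 / (jacobi_dn (y x) m)\<^sup>2" for x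
    have Qd: "((\<lambda>x. ?q (y x)) has_real_derivative q' x * (\<Lambda> * v x)) (at x within ?I)" if "x \<in> ?I" for x
      unfolding q'_def
      by (rule DERIV_chain2[OF elastica_slope_deriv[OF m] yd'[OF that]]) (use sn[OF that] in simp)
    have Gd: "((\<lambda>x. ?G (y x)) has_real_derivative G' x * (\<Lambda> * v x)) (at x within ?I)" if "x \<in> ?I" for x
      unfolding G'_def by (rule DERIV_chain2[OF elastica_defect_deriv[OF m] yd'[OF that]])
    have dn: "jacobi_dn z m \<noteq> 0" for z using jacobi_dn_pos[OF m, of z] by simp
    note cj = continuous_on_compose2[OF continuous_on_jacobi(1)[OF m, of UNIV] yc' subset_UNIV]
      continuous_on_compose2[OF continuous_on_jacobi(2)[OF m, of UNIV] yc' subset_UNIV]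
      continuous_on_compose2[OF continuous_on_jacobi(3)[OF m, of UNIV] yc' subset_UNIV]
    have cQ: "continuous_on ?I (\<lambda>x. ?q (y x))" by (rule DERIV_continuous_on[OF Qd])
    have cQ': "continuous_on ?I (\<lambda>x. q' x * (\<Lambda> * v x))"
      unfolding q'_def by (intro continuous_intros cQ vc' cj)
    have cG': "continuous_on ?I (\<lambda>x. G' x * (\<Lambda> * v x))"
      unfolding G'_def by (intro continuous_intros vc' cj) (use dn in simp)
    have Q: "has_ac_deriv x0 b (\<lambda>x. ?q (y x)) (\<lambda>x. q' x * (\<Lambda> * v x))"
      using Qd by (intro has_ac_deriv_C1 cQ') (simp add: has_real_derivative_iff_has_vector_derivative)
    \<comment> \<open>Subtracting 1 makes this factor vanish at \<open>c\<close>, where the slope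
      that multiplies it has its pole.\<close>
    have u: "has_ac_deriv x0 b (\<lambda>x. T x \<bullet> T c - 1) (\<lambda>x. g x \<bullet> T c)"
    proof -
      have "has_ac_deriv x0 b (\<lambda>x. T x \<bullet> T c) (\<lambda>x. g x \<bullet> T c)"
        by (rule has_ac_deriv_linear[OF has_ac_deriv_subinterval[OF T(1)] bounded_linear_inner_left])
           (use x0 in auto)
      then show ?thesis by (rule has_ac_deriv_diff_const)
    qed
    let ?f = "\<lambda>x. ?q (y x) * (T x \<bullet> T c - 1)"
    let ?f' = "\<lambda>x. ?q (y x) * (g x \<bullet> T c) + q' x * (\<Lambda> * v x) * (T x \<bullet> T c - 1)"
    have f: "has_ac_deriv x0 b ?f ?f'" by (rule has_ac_deriv_mult[OF Q u])
    have f'i: "?f' integrable_on ?I" by (rule has_ac_deriv_integrable(2)[OF f order_refl order_refl])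
    have fi: "integral ?I ?f' = ?q (y x0) * (1 - T x0 \<bullet> T c)"
      using has_ac_deriv_diff[OF f order_refl less_imp_le[OF x0(2)] order_refl]
      by (simp add: yb elastica_values[OF m] algebra_simps)
    have G: "((\<lambda>x. G' x * (\<Lambda> * v x)) has_integral (?G (y b) - ?G (y x0))) ?I"
      using Gd x0 by (intro fundamental_theorem_of_calculus)
        (auto simp: has_real_derivative_iff_has_vector_derivative)
    have Ri': "?R integrable_on ?I" using x0 by (intro Ri) auto
    \<comment> \<open>The summand 1 of the Euler-Lagrange equation leaves 2 \<Lambda>^2 v (u - 1)
      inside the total derivative; adding the term with \<open>?R\<close> removes it, so that
      \<open>?lower\<close> is exactly the pointwise bound.\<close>
    let ?lower = "\<lambda>x. 2 * \<Lambda> * ?f' x + 2 * \<Lambda>\<^sup>2 * ?R x - 4 * m * \<Lambda> * (G' x * (\<Lambda> * v x))"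
    have "(?lower has_integral (2 * \<Lambda> * (?q (y x0) * (1 - T x0 \<bullet> T c)) + 2 * \<Lambda>\<^sup>2 * integral ?I ?R
        - 4 * m * \<Lambda> * (?G (y b) - ?G (y x0)))) ?I"
      using integrable_integral[OF f'i] integrable_integral[OF Ri'] G unfolding fi
      by (intro has_integral_diff has_integral_add has_integral_mult_right)
    moreover have "(?P has_integral integral ?I ?P) ?I"
      using x0 by (intro integrable_integral Pi) auto
    moreover have "?lower x \<le> ?P x" if x: "x \<in> ?I" for x
    proof -
      let ?s = "jacobi_sn (y x) m" and ?c = "jacobi_cn (y x) m" and ?d = "jacobi_dn (y x) m"
      define w where "w = 1 - 2 * m * ?s\<^sup>2"
      have xc: "x \<in> {c..b}" using x sub by auto
      have "?P x \<ge> 2 * \<Lambda> * ?q (y x) * (g x \<bullet> T c)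
          + \<Lambda>\<^sup>2 * v x * (2 * (?q (y x))\<^sup>2 * w * (T x \<bullet> T c - 1) - (?q (y x))\<^sup>2 * (1 - w)\<^sup>2)"
        by (rule elastica_pointwise_bound[OF T(2)[OF xc] Te T(3)[OF xc] v(2)[OF xc]])
      moreover have B: "(?q (y x))\<^sup>2 * (1 - w)\<^sup>2 = 4 * m * G' x"
        using sn[OF x] dn[of "y x"] unfolding w_def G'_def elastica_slope_def[OF m]
        by (simp add: field_simps power2_eq_square)
      moreover have C: "q' x = (?q (y x))\<^sup>2 * w + 1" by (simp add: q'_def w_def)
      have "?lower x = 2 * \<Lambda> * ?q (y x) * (g x \<bullet> T c)
          + \<Lambda>\<^sup>2 * v x * (2 * (?q (y x))\<^sup>2 * w * (T x \<bullet> T c - 1) - (?q (y x))\<^sup>2 * (1 - w)\<^sup>2)"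
        unfolding B C by (simp add: algebra_simps power2_eq_square)
      ultimately show ?thesis by simp
    qed
    ultimately have "2 * \<Lambda> * (?q (y x0) * (1 - T x0 \<bullet> T c)) + 2 * \<Lambda>\<^sup>2 * integral ?I ?R
        - 4 * m * \<Lambda> * (?G (y b) - ?G (y x0)) \<le> integral ?I ?P"
      by (rule has_integral_le)
    then show ?thesis by (simp add: yb mult.assoc)
  qed
  \<comment> \<open>The slope grows like 1/y while 1 - u is at most y / (2 \<Lambda>) times the
    energy on [c, x0]. The factors y cancel and leave a multiple of an energy that tends to 0 with
    the arc.\<close>
  have boundary: "- (2 * \<Lambda> * ?q (y x0) * (1 - T x0 \<bullet> T c)) \<le> integral {c..x0} ?P / (1 - m)"
    if x0: "c < x0" "x0 < b" for x0
  proof -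
    have r: "0 < y x0" "y x0 \<le> ell_K m" using yrange[of x0] x0 by auto
    have S: "integral {c..x0} v = y x0 / \<Lambda>" using \<Lambda>(1) by (simp add: y_def)
    have "(norm (T x0 - T c))\<^sup>2 \<le> integral {c..x0} v * integral {c..x0} ?P"
    proof (rule norm_increment_squared_le)
      show "has_ac_deriv c x0 T g" using x0 by (intro has_ac_deriv_subinterval[OF T(1)]) auto
      show "integral {c..x0} v > 0" unfolding S using r \<Lambda>(1) by simp
    qed (use x0 v(2) in \<open>auto intro!: vi Pi\<close>)
    moreover have "T x0 \<bullet> T x0 = 1" "T c \<bullet> T c = 1"
      using T(2)[of x0] Te x0 by (simp_all add: dot_square_norm)
    then have "(norm (T x0 - T c))\<^sup>2 = 2 * (1 - T x0 \<bullet> T c)"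
      unfolding power2_norm_eq_inner inner_diff_left inner_diff_right inner_commute[of "T c" "T x0"] by simp
    ultimately have 1: "2 * (1 - T x0 \<bullet> T c) \<le> y x0 / \<Lambda> * integral {c..x0} ?P" unfolding S by simp
    have "0 \<le> integral {c..x0} ?P"
      using x0 v(2) by (intro integral_nonneg Pi) (auto intro!: divide_nonneg_pos)
    then have nn: "0 \<le> y x0 / \<Lambda> * integral {c..x0} ?P" using r \<Lambda>(1) by simp
    note qb = elastica_slope_bound[OF m r]
    have nq: "0 \<le> \<Lambda> * (- ?q (y x0))"
      using qb(1) \<Lambda>(1) by (intro mult_nonneg_nonneg) auto
    have "- (2 * \<Lambda> * ?q (y x0) * (1 - T x0 \<bullet> T c)) = \<Lambda> * (- ?q (y x0)) * (2 * (1 - T x0 \<bullet> T c))" by simp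
    also have "\<dots> \<le> \<Lambda> * (- ?q (y x0)) * (y x0 / \<Lambda> * integral {c..x0} ?P)"
      by (rule mult_left_mono[OF 1 nq])
    also have "\<dots> \<le> \<Lambda> * (1 / ((1 - m) * y x0)) * (y x0 / \<Lambda> * integral {c..x0} ?P)"
      by (rule mult_right_mono[OF mult_left_mono[OF qb(2) less_imp_le[OF \<Lambda>(1)]] nn])
    also have "\<dots> = integral {c..x0} ?P / (1 - m)"
      using r \<Lambda>(1) by simp
    finally show ?thesis .
  qed
  \<comment> \<open>The deficit of the inequality with the boundary term replaced by its bound.
    Unlike the boundary term itself, it is continuous up to \<open>c\<close>, where its value is the
    claim.\<close>
  define \<Psi> where "\<Psi> x = integral {x..b} ?P - 2 * \<Lambda>\<^sup>2 * integral {x..b} ?R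
      + 4 * m * \<Lambda> * (?G (ell_K m) - ?G (y x)) + integral {c..x} ?P / (1 - m)" for x
  have "\<Psi> c \<ge> 0"
  proof (rule continuous_ge_on_closure[where S="{c<..<b}" and f=\<Psi>])
    have cG: "continuous_on UNIV ?G"
      by (rule DERIV_continuous_on) (use elastica_defect_deriv[OF m] in blast)
    have "continuous_on {c..b} \<Psi>"
      unfolding \<Psi>_def
      by (intro continuous_intros indefinite_integral_continuous_1 indefinite_integral_continuous_1'
          P Ri continuous_on_compose2[OF cG cy]) (use m in auto)
    then show "continuous_on (closure {c<..<b}) \<Psi>" using cb by simp
    show "c \<in> closure {c<..<b}" using cb by simp
    fix x assume "x \<in> {c<..<b}"
    then show "\<Psi> x \<ge> 0" unfolding \<Psi>_def using main[of x] boundary[of x] by simp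
  qed
  then have "integral {c..b} ?P \<ge> 2 * \<Lambda>\<^sup>2 * integral {c..b} ?R - 4 * m * \<Lambda> * ?G (ell_K m)"
    by (simp add: \<Psi>_def yc elastica_values[OF m])
  moreover have "4 * m * \<Lambda> * ?G (ell_K m) = 4 * \<Lambda> * (2 * (ell_K m - ell_E m) - m * ell_K m)"
    unfolding elastica_values(3)[OF m] using m by (simp add: field_simps)
  ultimately show ?thesis by simp
qed

text \<open>Turns the arc to the left of the midpoint into one starting at the midpoint.\<close>

lemma has_ac_deriv_reflect:
  assumes T: "has_ac_deriv a b T g"
  shows "has_ac_deriv (- b) (- a) (\<lambda>x. T (- x)) (\<lambda>x. - g (- x))"
  unfolding has_ac_deriv_def
proof (intro conjI ballI)
  have "(\<lambda>x. g (- x)) absolutely_integrable_on {- b..- a}"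
    using has_ac_deriv_integrable(1)[OF T order_refl order_refl] by simp
  then show "(\<lambda>x. - g (- x)) absolutely_integrable_on {- b..- a}"
    using absolutely_integrable_on_scaleR_iff[where c="-1" and f="\<lambda>x. g (- x)" and S="{- b..- a}"] by simp
  fix x assume x: "x \<in> {- b..- a}"
  have "integral {- b..x} (\<lambda>x. - g (- x)) = - integral {- b..- (- x)} (\<lambda>x. g (- x))"
    by (simp add: integral_neg)
  also have "\<dots> = - integral {- x..b} g" by (simp only: Henstock_Kurzweil_Integration.integral_reflect_real)
  also have "\<dots> = T (- x) - T b"
    using has_ac_deriv_diff[OF T, of "- x" b, symmetric] x by simp
  finally show "T (- x) = T (- (- b)) + integral {- b..x} (\<lambda>x. - g (- x))" by simp
qed

text \<open>Stated for a field of unit vectors and a weight instead of a curve, so that it applies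
  to subarcs without restricting H^2-curves to subintervals.\<close>

lemma loop_energy_bound:
  fixes T :: "real \<Rightarrow> 'a::euclidean_space" and v :: "real \<Rightarrow> real"
  assumes ab: "a < b"
    and v: "continuous_on {a..b} v" "\<And>x. x \<in> {a..b} \<Longrightarrow> v x > 0"
    and T: "has_ac_deriv a b T g" "\<And>x. x \<in> {a..b} \<Longrightarrow> norm (T x) = 1"
      "\<And>x. x \<in> {a..b} \<Longrightarrow> T x \<bullet> g x = 0"
    and P: "(\<lambda>x. (norm (g x))\<^sup>2 / v x) integrable_on {a..b}"
    and closed: "integral {a..b} (\<lambda>x. v x *\<^sub>R T x) = 0"
  shows "varpi_star \<le> integral {a..b} v * integral {a..b} (\<lambda>x. (norm (g x))\<^sup>2 / v x)"
proof -
  let ?P = "\<lambda>x. (norm (g x))\<^sup>2 / v x"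
  define L where "L = integral {a..b} v"
  have vi: "v integrable_on {s..t}" if "a \<le> s" "t \<le> b" for s t
    using that by (intro integrable_continuous_real continuous_on_subset[OF v(1)]) auto
  have Pi: "?P integrable_on {s..t}" if "a \<le> s" "t \<le> b" for s t
    using P that by (auto intro: integrable_on_subinterval)
  have vpos: "integral {s..t} v > 0" if "a \<le> s" "s < t" "t \<le> b" for s t
  proof -
    have "integral {s..t} (\<lambda>_. 0) < integral {s..t} v"
      using that v(2) by (intro integral_less_real continuous_on_subset[OF v(1)]) auto
    then show ?thesis by simp
  qed
  have L0: "L > 0" unfolding L_def using ab by (intro vpos) auto
  have "continuous_on {a..b} (\<lambda>x. integral {a..x} v)"
    by (intro indefinite_integral_continuous_1 vi) auto
  \<comment> \<open>The midpoint in arclength: halves of equal length can share one scale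
    \<open>\<Lambda>\<close>, and their bounds can be added with a common multiplier.\<close>
  then have "\<exists>x\<ge>a. x \<le> b \<and> integral {a..x} v = L / 2"
    using L0 ab by (intro IVT') (auto simp: L_def)
  then obtain c where c: "a \<le> c" "c \<le> b" "integral {a..c} v = L / 2" by blast
  have "c \<noteq> a" using c(3) L0 by auto
  moreover have "c \<noteq> b" using c(3) L0 unfolding L_def by auto
  ultimately have c': "a < c" "c < b" using c(1,2) by simp_all
  have comb: "integral {a..c} f + integral {c..b} f = integral {a..b} f" if "f integrable_on {a..b}" for f :: "real \<Rightarrow> real"
    by (rule Henstock_Kurzweil_Integration.integral_combine[OF c(1,2) that])
  have cr: "integral {c..b} v = L / 2" using comb[OF vi] c(3) by (simp add: L_def)
  define K E where "K = ell_K m_star" and "E = ell_E m_star"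
  define \<Lambda> where "\<Lambda> = 2 * K / L"
  have K: "K > 0" "K = 2 * E"
    unfolding K_def E_def using m_star ell_K_pos[of m_star] by auto
  have \<Lambda>: "\<Lambda> > 0" "\<Lambda> * (L / 2) = K" using L0 K by (simp_all add: \<Lambda>_def)
  let ?R = "\<lambda>x. v x * (1 - T x \<bullet> T c)"
  let ?D = "4 * \<Lambda> * (2 * (K - E) - m_star * K)"
  have right: "integral {c..b} ?P \<ge> 2 * \<Lambda>\<^sup>2 * integral {c..b} ?R - ?D"
    unfolding K_def E_def
  proof (rule elastica_half_bound[OF m_star(1,2) c'(2)])
    show "continuous_on {c..b} v" using c by (auto intro: continuous_on_subset[OF v(1)])
    show "has_ac_deriv c b T g" using c by (intro has_ac_deriv_subinterval[OF T(1)]) auto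
    show "\<Lambda> * integral {c..b} v = ell_K m_star" unfolding cr \<Lambda>(2) K_def ..
  qed (use c v(2) T(2,3) \<Lambda> in \<open>auto intro!: Pi\<close>)
  \<comment> \<open>Reversing the parameter preserves the energy and the inner products with the
    midpoint tangent, so the same half bound applies.\<close>
  have left': "integral {- c..- a} (\<lambda>x. (norm (- g (- x)))\<^sup>2 / v (- x))
    \<ge> 2 * \<Lambda>\<^sup>2 * integral {- c..- a} (\<lambda>x. v (- x) * (1 - T (- x) \<bullet> T (- (- c)))) - ?D"
    unfolding K_def E_def
  proof (rule elastica_half_bound[OF m_star(1,2), where T="\<lambda>x. T (- x)" and v="\<lambda>x. v (- x)" and g="\<lambda>x. - g (- x)"])
    show "- c < - a" using c' by simp
    show "continuous_on {- c..- a} (\<lambda>x. v (- x))"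
      using c by (intro continuous_on_compose2[OF v(1)] continuous_intros) auto
    show "has_ac_deriv (- c) (- a) (\<lambda>x. T (- x)) (\<lambda>x. - g (- x))"
      using c by (intro has_ac_deriv_reflect has_ac_deriv_subinterval[OF T(1)]) auto
    show "(\<lambda>x. (norm (- g (- x)))\<^sup>2 / v (- x)) integrable_on {- c..- a}"
      using Pi[of a c] c Henstock_Kurzweil_Integration.integrable_reflect_real[where f="?P" and a=a and b=c] by simp
    show "\<Lambda> * integral {- c..- a} (\<lambda>x. v (- x)) = ell_K m_star"
      unfolding Henstock_Kurzweil_Integration.integral_reflect_real c(3) \<Lambda>(2) K_def ..
  qed (use c v(2) T(2,3) \<Lambda> in auto)
  have left: "integral {a..c} ?P \<ge> 2 * \<Lambda>\<^sup>2 * integral {a..c} ?R - ?D"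
    using left' Henstock_Kurzweil_Integration.integral_reflect_real[of c a ?P]
      Henstock_Kurzweil_Integration.integral_reflect_real[of c a ?R] by simp
  have cvT: "continuous_on {a..b} (\<lambda>x. v x *\<^sub>R T x)"
    by (intro continuous_intros v(1) has_ac_deriv_continuous_on[OF T(1)])
  \<comment> \<open>Closedness enters through this scalar identity; it evaluates the integral of v
    (1 - u) over the whole loop as its length.\<close>
  have vT: "((\<lambda>x. v x *\<^sub>R T x \<bullet> T c) has_integral 0) {a..b}"
    using has_integral_linear[OF integrable_integral[OF integrable_continuous_real[OF cvT]] bounded_linear_inner_left[of "T c"]]
    by (simp add: closed o_def)
  have "((\<lambda>x. v x - v x *\<^sub>R T x \<bullet> T c) has_integral (L - 0)) {a..b}"
    unfolding L_def by (intro has_integral_diff vT integrable_integral vi) auto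
  then have R: "(?R has_integral L) {a..b}" by (simp add: algebra_simps)
  have "2 * \<Lambda>\<^sup>2 * integral {a..c} ?R + 2 * \<Lambda>\<^sup>2 * integral {c..b} ?R = 2 * \<Lambda>\<^sup>2 * L"
    using comb[OF has_integral_integrable[OF R]]
    unfolding integral_unique[OF R] distrib_left[symmetric] by (rule arg_cong)
  then have "integral {a..b} ?P \<ge> 2 * \<Lambda>\<^sup>2 * L - 2 * ?D"
    using left right comb[OF P] by linarith
  then have "L * integral {a..b} ?P \<ge> L * (2 * \<Lambda>\<^sup>2 * L - 2 * ?D)"
    using L0 by (intro mult_left_mono) auto
  \<comment> \<open>Everything depends only on \<open>\<Lambda> * L\<close> = 2 K; substituting K =
    2 E leaves 32 E^2 - 64 (1 - m) E^2 for m = \<open>m_star\<close>.\<close>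
  moreover have "L * (2 * \<Lambda>\<^sup>2 * L - 2 * ?D) = varpi_star"
  proof -
    have "L * (2 * \<Lambda>\<^sup>2 * L - 2 * ?D) = 2 * (\<Lambda> * L)\<^sup>2 - 8 * (\<Lambda> * L) * (2 * (K - E) - m_star * K)"
      by (simp add: power2_eq_square algebra_simps)
    also have "\<Lambda> * L = 4 * E" using \<Lambda>(2) K by simp
    also have "2 * (4 * E)\<^sup>2 - 8 * (4 * E) * (2 * (K - E) - m_star * K) = varpi_star"
      unfolding K(2) varpi_star_def E_def[symmetric] by (simp add: power2_eq_square algebra_simps)
    finally show ?thesis .
  qed
  ultimately show ?thesis unfolding L_def by simp
qed

section \<open>Multiple points\<close>

lemma ell_E_star_pos: "0 < ell_E m_star"
  using ell_K_pos[of m_star] m_star by simp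

lemma cn_squared_primitive_deriv:
  assumes "0 < m" "m < 1"
  shows "((\<lambda>y. jacobi_E y m - (1 - m) * y) has_real_derivative m * (jacobi_cn y m)\<^sup>2) (at y)"
proof -
  have "((\<lambda>y. jacobi_E y m - (1 - m) * y) has_real_derivative (jacobi_dn y m)\<^sup>2 - (1 - m) * 1) (at y)"
    by (intro DERIV_diff DERIV_cmult DERIV_ident jacobi_E_deriv[OF assms])
  then show ?thesis
    unfolding jacobi_dn_squared[OF assms] jacobi_sn_cn_squared by (simp add: algebra_simps)
qed

text \<open>The integral of m cn^2 over [0, K] equals E - (1 - m) K, which is (2 m - 1) E because K
  = 2 E. The sign thus follows without any numerical estimate of \<open>m_star\<close>; it allows
  square roots of the bound to be added.\<close>

lemma varpi_star_nonneg: "0 \<le> varpi_star"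
proof -
  note m = m_star(1,2)
  have "jacobi_E 0 m_star - (1 - m_star) * 0 \<le> jacobi_E (ell_K m_star) m_star - (1 - m_star) * ell_K m_star"
  proof (rule DERIV_nonneg_imp_nondecreasing[where f="\<lambda>y. jacobi_E y m_star - (1 - m_star) * y"])
    show "0 \<le> ell_K m_star" using ell_K_pos[of m_star] m by simp
    show "\<exists>d. ((\<lambda>y. jacobi_E y m_star - (1 - m_star) * y) has_real_derivative d) (at y) \<and> 0 \<le> d" for y
      using cn_squared_primitive_deriv[OF m, of y] m by (intro exI conjI) auto
  qed
  then have "0 \<le> (2 * m_star - 1) * ell_E m_star"
    unfolding jacobi_values[OF m] unfolding m_star(3) by (simp add: algebra_simps)
  then show ?thesis
    using ell_E_star_pos unfolding varpi_star_def by (simp add: zero_le_mult_iff)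
qed

text \<open>Cauchy-Schwarz in the plane. It makes the square root of length times energy
  superadditive over consecutive arcs, and this yields the square of k - 1 instead of k - 1
  itself.\<close>

lemma sqrt_mult_superadditive:
  fixes a b c d :: real
  assumes "0 \<le> a" "0 \<le> b" "0 \<le> c" "0 \<le> d"
  shows "sqrt (a * b) + sqrt (c * d) \<le> sqrt ((a + c) * (b + d))"
proof (rule real_le_rsqrt)
  have "(sqrt (a * b) + sqrt (c * d))\<^sup>2 = a * b + c * d + 2 * sqrt (a * b) * sqrt (c * d)"
    using assms by (simp add: power2_sum)
  also have "2 * sqrt (a * b) * sqrt (c * d) = 2 * sqrt ((a * d) * (c * b))"
    by (simp add: real_sqrt_mult)
  also have "2 * sqrt ((a * d) * (c * b)) \<le> a * d + c * b"
    using arith_geo_mean_sqrt[of "a * d" "c * b"] assms by simp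
  finally show "(sqrt (a * b) + sqrt (c * d))\<^sup>2 \<le> (a + c) * (b + d)"
    by (simp add: algebra_simps)
qed

lemma curve_length_integral:
  assumes "continuous_on {a..b} (speed a b \<gamma>)"
  shows "curve_length a b \<gamma> = integral {a..b} (speed a b \<gamma>)"
  unfolding curve_length_def
  by (rule LINT_lebesgue_on_Icc[OF absolutely_integrable_continuous_real[OF assms]])

lemma arclength_integral:
  assumes "continuous_on {a..b} (speed a b \<gamma>)" "x \<le> b"
  shows "arclength a b \<gamma> x = integral {a..x} (speed a b \<gamma>)"
  unfolding arclength_def using assms(2)
  by (intro LINT_lebesgue_on_Icc absolutely_integrable_continuous_real continuous_on_subset[OF assms(1)]) auto

theorem multiplicity_energy_bound:
  fixes \<gamma> :: "real \<Rightarrow> 'a::euclidean_space"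
  assumes \<gamma>: "immersed_H2_curve a b \<gamma>" and k: "k \<ge> 1" "has_point_of_multiplicity a b \<gamma> k"
  shows "varpi_star * (real k - 1)\<^sup>2 \<le> normalized_bending_energy a b \<gamma>"
proof -
  have ab: "a < b" using \<gamma> by (simp add: immersed_H2_curve_def)
  define v T where "v = speed a b \<gamma>" and "T = unit_tangent a b \<gamma>"
  note str = immersed_H2_curve_structure[OF \<gamma>, folded v_def T_def]
  note v = str(2,3) and norm_T = str(4) and der = str(5)
  obtain g where T: "has_ac_deriv a b T g" and Tg: "\<forall>x\<in>{a..b}. T x \<bullet> g x = 0"
    and P: "(\<lambda>x. (norm (g x))\<^sup>2 / v x) absolutely_integrable_on {a..b}"
    using str(1) by blast
  let ?P = "\<lambda>x. (norm (g x))\<^sup>2 / v x"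
  have Pi: "?P integrable_on {s..t}" if "a \<le> s" "t \<le> b" for s t
    using absolutely_integrable_on_subinterval[OF P] that by (auto simp: absolutely_integrable_on_def)
  have vi: "v integrable_on {s..t}" if "a \<le> s" "t \<le> b" for s t
    using that by (intro integrable_continuous_real continuous_on_subset[OF v(1)]) auto
  have nn: "0 \<le> integral {s..t} v" "0 \<le> integral {s..t} ?P" if "a \<le> s" "t \<le> b" for s t
  proof -
    have "0 \<le> v x" "0 \<le> ?P x" if "x \<in> {s..t}" for x
      using v(2)[of x] that \<open>a \<le> s\<close> \<open>t \<le> b\<close> by simp_all
    then show "0 \<le> integral {s..t} v" "0 \<le> integral {s..t} ?P"
      using that by (intro integral_nonneg vi Pi; simp)+
  qed
  define \<Phi> where "\<Phi> s t = sqrt (integral {s..t} v * integral {s..t} ?P)" for s t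
  have \<Phi>0: "0 \<le> \<Phi> s t" if "a \<le> s" "t \<le> b" for s t
    unfolding \<Phi>_def using nn[OF that] by simp
  have add: "\<Phi> s t + \<Phi> t u \<le> \<Phi> s u" if "a \<le> s" "s \<le> t" "t \<le> u" "u \<le> b" for s t u
  proof -
    have "integral {s..t} v + integral {t..u} v = integral {s..u} v"
      "integral {s..t} ?P + integral {t..u} ?P = integral {s..u} ?P"
      using that by (intro Henstock_Kurzweil_Integration.integral_combine vi Pi; simp)+
    then show ?thesis
      using sqrt_mult_superadditive[OF nn[of s t] nn[of t u]] that unfolding \<Phi>_def by simp
  qed
  \<comment> \<open>Equal end points of the arc mean exactly that the integral of
    \<open>v x *\<^sub>R T x\<close> over it is zero.\<close>
  have loop: "sqrt varpi_star \<le> \<Phi> s t" if st: "a \<le> s" "s < t" "t \<le> b" "\<gamma> s = \<gamma> t" for s t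
    unfolding \<Phi>_def
  proof (rule real_sqrt_le_mono[OF loop_energy_bound])
    have sub: "{s..t} \<subseteq> {a..b}" using st by auto
    show "continuous_on {s..t} v" using v(1) sub by (rule continuous_on_subset)
    show "has_ac_deriv s t T g" using st by (intro has_ac_deriv_subinterval[OF T]) auto
    show "?P integrable_on {s..t}" using st by (intro Pi)
    have "((\<lambda>x. v x *\<^sub>R T x) has_integral (\<gamma> t - \<gamma> s)) {s..t}"
    proof (rule fundamental_theorem_of_calculus)
      show "(\<gamma> has_vector_derivative v x *\<^sub>R T x) (at x within {s..t})" if "x \<in> {s..t}" for x
        using that sub by (intro has_vector_derivative_within_subset[OF der]) auto
    qed (use st in simp)
    then show "integral {s..t} (\<lambda>x. v x *\<^sub>R T x) = 0"
      using st by (simp add: integral_unique)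
  qed (use st v(2) norm_T Tg in auto)
  obtain p S where S: "S \<subseteq> {x \<in> {a..b}. \<gamma> x = p}" "finite S" "card S = k"
    using k(2) unfolding has_point_of_multiplicity_def by blast
  \<comment> \<open>Induction by adding a new largest parameter: each one after the first closes one
    more loop with its predecessor, so k visits give k - 1 loops.\<close>
  have "A \<subseteq> S \<Longrightarrow> A \<noteq> {} \<Longrightarrow> (real (card A) - 1) * sqrt varpi_star \<le> \<Phi> a (Max A)" if "finite A" for A
    using that
  proof (induction rule: finite_linorder_max_induct)
    case (insert t A)
    have t: "t \<in> {a..b}" "\<gamma> t = p" using insert.prems(1) S(1) by auto
    show ?case
    proof (cases "A = {}")
      case True
      then show ?thesis using \<Phi>0[of a t] t by simp
    next
      case False
      have "Max A \<in> A" using insert.hyps(1) False by (rule Max_in)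
      then have M: "Max A \<in> {a..b}" "\<gamma> (Max A) = p" "Max A < t"
        using insert.prems(1) S(1) insert.hyps(2) by auto
      have "Max (insert t A) = t"
        using insert.hyps(1,2) by (intro Max_eqI) (auto intro: less_imp_le)
      moreover have "card (insert t A) = Suc (card A)"
        using insert.hyps(1,2) by (intro card_insert_disjoint) auto
      moreover have "(real (card A) - 1) * sqrt varpi_star \<le> \<Phi> a (Max A)"
        using insert.IH insert.prems(1) False by blast
      moreover have "sqrt varpi_star \<le> \<Phi> (Max A) t"
        using M t by (intro loop) auto
      moreover have "\<Phi> a (Max A) + \<Phi> (Max A) t \<le> \<Phi> a t"
        using M t by (intro add) auto
      ultimately show ?thesis by (simp add: algebra_simps)
    qed
  qed simp
  moreover have "S \<noteq> {}" using S(3) k(1) by auto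
  ultimately have "(real k - 1) * sqrt varpi_star \<le> \<Phi> a (Max S)"
    using S(2,3) by blast
  also have "\<dots> \<le> \<Phi> a b"
  proof -
    have "Max S \<in> {a..b}" using S(1) Max_in[OF S(2) \<open>S \<noteq> {}\<close>] by auto
    then show ?thesis using add[of a "Max S" b] \<Phi>0[of "Max S" b] by simp
  qed
  finally have "((real k - 1) * sqrt varpi_star)\<^sup>2 \<le> (\<Phi> a b)\<^sup>2"
    using k(1) varpi_star_nonneg by (intro power_mono) auto
  moreover have "((real k - 1) * sqrt varpi_star)\<^sup>2 = varpi_star * (real k - 1)\<^sup>2"
    using varpi_star_nonneg by (simp add: power_mult_distrib)
  moreover have "(\<Phi> a b)\<^sup>2 = integral {a..b} v * integral {a..b} ?P"
    unfolding \<Phi>_def using nn[of a b] by simp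
  moreover have "bending_energy a b \<gamma> = integral {a..b} ?P"
    unfolding v_def using T P v(2) by (intro bending_energy_ac[OF ab]) (auto simp: T_def v_def)
  moreover have "curve_length a b \<gamma> = integral {a..b} v"
    unfolding v_def using v(1) by (intro curve_length_integral) (simp add: v_def)
  ultimately show ?thesis unfolding normalized_bending_energy_def by simp
qed

section \<open>The figure-eight elastica\<close>

lemma AE_lebesgue_on_iff_negligible:
  assumes "S \<in> sets lebesgue"
  shows "(AE x in lebesgue_on S. Q x) \<longleftrightarrow> (\<exists>N. negligible N \<and> (\<forall>x\<in>S - N. Q x))"
proof -
  have "(AE x in lebesgue_on S. Q x) \<longleftrightarrow> (AE x in lebesgue. x \<in> S \<longrightarrow> Q x)"
    using assms by (intro AE_restrict_space_iff) simp
  also have "\<dots> \<longleftrightarrow> (\<exists>N\<in>null_sets lebesgue. {x \<in> space lebesgue. \<not> (x \<in> S \<longrightarrow> Q x)} \<subseteq> N)"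
    by (rule eventually_ae_filter)
  also have "\<dots> \<longleftrightarrow> (\<exists>N. negligible N \<and> (\<forall>x\<in>S - N. Q x))"
    unfolding negligible_iff_null_sets[symmetric] Bex_def by auto
  finally show ?thesis .
qed

text \<open>The unit tangent of the figure-eight elastica is \<open>(cos \<phi>, sin \<phi>)\<close> with
  \<open>sin (\<phi> / 2) = sqrt m sn\<close>.\<close>

definition elastica_cos :: "real \<Rightarrow> real" where
  "elastica_cos y = 1 - 2 * m_star * (jacobi_sn y m_star)\<^sup>2"

definition elastica_sin :: "real \<Rightarrow> real" where
  "elastica_sin y = 2 * sqrt m_star * jacobi_sn y m_star * jacobi_dn y m_star"

text \<open>The derivative of the tangent angle: differentiate sin (\<phi>/2) = sqrt m sn and use
  cos (\<phi>/2) = dn.\<close>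

definition elastica_curvature :: "real \<Rightarrow> real" where
  "elastica_curvature y = 2 * sqrt m_star * jacobi_cn y m_star"

lemma elastica_cos_sin: "(elastica_cos y)\<^sup>2 + (elastica_sin y)\<^sup>2 = 1"
  unfolding elastica_cos_def elastica_sin_def power_mult_distrib jacobi_dn_squared[OF m_star(1,2)]
  using m_star(1) by (simp add: power2_eq_square algebra_simps)

lemma elastica_cos_deriv:
  "(elastica_cos has_real_derivative - elastica_curvature y * elastica_sin y) (at y)"
proof -
  have "(elastica_cos has_real_derivative - 4 * m_star * jacobi_sn y m_star * (jacobi_cn y m_star * jacobi_dn y m_star)) (at y)"
    unfolding elastica_cos_def[abs_def]
    by (auto intro!: derivative_eq_intros jacobi_sn_deriv[OF m_star(1,2)])
  moreover have "- 4 * m_star * jacobi_sn y m_star * (jacobi_cn y m_star * jacobi_dn y m_star)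
      = - 4 * (sqrt m_star * sqrt m_star) * jacobi_sn y m_star * (jacobi_cn y m_star * jacobi_dn y m_star)"
    using m_star(1) by simp
  ultimately show ?thesis
    unfolding elastica_curvature_def elastica_sin_def by (simp only: mult_ac mult_minus_left) (simp add: mult_ac)
qed

lemma elastica_sin_deriv:
  "(elastica_sin has_real_derivative elastica_curvature y * elastica_cos y) (at y)"
proof -
  note m = m_star(1,2)
  have "(elastica_sin has_real_derivative 2 * sqrt m_star * ((jacobi_cn y m_star * jacobi_dn y m_star) * jacobi_dn y m_star
     + (- m_star * jacobi_sn y m_star * jacobi_cn y m_star) * jacobi_sn y m_star)) (at y)"
    unfolding elastica_sin_def[abs_def] mult.assoc[of "2 * sqrt m_star"]
    by (intro DERIV_cmult DERIV_mult jacobi_sn_deriv jacobi_dn_deriv m)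
  also have "2 * sqrt m_star * ((jacobi_cn y m_star * jacobi_dn y m_star) * jacobi_dn y m_star
     + (- m_star * jacobi_sn y m_star * jacobi_cn y m_star) * jacobi_sn y m_star)
     = 2 * sqrt m_star * jacobi_cn y m_star * ((jacobi_dn y m_star)\<^sup>2 - m_star * (jacobi_sn y m_star)\<^sup>2)"
    by (simp add: algebra_simps power2_eq_square)
  also have "\<dots> = elastica_curvature y * elastica_cos y"
    unfolding elastica_curvature_def elastica_cos_def jacobi_dn_squared[OF m] by simp
  finally show ?thesis .
qed

lemma elastica_cos_primitive:
  "((\<lambda>y. 2 * jacobi_E y m_star - y) has_real_derivative elastica_cos y) (at y)"
proof -
  have "((\<lambda>y. 2 * jacobi_E y m_star - y) has_real_derivative 2 * (jacobi_dn y m_star)\<^sup>2 - 1) (at y)"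
    by (intro DERIV_diff DERIV_cmult DERIV_ident jacobi_E_deriv m_star)
  then show ?thesis
    unfolding elastica_cos_def jacobi_dn_squared[OF m_star(1,2)] by (simp add: algebra_simps)
qed

text \<open>The pendulum equation \<phi>'' = - sin \<phi> of the elastica. It makes the second
  coordinate of the curve a multiple of the curvature.\<close>

lemma elastica_sin_primitive:
  "((\<lambda>y. - elastica_curvature y) has_real_derivative elastica_sin y) (at y)"
proof -
  have "((\<lambda>y. - (2 * sqrt m_star * jacobi_cn y m_star)) has_real_derivative
      - (2 * sqrt m_star * (- jacobi_sn y m_star * jacobi_dn y m_star))) (at y)"
    by (intro DERIV_minus DERIV_cmult jacobi_cn_deriv m_star)
  then show ?thesis
    unfolding elastica_curvature_def elastica_sin_def by (simp add: mult.assoc)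
qed

lemma elastica_energy_primitive:
  "((\<lambda>y. 4 * (jacobi_E y m_star - (1 - m_star) * y)) has_real_derivative (elastica_curvature y)\<^sup>2) (at y)"
proof -
  have "((\<lambda>y. 4 * (jacobi_E y m_star - (1 - m_star) * y)) has_real_derivative
      4 * (m_star * (jacobi_cn y m_star)\<^sup>2)) (at y)"
    by (intro DERIV_cmult cn_squared_primitive_deriv m_star)
  then show ?thesis
    unfolding elastica_curvature_def power_mult_distrib using m_star(1) by (simp add: mult.assoc)
qed

lemma continuous_on_elastica:
  "continuous_on S elastica_cos" "continuous_on S elastica_sin" "continuous_on S elastica_curvature"
  unfolding elastica_cos_def[abs_def] elastica_sin_def[abs_def] elastica_curvature_def[abs_def]
  by (intro continuous_intros continuous_on_jacobi m_star)+

lemma in_span_orthonormal_pair: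
  fixes e1 e2 z :: "'a::euclidean_space"
  assumes "norm e1 = 1" "norm e2 = 1" "e1 \<bullet> e2 = 0" "z \<in> span {e1, e2}"
  shows "z = (z \<bullet> e1) *\<^sub>R e1 + (z \<bullet> e2) *\<^sub>R e2"
proof -
  define w where "w = z - ((z \<bullet> e1) *\<^sub>R e1 + (z \<bullet> e2) *\<^sub>R e2)"
  have e: "e1 \<bullet> e1 = 1" "e2 \<bullet> e2 = 1" "e2 \<bullet> e1 = 0"
    using assms by (simp_all add: dot_square_norm inner_commute)
  have "w \<in> span {e1, e2}"
    unfolding w_def by (intro span_diff span_add span_scale assms(4)) (auto intro: span_base)
  moreover have "w \<bullet> e1 = 0" "w \<bullet> e2 = 0"
    by (simp_all add: w_def inner_diff_left inner_add_left e assms(3))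
  ultimately have "orthogonal w w"
    by (intro orthogonal_to_span[of w "{e1, e2}"]) (auto simp: orthogonal_def)
  then show ?thesis by (simp add: orthogonal_def w_def)
qed

lemma integral_compose_primitive:
  fixes F f y :: "real \<Rightarrow> real"
  assumes "a \<le> b" "\<And>x. x \<in> {a..b} \<Longrightarrow> (y has_real_derivative y' x) (at x within {a..b})"
    and "\<And>z. (F has_real_derivative f z) (at z)"
  shows "((\<lambda>x. f (y x) * y' x) has_integral (F (y b) - F (y a))) {a..b}"
proof (rule fundamental_theorem_of_calculus[OF assms(1)])
  show "((\<lambda>x. F (y x)) has_vector_derivative f (y x) * y' x) (at x within {a..b})" if "x \<in> {a..b}" for x
    using DERIV_chain2[OF assms(3) assms(2)[OF that]] by (simp add: has_real_derivative_iff_has_vector_derivative)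
qed

text \<open>Signed curvature determines a planar curve up to a rigid motion, with a reflection when
  \<open>\<sigma> = -1\<close>. So the tangent is a fixed rotation of the model field (cos \<phi>,
  sin \<phi>), up to that reflection, and both claims reduce to integrals with explicit
  primitives.\<close>

lemma figure_eight_closed_energy:
  fixes \<gamma> :: "real \<Rightarrow> 'a::euclidean_space"
  assumes "half_fold_figure_eight_elastica a b \<gamma>"
  shows "\<gamma> a = \<gamma> b" "normalized_bending_energy a b \<gamma> = varpi_star"
proof -
  note m = m_star(1,2)
  define v T where "v = speed a b \<gamma>" and "T = unit_tangent a b \<gamma>"
  define K E where "K = ell_K m_star" and "E = ell_E m_star"
  define L where "L = curve_length a b \<gamma>"
  define \<Lambda> where "\<Lambda> = 2 * K / L"
  have \<gamma>: "immersed_H2_curve a b \<gamma>"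
    using assms unfolding half_fold_figure_eight_elastica_def by blast
  obtain p e1 e2 \<sigma> where e: "norm e1 = 1" "norm e2 = 1" "e1 \<bullet> e2 = 0"
    and plane: "\<forall>x\<in>{a..b}. \<gamma> x - p \<in> span {e1, e2}" and \<sigma>: "\<sigma> \<in> {1, - 1 :: real}"
    and ae: "AE x in lebesgue_on {a..b}. signed_curvature e1 e2 a b \<gamma> x =
           \<sigma> * (2 * sqrt m_star * \<Lambda> * jacobi_cn (\<Lambda> * arclength a b \<gamma> x - K) m_star)"
    using assms unfolding half_fold_figure_eight_elastica_def Let_def \<Lambda>_def L_def K_def by blast
  have ab: "a < b" using \<gamma> by (simp add: immersed_H2_curve_def)
  have ee: "e1 \<bullet> e1 = 1" "e2 \<bullet> e2 = 1" "e2 \<bullet> e1 = 0"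
    using e by (simp_all add: dot_square_norm inner_commute)
  have \<sigma>2: "\<sigma> * \<sigma> = 1" using \<sigma> by auto
  note str = immersed_H2_curve_structure[OF \<gamma>, folded v_def T_def]
  note v = str(2,3) and norm_T = str(4) and der = str(5)
  obtain g where T: "has_ac_deriv a b T g" and Tg: "\<forall>x\<in>{a..b}. T x \<bullet> g x = 0"
    and P: "(\<lambda>x. (norm (g x))\<^sup>2 / v x) absolutely_integrable_on {a..b}"
    using str(1) by blast
  have Lint: "L = integral {a..b} v"
    unfolding L_def v_def using v(1) by (intro curve_length_integral) (simp add: v_def)
  have L0: "L > 0"
  proof -
    have "integral {a..b} (\<lambda>_. 0) < integral {a..b} v"
      using ab v by (intro integral_less_real) auto
    then show ?thesis by (simp add: Lint)
  qed
  have K: "K > 0" "K = 2 * E"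
    unfolding K_def E_def using m_star ell_K_pos[of m_star] by auto
  have \<Lambda>: "\<Lambda> > 0" "\<Lambda> * L = 2 * K" using K(1) L0 by (simp_all add: \<Lambda>_def)
  \<comment> \<open>The argument of \<open>cn\<close> in the prescribed curvature; it runs from -K
    to K.\<close>
  define y where "y x = \<Lambda> * integral {a..x} v - K" for x
  have yd: "(y has_real_derivative \<Lambda> * v x) (at x within {a..b})" if "x \<in> {a..b}" for x
  proof -
    have "((\<lambda>x. integral {a..x} v) has_real_derivative v x) (at x within {a..b})"
      unfolding has_real_derivative_iff_has_vector_derivative
      by (rule integral_has_vector_derivative[OF v(1) that])
    from DERIV_diff[OF DERIV_cmult[OF this, of \<Lambda>] DERIV_const[of K]] show ?thesis
      unfolding y_def[abs_def] by simp
  qed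
  have ya: "y a = - K" and yb: "y b = K"
    unfolding y_def Lint[symmetric] using \<Lambda>(2) by simp_all
  have cy: "continuous_on {a..b} y" by (rule DERIV_continuous_on[OF yd])
  define \<omega> where "\<omega> x = elastica_curvature (y x) * (\<Lambda> * v x)" for x
  define C S where "C x = elastica_cos (y x)" and "S x = elastica_sin (y x)" for x
  note comp = continuous_on_compose2[OF _ cy subset_UNIV]
  have cC: "continuous_on {a..b} C" "continuous_on {a..b} S" "continuous_on {a..b} \<omega>"
    unfolding C_def[abs_def] S_def[abs_def] \<omega>_def[abs_def]
    by (intro continuous_intros v(1) comp[OF continuous_on_elastica(1)] comp[OF continuous_on_elastica(2)]
        comp[OF continuous_on_elastica(3)])+
  have C: "has_ac_deriv a b C (\<lambda>x. - \<omega> x * S x)"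
  proof (rule has_ac_deriv_C1)
    show "continuous_on {a..b} (\<lambda>x. - \<omega> x * S x)" by (intro continuous_intros cC)
    show "(C has_vector_derivative - \<omega> x * S x) (at x within {a..b})" if "a \<le> x" "x \<le> b" for x
      using DERIV_chain2[OF elastica_cos_deriv yd[of x]] that
      unfolding C_def[abs_def] S_def \<omega>_def has_real_derivative_iff_has_vector_derivative[symmetric]
      by (simp add: mult_ac)
  qed
  have S: "has_ac_deriv a b S (\<lambda>x. \<omega> x * C x)"
  proof (rule has_ac_deriv_C1)
    show "continuous_on {a..b} (\<lambda>x. \<omega> x * C x)" by (intro continuous_intros cC)
    show "(S has_vector_derivative \<omega> x * C x) (at x within {a..b})" if "a \<le> x" "x \<le> b" for x
      using DERIV_chain2[OF elastica_sin_deriv yd[of x]] that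
      unfolding S_def[abs_def] C_def \<omega>_def has_real_derivative_iff_has_vector_derivative[symmetric]
      by (simp add: mult_ac)
  qed
  have CS: "C x * C x + S x * S x = 1" for x
    using elastica_cos_sin[of "y x"] by (simp add: C_def S_def power2_eq_square)
  define T1 T2 where "T1 x = T x \<bullet> e1" and "T2 x = T x \<bullet> e2" for x
  let ?pr = "\<lambda>z. (z \<bullet> e1) *\<^sub>R e1 + (z \<bullet> e2) *\<^sub>R e2"
  have pr: "bounded_linear ?pr"
    by (intro bounded_linear_add bounded_linear_scaleR_const[OF bounded_linear_inner_left])
  \<comment> \<open>The orthogonal projection onto the plane fixes \<open>\<gamma> - p\<close>,
    hence also its derivative.\<close>
  have Tdec: "T x = T1 x *\<^sub>R e1 + T2 x *\<^sub>R e2" if x: "x \<in> {a..b}" for x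
  proof -
    have d0: "((\<lambda>x. \<gamma> x - p) has_vector_derivative v x *\<^sub>R T x) (at x within {a..b})"
      using der[OF x] by (auto intro!: derivative_eq_intros)
    have "((\<lambda>x. ?pr (\<gamma> x - p)) has_vector_derivative ?pr (v x *\<^sub>R T x)) (at x within {a..b})"
      by (rule bounded_linear.has_vector_derivative[OF pr d0])
    then have "((\<lambda>x. \<gamma> x - p) has_vector_derivative ?pr (v x *\<^sub>R T x)) (at x within {a..b})"
    proof (rule has_vector_derivative_transform[OF x, rotated])
      show "\<gamma> t - p = ?pr (\<gamma> t - p)" if "t \<in> {a..b}" for t
        by (rule in_span_orthonormal_pair[OF e]) (use plane that in blast)
    qed
    then have "v x *\<^sub>R T x = ?pr (v x *\<^sub>R T x)"
      using vector_derivative_unique_within_closed_interval[of a b x] ab x d0 by (metis box_real(2))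
    also have "\<dots> = v x *\<^sub>R ?pr (T x)" by (simp add: scaleR_add_right)
    finally show ?thesis using v(2)[OF x] unfolding T1_def T2_def by simp
  qed
  have TT: "T1 x * T1 x + T2 x * T2 x = 1" if "x \<in> {a..b}" for x
  proof -
    have "T x \<bullet> T x = 1" using norm_T[OF that] by (simp add: dot_square_norm)
    then show ?thesis unfolding Tdec[OF that] by (simp add: inner_add_left inner_add_right ee e(3))
  qed
  have T1: "has_ac_deriv a b T1 (\<lambda>x. g x \<bullet> e1)"
    unfolding T1_def[abs_def] by (rule has_ac_deriv_linear[OF T bounded_linear_inner_left])
  have T2: "has_ac_deriv a b T2 (\<lambda>x. g x \<bullet> e2)"
    unfolding T2_def[abs_def] by (rule has_ac_deriv_linear[OF T bounded_linear_inner_left])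
  \<comment> \<open>Both \<open>g\<close> and its projection are derivatives of the same planar
    tangent field, so \<open>g\<close> lies in the plane almost everywhere.\<close>
  have "has_ac_deriv a b T (\<lambda>x. ?pr (g x))"
  proof (rule has_ac_deriv_cong[OF has_ac_deriv_linear[OF T pr]])
    show "?pr (T x) = T x" if "a \<le> x" "x \<le> b" for x
      using Tdec[of x] that unfolding T1_def T2_def by simp
  qed simp
  from has_ac_deriv_unique[OF ab T this] obtain N1 where N1: "negligible N1"
    "\<forall>x\<in>{a..b} - N1. g x = ?pr (g x)" by blast
  obtain N2 where N2: "negligible N2" "\<forall>x\<in>{a..b} - N2. curvature a b \<gamma> x = (1 / v x) *\<^sub>R g x"
    using curvature_ac[OF ab, of \<gamma> g] T unfolding T_def v_def by blast
  obtain N3 where N3: "negligible N3" "\<forall>x\<in>{a..b} - N3. signed_curvature e1 e2 a b \<gamma> x =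
           \<sigma> * (2 * sqrt m_star * \<Lambda> * jacobi_cn (\<Lambda> * arclength a b \<gamma> x - K) m_star)"
    using ae by (subst (asm) AE_lebesgue_on_iff_negligible) auto
  define N where "N = N1 \<union> N2 \<union> N3"
  have N: "negligible N" unfolding N_def using N1(1) N2(1) N3(1) by (intro negligible_Un)
  \<comment> \<open>The curvature equation and orthogonality to the tangent form a linear system for
    the two components of \<open>g\<close>; its matrix is orthogonal because \<open>T1\<close> and
    \<open>T2\<close> are the components of a unit vector.\<close>
  have frenet: "g x \<bullet> e1 = - \<sigma> * \<omega> x * T2 x" "g x \<bullet> e2 = \<sigma> * \<omega> x * T1 x"
    "(norm (g x))\<^sup>2 = (\<omega> x)\<^sup>2" if x: "x \<in> {a..b} - N" for x
  proof -
    have xab: "x \<in> {a..b}" using x by blast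
    define g1 g2 where "g1 = g x \<bullet> e1" and "g2 = g x \<bullet> e2"
    have "signed_curvature e1 e2 a b \<gamma> x = ((1 / v x) *\<^sub>R g x) \<bullet> (T1 x *\<^sub>R e2 - T2 x *\<^sub>R e1)"
      unfolding signed_curvature_def Let_def T1_def T2_def T_def[symmetric]
      using N2(2) x by (simp add: N_def)
    also have "\<dots> = (T1 x * g2 - T2 x * g1) / v x"
      by (simp add: inner_diff_right g1_def g2_def diff_divide_distrib)
    finally have "(T1 x * g2 - T2 x * g1) / v x = \<sigma> * (2 * sqrt m_star * \<Lambda> * jacobi_cn (\<Lambda> * arclength a b \<gamma> x - K) m_star)"
      using N3(2) x by (simp add: N_def)
    also have "arclength a b \<gamma> x = integral {a..x} v"
      unfolding v_def using v(1) xab by (intro arclength_integral) (auto simp: v_def)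
    finally have 1: "T1 x * g2 - T2 x * g1 = \<sigma> * \<omega> x"
      using v(2)[OF xab] unfolding \<omega>_def elastica_curvature_def y_def by (simp add: field_simps)
    have "T x \<bullet> g x = 0" using Tg xab by blast
    then have 2: "T1 x * g1 + T2 x * g2 = 0"
      unfolding Tdec[OF xab] by (simp add: inner_add_left g1_def g2_def inner_commute[of "g x"])
    note tt = TT[OF xab]
    have "g1 = (T1 x * T1 x + T2 x * T2 x) * g1" using tt by simp
    also have "\<dots> = T1 x * (T1 x * g1 + T2 x * g2) - T2 x * (T1 x * g2 - T2 x * g1)"
      by (simp add: algebra_simps)
    finally have g1: "g1 = - \<sigma> * \<omega> x * T2 x" unfolding 1 2 by simp
    have "g2 = (T1 x * T1 x + T2 x * T2 x) * g2" using tt by simp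
    also have "\<dots> = T2 x * (T1 x * g1 + T2 x * g2) + T1 x * (T1 x * g2 - T2 x * g1)"
      by (simp add: algebra_simps)
    finally have g2: "g2 = \<sigma> * \<omega> x * T1 x" unfolding 1 2 by simp
    show "g x \<bullet> e1 = - \<sigma> * \<omega> x * T2 x" "g x \<bullet> e2 = \<sigma> * \<omega> x * T1 x"
      using g1 g2 by (simp_all add: g1_def g2_def)
    have "g x = g1 *\<^sub>R e1 + g2 *\<^sub>R e2"
      unfolding g1_def g2_def using N1(2) x by (simp add: N_def)
    then have "(norm (g x))\<^sup>2 = g1 * g1 + g2 * g2"
      unfolding power2_norm_eq_inner by (simp add: inner_add_left inner_add_right ee e(3))
    also have "\<dots> = (\<sigma> * \<sigma>) * (\<omega> x)\<^sup>2 * (T1 x * T1 x + T2 x * T2 x)"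
      unfolding g1 g2 by (simp add: algebra_simps power2_eq_square)
    finally show "(norm (g x))\<^sup>2 = (\<omega> x)\<^sup>2" unfolding tt \<sigma>2 by simp
  qed
  have T1': "has_ac_deriv a b T1 (\<lambda>x. - \<sigma> * \<omega> x * T2 x)"
    by (rule has_ac_deriv_spike[OF T1 N]) (simp only: frenet)
  have T2': "has_ac_deriv a b T2 (\<lambda>x. \<sigma> * \<omega> x * T1 x)"
    by (rule has_ac_deriv_spike[OF T2 N]) (simp only: frenet)
  have const: "f x = f a" if "has_ac_deriv a b f f'" "\<And>x. f' x = 0" "x \<in> {a..b}" for f f' :: "real \<Rightarrow> real" and x
  proof -
    have "f' = (\<lambda>_. 0)" using that(2) by (rule ext)
    then show ?thesis using has_ac_derivD[OF that(1), of x] that(3) by simp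
  qed
  \<comment> \<open>\<open>A\<close> and \<open>B\<close> are the cosine and sine of the angle
    between (T1, \<sigma> T2) and the model (C, S). Their constancy replaces a uniqueness theorem
    for the frame equation, whose solutions here are only absolutely continuous.\<close>
  define A where "A x = T1 x * C x + \<sigma> * (T2 x * S x)" for x
  define B where "B x = \<sigma> * (T2 x * C x) + - 1 * (T1 x * S x)" for x
  have A: "A x = A a" if "x \<in> {a..b}" for x
  proof (rule const[OF _ _ that])
    show "has_ac_deriv a b A (\<lambda>x. (T1 x * (- \<omega> x * S x) + (- \<sigma> * \<omega> x * T2 x) * C x)
        + \<sigma> * (T2 x * (\<omega> x * C x) + (\<sigma> * \<omega> x * T1 x) * S x))"
      unfolding A_def[abs_def]
      by (intro has_ac_deriv_add has_ac_deriv_cmul has_ac_deriv_mult T1' T2' C S)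
    have "(T1 x * (- \<omega> x * S x) + (- \<sigma> * \<omega> x * T2 x) * C x)
        + \<sigma> * (T2 x * (\<omega> x * C x) + (\<sigma> * \<omega> x * T1 x) * S x) = (\<sigma> * \<sigma> - 1) * (\<omega> x * T1 x * S x)" for x
      by (simp add: algebra_simps)
    then show "(T1 x * (- \<omega> x * S x) + (- \<sigma> * \<omega> x * T2 x) * C x)
        + \<sigma> * (T2 x * (\<omega> x * C x) + (\<sigma> * \<omega> x * T1 x) * S x) = 0" for x
      unfolding \<sigma>2 by simp
  qed
  have B: "B x = B a" if "x \<in> {a..b}" for x
  proof (rule const[OF _ _ that])
    show "has_ac_deriv a b B (\<lambda>x. \<sigma> * (T2 x * (- \<omega> x * S x) + (\<sigma> * \<omega> x * T1 x) * C x)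
        + - 1 * (T1 x * (\<omega> x * C x) + (- \<sigma> * \<omega> x * T2 x) * S x))"
      unfolding B_def[abs_def]
      by (intro has_ac_deriv_add has_ac_deriv_cmul has_ac_deriv_mult T1' T2' C S)
    have "\<sigma> * (T2 x * (- \<omega> x * S x) + (\<sigma> * \<omega> x * T1 x) * C x)
        + - 1 * (T1 x * (\<omega> x * C x) + (- \<sigma> * \<omega> x * T2 x) * S x) = (\<sigma> * \<sigma> - 1) * (\<omega> x * T1 x * C x)" for x
      by (simp add: algebra_simps)
    then show "\<sigma> * (T2 x * (- \<omega> x * S x) + (\<sigma> * \<omega> x * T1 x) * C x)
        + - 1 * (T1 x * (\<omega> x * C x) + (- \<sigma> * \<omega> x * T2 x) * S x) = 0" for x
      unfolding \<sigma>2 by simp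
  qed
  have T1eq: "T1 x = A a * C x - B a * S x" if "x \<in> {a..b}" for x
  proof -
    have "T1 x = T1 x * (C x * C x + S x * S x)" unfolding CS by simp
    also have "\<dots> = A x * C x - B x * S x" by (simp add: A_def B_def algebra_simps)
    finally show ?thesis unfolding A[OF that] B[OF that] .
  qed
  have T2eq: "T2 x = \<sigma> * (A a * S x + B a * C x)" if "x \<in> {a..b}" for x
  proof -
    have "T2 x = (\<sigma> * \<sigma>) * T2 x * (C x * C x + S x * S x)" unfolding CS \<sigma>2 by simp
    also have "\<dots> = \<sigma> * (A x * S x + B x * C x)" by (simp add: A_def B_def algebra_simps)
    finally show ?thesis unfolding A[OF that] B[OF that] .
  qed
  note jv = jacobi_values[OF m, folded K_def E_def]
  \<comment> \<open>The primitive \<open>2 * jacobi_E y m_star - y\<close> takes the values 2 E - K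
    and K - 2 E at the two ends; they vanish by the defining equation of
    \<open>m_star\<close>.\<close>
  have intC: "((\<lambda>x. C x * (\<Lambda> * v x)) has_integral 0) {a..b}"
    using integral_compose_primitive[OF less_imp_le[OF ab] yd elastica_cos_primitive]
    unfolding C_def ya yb jv using K(2) by simp
  \<comment> \<open>This direction closes because \<open>cn\<close>, and with it the curvature,
    vanishes at both ends.\<close>
  have intS: "((\<lambda>x. S x * (\<Lambda> * v x)) has_integral 0) {a..b}"
    using integral_compose_primitive[OF less_imp_le[OF ab] yd elastica_sin_primitive]
    unfolding S_def ya yb elastica_curvature_def jv by simp
  have i1: "((\<lambda>x. (A a * (C x * (\<Lambda> * v x)) - B a * (S x * (\<Lambda> * v x))) *\<^sub>R e1 +
       (\<sigma> * (A a * (S x * (\<Lambda> * v x)) + B a * (C x * (\<Lambda> * v x)))) *\<^sub>R e2) has_integral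
       ((A a * 0 - B a * 0) *\<^sub>R e1 + (\<sigma> * (A a * 0 + B a * 0)) *\<^sub>R e2)) {a..b}"
    by (intro has_integral_add has_integral_scaleR_left has_integral_diff has_integral_mult_right intC intS)
  have "((\<lambda>x. (\<Lambda> * v x) *\<^sub>R T x) has_integral 0) {a..b}"
  proof (rule has_integral_eq_rhs[OF has_integral_eq[OF _ i1]])
    show "(A a * (C x * (\<Lambda> * v x)) - B a * (S x * (\<Lambda> * v x))) *\<^sub>R e1 +
       (\<sigma> * (A a * (S x * (\<Lambda> * v x)) + B a * (C x * (\<Lambda> * v x)))) *\<^sub>R e2 = (\<Lambda> * v x) *\<^sub>R T x"
      if "x \<in> {a..b}" for x
      unfolding Tdec[OF that] T1eq[OF that] T2eq[OF that] by (simp add: algebra_simps)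
  qed simp
  moreover have "((\<lambda>x. \<Lambda> *\<^sub>R (v x *\<^sub>R T x)) has_integral \<Lambda> *\<^sub>R (\<gamma> b - \<gamma> a)) {a..b}"
    using ab der by (intro has_integral_cmul fundamental_theorem_of_calculus) auto
  ultimately have "\<Lambda> *\<^sub>R (\<gamma> b - \<gamma> a) = 0"
    using has_integral_unique[of "\<lambda>x. (\<Lambda> * v x) *\<^sub>R T x" "\<Lambda> *\<^sub>R (\<gamma> b - \<gamma> a)" "{a..b}" 0] by simp
  then show "\<gamma> a = \<gamma> b" using \<Lambda>(1) by simp
  have i2: "((\<lambda>x. \<Lambda> * ((elastica_curvature (y x))\<^sup>2 * (\<Lambda> * v x))) has_integral
      \<Lambda> * (4 * (jacobi_E (y b) m_star - (1 - m_star) * y b) - 4 * (jacobi_E (y a) m_star - (1 - m_star) * y a))) {a..b}"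
    by (intro has_integral_mult_right integral_compose_primitive[OF less_imp_le[OF ab] yd elastica_energy_primitive])
  have en: "((\<lambda>x. (\<omega> x)\<^sup>2 / v x) has_integral \<Lambda> * (8 * (E - (1 - m_star) * K))) {a..b}"
  proof (rule has_integral_eq_rhs[OF has_integral_eq[OF _ i2]])
    show "\<Lambda> * ((elastica_curvature (y x))\<^sup>2 * (\<Lambda> * v x)) = (\<omega> x)\<^sup>2 / v x" if "x \<in> {a..b}" for x
      using v(2)[OF that] by (simp add: \<omega>_def power2_eq_square)
  qed (simp add: ya yb jv)
  have "bending_energy a b \<gamma> = integral {a..b} (\<lambda>x. (norm (g x))\<^sup>2 / v x)"
    unfolding v_def using T P v(2) by (intro bending_energy_ac[OF ab]) (auto simp: T_def v_def)
  also have "\<dots> = integral {a..b} (\<lambda>x. (\<omega> x)\<^sup>2 / v x)"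
    by (rule integral_spike[OF N]) (simp add: frenet)
  also have "\<dots> = \<Lambda> * (8 * (E - (1 - m_star) * K))" using en by (rule integral_unique)
  finally have "normalized_bending_energy a b \<gamma> = (\<Lambda> * L) * (8 * (E - (1 - m_star) * K))"
    unfolding normalized_bending_energy_def L_def by simp
  then show "normalized_bending_energy a b \<gamma> = varpi_star"
    unfolding \<Lambda>(2) K(2) varpi_star_def E_def[symmetric] by (simp add: power2_eq_square algebra_simps)
qed


section \<open>Existence of a half-fold figure-eight elastica\<close>

lemma has_ac_deriv_C1_vector:
  fixes F f :: "real \<Rightarrow> 'a::euclidean_space"
  assumes "continuous_on UNIV f" "\<And>x. (F has_vector_derivative f x) (at x)"
  shows "has_ac_deriv a b F f"
  by (rule has_ac_deriv_C1[OF continuous_on_subset[OF assms(1) subset_UNIV]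
        has_vector_derivative_at_within[OF assms(2)]])

lemma L2_on_continuous:
  fixes f :: "real \<Rightarrow> 'a::euclidean_space"
  assumes "continuous_on UNIV f"
  shows "L2_on a b f"
  unfolding L2_on_def integrable_lebesgue_on_Ioo
proof
  show "f \<in> borel_measurable (lebesgue_on {a<..<b})"
    by (intro continuous_imp_measurable_on_sets_lebesgue continuous_on_subset[OF assms subset_UNIV]) simp
  show "(\<lambda>x. (norm (f x))\<^sup>2) absolutely_integrable_on {a..b}"
    by (intro absolutely_integrable_continuous_real continuous_intros continuous_on_subset[OF assms subset_UNIV])
qed

text \<open>The curve is written down from the primitives of cos \<phi> and sin \<phi>. With the
  affine parameter y = 2 K x - K and the factor 1 / (2 K), it has unit speed on [0, 1]; length and
  arclength are then trivial and the scale \<Lambda> is 2 K.\<close>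

lemma figure_eight_exists:
  fixes e1 e2 :: "'a::euclidean_space"
  assumes e: "norm e1 = 1" "norm e2 = 1" "e1 \<bullet> e2 = 0"
  shows "\<exists>\<gamma> :: real \<Rightarrow> 'a. half_fold_figure_eight_elastica 0 1 \<gamma>"
proof -
  note m = m_star(1,2)
  have ee: "e1 \<bullet> e1 = 1" "e2 \<bullet> e2 = 1" "e2 \<bullet> e1 = 0"
    using e by (simp_all add: dot_square_norm inner_commute)
  define K where "K = ell_K m_star"
  have K: "K > 0" unfolding K_def using ell_K_pos[of m_star] m by simp
  define y where "y x = 2 * K * x - K" for x
  have yd: "(y has_real_derivative 2 * K) (at x)" for x
    unfolding y_def[abs_def] by (auto intro!: derivative_eq_intros)
  have cy: "continuous_on UNIV y" unfolding y_def[abs_def] by (intro continuous_intros)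
  note comp = continuous_on_compose2[OF _ cy subset_UNIV]
  define \<gamma> where "\<gamma> x = ((2 * jacobi_E (y x) m_star - y x) / (2 * K)) *\<^sub>R e1
    + (- elastica_curvature (y x) / (2 * K)) *\<^sub>R e2" for x
  define W where "W x = elastica_cos (y x) *\<^sub>R e1 + elastica_sin (y x) *\<^sub>R e2" for x
  define \<omega> where "\<omega> x = elastica_curvature (y x) * (2 * K)" for x
  define h where "h x = (- \<omega> x * elastica_sin (y x)) *\<^sub>R e1 + (\<omega> x * elastica_cos (y x)) *\<^sub>R e2" for x
  have cW: "continuous_on UNIV W"
    unfolding W_def[abs_def]
    by (intro continuous_intros comp[OF continuous_on_elastica(1)] comp[OF continuous_on_elastica(2)])
  have ch: "continuous_on UNIV h"
    unfolding h_def[abs_def] \<omega>_def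
    by (intro continuous_intros comp[OF continuous_on_elastica(1)] comp[OF continuous_on_elastica(2)]
        comp[OF continuous_on_elastica(3)])
  have pair: "((\<lambda>x. f x *\<^sub>R e1 + g x *\<^sub>R e2) has_vector_derivative f' *\<^sub>R e1 + g' *\<^sub>R e2) (at x)"
    if "(f has_real_derivative f') (at x)" "(g has_real_derivative g') (at x)" for f g f' g' x
    using that by (auto intro!: derivative_eq_intros)
  have d\<gamma>: "(\<gamma> has_vector_derivative W x) (at x)" for x
  proof -
    have "((\<lambda>x. (2 * jacobi_E (y x) m_star - y x) / (2 * K)) has_real_derivative elastica_cos (y x)) (at x)"
      using DERIV_cdivide[OF DERIV_chain2[OF elastica_cos_primitive yd], of "2 * K" x] K by simp
    moreover have "((\<lambda>x. - elastica_curvature (y x) / (2 * K)) has_real_derivative elastica_sin (y x)) (at x)"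
      using DERIV_cdivide[OF DERIV_chain2[OF elastica_sin_primitive yd], of "2 * K" x] K by simp
    ultimately show ?thesis unfolding \<gamma>_def[abs_def] W_def by (rule pair)
  qed
  have dW: "(W has_vector_derivative h x) (at x)" for x
  proof -
    have "((\<lambda>x. elastica_cos (y x)) has_real_derivative - \<omega> x * elastica_sin (y x)) (at x)"
      using DERIV_chain2[OF elastica_cos_deriv yd, of x] unfolding \<omega>_def by (simp add: mult_ac)
    moreover have "((\<lambda>x. elastica_sin (y x)) has_real_derivative \<omega> x * elastica_cos (y x)) (at x)"
      using DERIV_chain2[OF elastica_sin_deriv yd, of x] unfolding \<omega>_def by (simp add: mult_ac)
    ultimately show ?thesis unfolding W_def[abs_def] h_def by (rule pair)
  qed
  have c\<gamma>: "continuous_on UNIV \<gamma>"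
    using d\<gamma> by (meson continuous_at_imp_continuous_on has_vector_derivative_continuous)
  have cd: "curve_deriv 0 1 \<gamma> x = W x" if "x \<in> {0..1}" for x
    unfolding curve_deriv_def
    by (rule vector_derivative_within_closed_interval[OF _ that has_vector_derivative_at_within[OF d\<gamma>]]) simp
  have nW: "norm (W x) = 1" for x
  proof -
    have "(norm (W x))\<^sup>2 = (elastica_cos (y x))\<^sup>2 + (elastica_sin (y x))\<^sup>2"
      unfolding power2_norm_eq_inner W_def
      by (simp add: inner_add_left inner_add_right ee e(3) power2_eq_square)
    then have "(norm (W x))\<^sup>2 = 1\<^sup>2" unfolding elastica_cos_sin by simp
    then show ?thesis by (rule power2_eq_imp_eq) simp_all
  qed
  have sp: "speed 0 1 \<gamma> x = 1" if "x \<in> {0..1}" for x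
    unfolding speed_def cd[OF that] by (rule nW)
  have ut: "unit_tangent 0 1 \<gamma> x = W x" if "x \<in> {0..1}" for x
    unfolding unit_tangent_def sp[OF that] cd[OF that] by simp
  have csp: "continuous_on {0..1} (speed 0 1 \<gamma>)"
    by (rule continuous_on_eq[OF continuous_on_const[of _ 1]]) (simp add: sp)
  have len: "curve_length 0 1 \<gamma> = 1"
  proof -
    have "curve_length 0 1 \<gamma> = integral {0..1} (speed 0 1 \<gamma>)"
      by (rule curve_length_integral[OF csp])
    also have "\<dots> = integral {0..1::real} (\<lambda>_. 1)" by (rule integral_cong) (rule sp)
    finally show ?thesis by simp
  qed
  have arc: "arclength 0 1 \<gamma> x = x" if "x \<in> {0..1}" for x
  proof -
    have "arclength 0 1 \<gamma> x = integral {0..x} (speed 0 1 \<gamma>)"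
      using that by (intro arclength_integral csp) simp
    also have "\<dots> = integral {0..x} (\<lambda>_. 1)" using that by (intro integral_cong sp) auto
    finally show ?thesis using that by simp
  qed
  have imm: "immersed_H2_curve 0 1 \<gamma>"
    unfolding immersed_H2_curve_def W22_on_def
  proof (intro conjI exI ballI)
    show "L2_on 0 1 \<gamma>" "L2_on 0 1 W" "L2_on 0 1 h"
      by (intro L2_on_continuous c\<gamma> cW ch)+
    show "has_weak_derivative 0 1 \<gamma> W"
      by (rule has_weak_derivative_if_ac[OF has_ac_deriv_C1_vector[OF cW d\<gamma>]])
    show "has_weak_derivative 0 1 W h"
      by (rule has_weak_derivative_if_ac[OF has_ac_deriv_C1_vector[OF ch dW]])
    show "curve_deriv 0 1 \<gamma> x \<noteq> 0" if "x \<in> {0..1}" for x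
      using cd[OF that] nW[of x] by auto
  qed (use continuous_on_subset[OF c\<gamma> subset_UNIV] in simp_all)
  have "has_ac_deriv 0 1 (unit_tangent 0 1 \<gamma>) h"
    by (rule has_ac_deriv_cong[OF has_ac_deriv_C1_vector[OF ch dW]]) (simp_all add: ut)
  then obtain N where N: "negligible N"
    "\<forall>x\<in>{0..1} - N. curvature 0 1 \<gamma> x = (1 / speed 0 1 \<gamma> x) *\<^sub>R h x"
    using curvature_ac[of 0 1 \<gamma> h] by auto
  have "signed_curvature e1 e2 0 1 \<gamma> x = 1 * (2 * sqrt m_star * (2 * K / 1) *
      jacobi_cn (2 * K / 1 * arclength 0 1 \<gamma> x - K) m_star)" if x: "x \<in> {0..1} - N" for x
  proof -
    have x': "x \<in> {0..1}" using x by blast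
    have W: "W x \<bullet> e1 = elastica_cos (y x)" "W x \<bullet> e2 = elastica_sin (y x)"
      unfolding W_def by (simp_all add: inner_add_left ee e(3))
    have "curvature 0 1 \<gamma> x = h x" using N(2) x sp[OF x'] by simp
    then have "signed_curvature e1 e2 0 1 \<gamma> x
        = h x \<bullet> (elastica_cos (y x) *\<^sub>R e2 - elastica_sin (y x) *\<^sub>R e1)"
      unfolding signed_curvature_def Let_def ut[OF x'] W by simp
    also have "\<dots> = \<omega> x * ((elastica_cos (y x))\<^sup>2 + (elastica_sin (y x))\<^sup>2)"
      unfolding h_def
      by (simp add: inner_add_left inner_diff_right ee e(3) power2_eq_square algebra_simps)
    also have "\<dots> = \<omega> x" unfolding elastica_cos_sin by simp
    finally show ?thesis
      unfolding arc[OF x'] \<omega>_def elastica_curvature_def y_def by simp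
  qed
  then have ae: "AE x in lebesgue_on {0..1}. signed_curvature e1 e2 0 1 \<gamma> x = 1 * (2 * sqrt m_star * (2 * K / 1) *
      jacobi_cn (2 * K / 1 * arclength 0 1 \<gamma> x - K) m_star)"
    by (subst AE_lebesgue_on_iff_negligible) (use N(1) in auto)
  have "half_fold_figure_eight_elastica 0 1 \<gamma>"
    unfolding half_fold_figure_eight_elastica_def Let_def len K_def[symmetric]
  proof (intro conjI exI ballI)
    show "\<gamma> x - 0 \<in> span {e1, e2}" if "x \<in> {0..1}" for x
      unfolding \<gamma>_def diff_zero by (intro span_add span_scale span_base) simp_all
  qed (use imm e ae in auto)
  then show ?thesis by blast
qed

theorem theorem2p7:
  assumes "CARD('n::finite) \<ge> 2"
  shows
    "(\<forall>(k::nat) (\<gamma> :: real \<Rightarrow> real ^ 'n).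
        k \<ge> 2 \<longrightarrow> immersed_H2_curve 0 1 \<gamma> \<longrightarrow> has_point_of_multiplicity 0 1 \<gamma> k \<longrightarrow>
        normalized_bending_energy 0 1 \<gamma> \<ge> varpi_star * (real k - 1)\<^sup>2) \<and>
     (\<forall>\<gamma> :: real \<Rightarrow> real ^ 'n.
        immersed_H2_curve 0 1 \<gamma> \<longrightarrow> normalized_bending_energy 0 1 \<gamma> < varpi_star \<longrightarrow>
        inj_on \<gamma> {0..1}) \<and>
     (\<forall>a b (\<gamma> :: real \<Rightarrow> real ^ 'n).
        half_fold_figure_eight_elastica a b \<gamma> \<longrightarrow>
        immersed_H2_curve a b \<gamma> \<and> \<not> inj_on \<gamma> {a..b} \<and>
        normalized_bending_energy a b \<gamma> = varpi_star) \<and>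
     (\<exists>\<gamma> :: real \<Rightarrow> real ^ 'n. half_fold_figure_eight_elastica 0 1 \<gamma>) \<and>
     (\<forall>c. (\<forall>\<gamma> :: real \<Rightarrow> real ^ 'n.
             immersed_H2_curve 0 1 \<gamma> \<longrightarrow> normalized_bending_energy 0 1 \<gamma> < c \<longrightarrow>
             inj_on \<gamma> {0..1})
          \<longrightarrow> c \<le> varpi_star)"
proof (intro conjI allI impI)
  show "varpi_star * (real k - 1)\<^sup>2 \<le> normalized_bending_energy 0 1 \<gamma>"
    if "k \<ge> 2" "immersed_H2_curve 0 1 \<gamma>" "has_point_of_multiplicity 0 1 \<gamma> k"
    for k and \<gamma> :: "real \<Rightarrow> real ^ 'n"
    using that by (intro multiplicity_energy_bound) auto
  show "inj_on \<gamma> {0..1}"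
    if \<gamma>: "immersed_H2_curve 0 1 \<gamma>" "normalized_bending_energy 0 1 \<gamma> < varpi_star"
    for \<gamma> :: "real \<Rightarrow> real ^ 'n"
  proof (rule inj_onI, rule ccontr)
    fix s t :: real assume "s \<in> {0..1}" "t \<in> {0..1}" "\<gamma> s = \<gamma> t" "s \<noteq> t"
    then have "has_point_of_multiplicity 0 1 \<gamma> 2"
      unfolding has_point_of_multiplicity_def by (intro exI[of _ "\<gamma> s"] exI[of _ "{s, t}"]) auto
    from multiplicity_energy_bound[OF \<gamma>(1) _ this] \<gamma>(2) show False by simp
  qed
  have fig8: "immersed_H2_curve a b \<gamma> \<and> \<not> inj_on \<gamma> {a..b} \<and> normalized_bending_energy a b \<gamma> = varpi_star"
    if "half_fold_figure_eight_elastica a b \<gamma>" for a b and \<gamma> :: "real \<Rightarrow> real ^ 'n"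
  proof (intro conjI)
    show imm: "immersed_H2_curve a b \<gamma>"
      using that unfolding half_fold_figure_eight_elastica_def by blast
    then have "a < b" unfolding immersed_H2_curve_def by blast
    then show "\<not> inj_on \<gamma> {a..b}"
      using figure_eight_closed_energy(1)[OF that] inj_onD[of \<gamma> "{a..b}" a b] by auto
  qed (rule figure_eight_closed_energy(2)[OF that])
  then show "immersed_H2_curve a b \<gamma>" "\<not> inj_on \<gamma> {a..b}" "normalized_bending_energy a b \<gamma> = varpi_star"
    if "half_fold_figure_eight_elastica a b \<gamma>" for a b and \<gamma> :: "real \<Rightarrow> real ^ 'n"
    using that by blast+
  have "\<not> card (UNIV :: 'n set) \<le> Suc 0" using assms by simp
  then obtain i j :: 'n where "i \<noteq> j"
    using card_le_Suc0_iff_eq[of "UNIV :: 'n set"] by auto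
  then show ex: "\<exists>\<gamma> :: real \<Rightarrow> real ^ 'n. half_fold_figure_eight_elastica 0 1 \<gamma>"
    by (intro figure_eight_exists[of "axis i 1" "axis j 1"]) (simp_all add: norm_axis_1 inner_axis_axis)
  \<comment> \<open>If \<open>c\<close> exceeded \<open>varpi_star\<close>, the figure-eight curve
    on [0, 1] would have energy below \<open>c\<close> without being injective.\<close>
  show "c \<le> varpi_star"
    if c: "\<forall>\<gamma> :: real \<Rightarrow> real ^ 'n. immersed_H2_curve 0 1 \<gamma> \<longrightarrow> normalized_bending_energy 0 1 \<gamma> < c \<longrightarrow>
             inj_on \<gamma> {0..1}" for c
    using ex fig8 c by (metis linorder_not_le)
qed

end
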